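(* Let $\Delta$ be a consistently oriented connectivity complex with vertex set $\{1,\ldots,N_V\}$, let $Q_{\mathrm{ref}}\in\mathcal{M}_+(\Delta)$, and let $\beta_1,\beta_2,\beta_3>0$. For each boundary $1$-face $[j_0,j_1]\in E_\partial$ and each boundary vertex $i_0\in V_\partial$ with $i_0\ne j_0,j_1$, let $Q\mapsto D^\mu_Q(i_0;[j_0,j_1])$ be a continuous function on $\mathcal{M}_+(\Delta)$ satisfying $$0<D^\mu_Q(i_0;[j_0,j_1])\le D_Q(i_0;[j_0,j_1])\quad\text{for all } Q\in\mathcal{M}_+(\Delta),$$ and define $f^\mu:\mathcal{M}_+(\Delta)\to\mathbb{R}$ by $$f^\mu(Q)=\sum_{k=1}^{N_T}\sum_{\ell=0}^{2}\frac{\beta_1}{h_Q^\ell(i_0^k,i_1^k,i_2^k)}+\sum_{[j_0,j_1]\in E_\partial}\ \sum_{\substack{i_0\in V_\partial\\ i_0\ne j_0,j_1}}\frac{\beta_2}{D^\mu_Q(i_0;[j_0,j_1])}+\frac{\beta_3}{2}\|Q-Q_{\mathrm{ref}}\|_F^2 .$$ Then: (a) The restriction of $f^\mu$ to $\mathcal{M}_+(\Delta;Q_{\mathrm{ref}})$ is proper. (b) Suppose in addition that the functions $Q\mapsto D^\mu_Q(i_0;[j_0,j_1])$ are of class $C^3$ on $\mathcal{M}_+(\Delta;Q_{\mathrm{ref}})$. Then $\mathcal{M}_+(\Delta;Q_{\mathrm{ref}})$, endowed with the Riemannian metric whose components (with respect to the chart $\operatorname{vec}$) are $$g_{ab}=\delta_a^b+\frac{\partial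 f^\mu}{\partial(\operatorname{vec}Q)^a}\,\frac{\partial f^\mu}{\partial(\operatorname{vec}Q)^b},\qquad a,b=1,\ldots,2N_V,$$ is geodesically complete.
   Context: An abstract simplicial complex $\Delta$ over a finite set is a non-empty collection of non-empty subsets such that every non-empty subset of an element of $\Delta$ is in $\Delta$. Elements $\sigma\in\Delta$ are faces; $\sigma$ is an $m$-face if $\#\sigma=m+1$; the vertex set of $\Delta$ is the union of its faces. $\Delta$ is a simplicial $2$-complex if the largest dimension of its faces is $2$. It is pure if every maximal face has dimension $2$. It is $2$-path connected if for any two distinct $2$-faces $\sigma,\sigma'$ there is a finite sequence of $2$-faces $\sigma_0=\sigma,\ldots,\sigma_n=\sigma'$ such that $\sigma_i\cap\sigma_{i+1}$ is a $1$-face for all $i$. A connectivity complex is an abstract simplicial $2$-complex which is pure and $2$-path connected. An orientation of a $2$-face $\{i_0,i_1,i_2\}$ is an equivalence class $[i_0,i_1,i_2]$ of orderings modulo even permutations; it induces the orientations $[i_1,i_2],[i_2,i_0],[i_0,i_1]$ on its $1$-faces. $\Delta$ is consistently oriented if each $2$-face has an assigned orientation such that any two distinct $2$-faces sharing a $1$-face induce opposite orientations on that $1$-face. For $Q=[Q_1,\ldots,Q_{N_V}]\in\mathbb{R}^{2\times N_V}$ with columns $Q_i\in\mathbb{R}^2$, let $\Sigma_\Delta(Q)=\{\operatorname{conv}\{Q_{i_0},\ldots,Q_{i_k}\} : \{i_0,\ldots,i_k\}\in\Delta\}$. A geometric simplicial complex in $\mathbb{R}^2$ is a non-empty finite set of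 simplices (convex hulls of affine independent points) containing all faces of its members and such that the non-empty intersection of any two members is a face of both. The abstract simplicial complex associated with $\Sigma_\Delta(Q)$ is $\{\sigma\subset\{1,\ldots,N_V\} : \operatorname{conv}\{Q_i\}_{i\in\sigma}\in\Sigma_\Delta(Q)\}$. $\mathcal{M}_0(\Delta)$ is the set of $Q\in\mathbb{R}^{2\times N_V}$ such that $\Sigma_\Delta(Q)$ is a geometric simplicial complex in $\mathbb{R}^2$ whose associated abstract simplicial complex is $\Delta$. The signed area is $A_Q(i_0,i_1,i_2)=\frac12\det[Q_{i_1}-Q_{i_0},\,Q_{i_2}-Q_{i_1}]$; $\mathcal{M}_+(\Delta)$ is the set of $Q\in\mathcal{M}_0(\Delta)$ with $A_Q(i_0,i_1,i_2)>0$ for all (oriented) $2$-faces $[i_0,i_1,i_2]$ of $\Delta$ (it is open in $\mathbb{R}^{2\times N_V}$). For $Q_{\mathrm{ref}}\in\mathcal{M}_+(\Delta)$, $\mathcal{M}_+(\Delta;Q_{\mathrm{ref}})$ is the set of $Q\in\mathcal{M}_+(\Delta)$ that can be joined to $Q_{\mathrm{ref}}$ by a continuous path in $\mathcal{M}_+(\Delta)$; it is a path component of $\mathcal{M}_+(\Delta)$ and an open submanifold of $\mathbb{R}^{2\times N_V}$. The $2$-faces of $\Delta$ are numbered $[i_0^k,i_1^k,i_2^k]$, $k=1,\ldots,N_T$. For a $2$-face $[i_0,i_1,i_2]$, the heights are $h_Q^\ell(i_0,i_1,i_2)=2A_Q(i_0,i_1,i_2)/\|Q_{i_{\ell\oplus1}}-Q_{i_{\ell\oplus2}}\|$,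 $\ell=0,1,2$, where $\oplus$ is addition modulo $3$ and $\|\cdot\|$ is the Euclidean norm. A $1$-face is a boundary $1$-face if it belongs to exactly one $2$-face; $E_\partial$ is the set of boundary $1$-faces. A $0$-face (vertex) is a boundary $0$-face if it belongs to at least one boundary $1$-face; $V_\partial$ is the set of boundary $0$-faces. For a vertex $i_0$ and a $1$-face $[j_0,j_1]$, $D_Q(i_0;[j_0,j_1])=\min\{\|Q_{i_0}-x\|_1 : x\in\operatorname{conv}\{Q_{j_0},Q_{j_1}\}\}$, where the $1$-norm is taken in an edge-oriented orthonormal coordinate system, i.e., $\|y\|_1=|u\cdot y|+|u^\perp\cdot y|$ with $u=(Q_{j_1}-Q_{j_0})/\|Q_{j_1}-Q_{j_0}\|$ and $u^\perp$ a unit vector orthogonal to $u$. $\|\cdot\|_F$ is the Frobenius norm. A function $f:\mathcal{M}\to\mathbb{R}$ is proper if preimages of compact subsets of $\mathbb{R}$ are compact in $\mathcal{M}$. $\operatorname{vec}:\mathbb{R}^{2\times N_V}\to\mathbb{R}^{2N_V}$ stacks the columns, $\delta_a^b$ is the Kronecker delta. A Riemannian manifold is geodesically complete if all geodesics exist for all $t\in\mathbb{R}$. *)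

theory Defs
  imports "HOL-Analysis.Analysis"
begin

section \<open>Abstract simplicial 2-complexes\<close>

definition abstract_simplicial_complex :: "'v set set \<Rightarrow> bool" where
  "abstract_simplicial_complex \<Delta> \<longleftrightarrow>
     finite (\<Union>\<Delta>) \<and> \<Delta> \<noteq> {} \<and> {} \<notin> \<Delta> \<and>
     (\<forall>\<sigma>\<in>\<Delta>. \<forall>\<tau>. \<tau> \<noteq> {} \<and> \<tau> \<subseteq> \<sigma> \<longrightarrow> \<tau> \<in> \<Delta>)"

definition faces :: "nat \<Rightarrow> 'v set set \<Rightarrow> 'v set set" where
  "faces m \<Delta> = {\<sigma>\<in>\<Delta>. card \<sigma> = m + 1}"

definition simplicial_2_complex :: "'v set set \<Rightarrow> bool" where
  "simplicial_2_complex \<Delta> \<longleftrightarrow>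
     abstract_simplicial_complex \<Delta> \<and> faces 2 \<Delta> \<noteq> {} \<and> (\<forall>\<sigma>\<in>\<Delta>. card \<sigma> \<le> 3)"

definition pure_2_complex :: "'v set set \<Rightarrow> bool" where
  "pure_2_complex \<Delta> \<longleftrightarrow>
     (\<forall>\<sigma>\<in>\<Delta>. (\<forall>\<tau>\<in>\<Delta>. \<sigma> \<subseteq> \<tau> \<longrightarrow> \<tau> = \<sigma>) \<longrightarrow> \<sigma> \<in> faces 2 \<Delta>)"

definition two_path_connected :: "'v set set \<Rightarrow> bool" where
  "two_path_connected \<Delta> \<longleftrightarrow>
     (\<forall>\<sigma>\<in>faces 2 \<Delta>. \<forall>\<sigma>'\<in>faces 2 \<Delta>. \<sigma> \<noteq> \<sigma>' \<longrightarrow>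
        (\<exists>(n::nat) s. s 0 = \<sigma> \<and> s n = \<sigma>' \<and> (\<forall>i\<le>n. s i \<in> faces 2 \<Delta>) \<and>
                      (\<forall>i<n. s i \<inter> s (Suc i) \<in> faces 1 \<Delta>)))"

definition connectivity_complex :: "'v set set \<Rightarrow> bool" where
  "connectivity_complex \<Delta> \<longleftrightarrow>
     simplicial_2_complex \<Delta> \<and> pure_2_complex \<Delta> \<and> two_path_connected \<Delta>"

definition boundary_edges :: "'v set set \<Rightarrow> 'v set set" where
  "boundary_edges \<Delta> = {e\<in>faces 1 \<Delta>. card {\<sigma>\<in>faces 2 \<Delta>. e \<subseteq> \<sigma>} = 1}"

definition boundary_vertices :: "'v set set \<Rightarrow> 'v set" where
  "boundary_vertices \<Delta> = {v. \<exists>e\<in>boundary_edges \<Delta>. v \<in> e}"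


section \<open>Orientations\<close>

text \<open>An ordering \<open>(i\<^sub>0, i\<^sub>1, i\<^sub>2)\<close> of a 2-face is a function \<open>t\<close> on the type \<^typ>\<open>3\<close>, whose
  elements are \<open>0\<close>, \<open>1\<close>, \<open>2\<close> and whose addition is addition modulo 3. The oriented face
  \<open>[i\<^sub>0, i\<^sub>1, i\<^sub>2]\<close> is the class of \<open>t\<close> modulo even permutations of the positions.\<close>

definition oriented_class :: "(3 \<Rightarrow> 'v) \<Rightarrow> (3 \<Rightarrow> 'v) set" where
  "oriented_class t = {t \<circ> p | p. p permutes (UNIV :: 3 set) \<and> evenperm p}"

definition orientation_of :: "'v set \<Rightarrow> (3 \<Rightarrow> 'v) set \<Rightarrow> bool" where
  "orientation_of \<sigma> C \<longleftrightarrow> (\<exists>t. bij_betw t UNIV \<sigma> \<and> C = oriented_class t)"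

text \<open>The induced oriented edges \<open>[i\<^sub>1, i\<^sub>2]\<close>, \<open>[i\<^sub>2, i\<^sub>0]\<close>, \<open>[i\<^sub>0, i\<^sub>1]\<close>. The only even permutation of
  two positions is the identity, so an oriented edge is just an ordered pair.\<close>

definition induced_edges :: "(3 \<Rightarrow> 'v) set \<Rightarrow> ('v \<times> 'v) set" where
  "induced_edges C = {(t (l + 1), t (l + 2)) | t l. t \<in> C}"

definition consistently_oriented :: "'v set set \<Rightarrow> ('v set \<Rightarrow> (3 \<Rightarrow> 'v) set) \<Rightarrow> bool" where
  "consistently_oriented \<Delta> ori \<longleftrightarrow>
     (\<forall>\<sigma>\<in>faces 2 \<Delta>. orientation_of \<sigma> (ori \<sigma>)) \<and>
     (\<forall>\<sigma>\<in>faces 2 \<Delta>. \<forall>\<sigma>'\<in>faces 2 \<Delta>. \<forall>a b. \<sigma> \<noteq> \<sigma>' \<and> {a, b} \<in> faces 1 \<Delta> \<and> {a, b} \<subseteq> \<sigma> \<inter> \<sigma>' \<longrightarrow>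
        ((a, b) \<in> induced_edges (ori \<sigma>) \<longleftrightarrow> (b, a) \<in> induced_edges (ori \<sigma>')))"

text \<open>\<open>T k\<close> is the representative \<open>(i\<^sub>0\<^sup>k, i\<^sub>1\<^sup>k, i\<^sub>2\<^sup>k)\<close> of the \<open>k\<close>-th oriented 2-face.\<close>

definition numbering_2_faces ::
    "'v set set \<Rightarrow> ('v set \<Rightarrow> (3 \<Rightarrow> 'v) set) \<Rightarrow> nat \<Rightarrow> (nat \<Rightarrow> 3 \<Rightarrow> 'v) \<Rightarrow> bool" where
  "numbering_2_faces \<Delta> ori N T \<longleftrightarrow>
     bij_betw (\<lambda>k. range (T k)) {1..N} (faces 2 \<Delta>) \<and>
     (\<forall>k\<in>{1..N}. T k \<in> ori (range (T k)))"


section \<open>Planar realizations\<close>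

text \<open>A matrix with 2 rows and \<open>N\<^sub>V\<close> columns is an element of \<^typ>\<open>real^'n^2\<close> with
  \<open>N\<^sub>V = CARD('n)\<close>; the point \<open>Q\<^sub>i\<close> is \<^term>\<open>column i Q\<close>, and \<^const>\<open>norm\<close> is the Frobenius norm.\<close>

definition realization :: "'n set set \<Rightarrow> real^'n^2 \<Rightarrow> (real^2) set set" where
  "realization \<Delta> Q = {convex hull ((\<lambda>i. column i Q) ` \<sigma>) | \<sigma>. \<sigma> \<in> \<Delta>}"

text \<open>Unlike \<^const>\<open>simplicial_complex\<close>, the empty set is not admitted as a simplex or a face.\<close>

definition geometric_simplicial_complex :: "'a::euclidean_space set set \<Rightarrow> bool" where
  "geometric_simplicial_complex K \<longleftrightarrow>
     K \<noteq> {} \<and> finite K \<and>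
     (\<forall>S\<in>K. \<exists>n\<ge>0. n simplex S) \<and>
     (\<forall>S\<in>K. \<forall>F. F face_of S \<and> F \<noteq> {} \<longrightarrow> F \<in> K) \<and>
     (\<forall>S\<in>K. \<forall>S'\<in>K. S \<inter> S' \<noteq> {} \<longrightarrow> (S \<inter> S') face_of S \<and> (S \<inter> S') face_of S')"

definition associated_complex :: "'n set set \<Rightarrow> real^'n^2 \<Rightarrow> 'n set set" where
  "associated_complex \<Delta> Q = {\<sigma>. convex hull ((\<lambda>i. column i Q) ` \<sigma>) \<in> realization \<Delta> Q}"

definition M_zero :: "'n::finite set set \<Rightarrow> (real^'n^2) set" where
  "M_zero \<Delta> = {Q. geometric_simplicial_complex (realization \<Delta> Q) \<and> associated_complex \<Delta> Q = \<Delta>}"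

definition signed_area :: "real^'n^2 \<Rightarrow> (3 \<Rightarrow> 'n) \<Rightarrow> real" where
  "signed_area Q t =
     1/2 * det (transpose (vector [column (t 1) Q - column (t 0) Q,
                                   column (t 2) Q - column (t 1) Q] :: real^2^2))"

definition M_plus :: "'n::finite set set \<Rightarrow> ('n set \<Rightarrow> (3 \<Rightarrow> 'n) set) \<Rightarrow> (real^'n^2) set" where
  "M_plus \<Delta> ori = {Q\<in>M_zero \<Delta>. \<forall>\<sigma>\<in>faces 2 \<Delta>. \<forall>t\<in>ori \<sigma>. signed_area Q t > 0}"

definition M_plus_comp ::
    "'n::finite set set \<Rightarrow> ('n set \<Rightarrow> (3 \<Rightarrow> 'n) set) \<Rightarrow> real^'n^2 \<Rightarrow> (real^'n^2) set" where
  "M_plus_comp \<Delta> ori Qref = path_component_set (M_plus \<Delta> ori) Qref"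

definition height :: "real^'n^2 \<Rightarrow> 3 \<Rightarrow> (3 \<Rightarrow> 'n) \<Rightarrow> real" where
  "height Q l t = 2 * signed_area Q t / norm (column (t (l + 1)) Q - column (t (l + 2)) Q)"

definition perp :: "real^2 \<Rightarrow> real^2" where
  "perp u = vector [- u$2, u$1]"

definition edge_norm1 :: "real^2 \<Rightarrow> real^2 \<Rightarrow> real" where
  "edge_norm1 u y = \<bar>u \<bullet> y\<bar> + \<bar>perp u \<bullet> y\<bar>"

text \<open>The infimum is a minimum, because the segment is compact and the norm is continuous.\<close>

definition edge_dist :: "real^'n^2 \<Rightarrow> 'n \<Rightarrow> 'n \<Rightarrow> 'n \<Rightarrow> real" where
  "edge_dist Q i0 j0 j1 =
     (let u = (column j1 Q - column j0 Q) /\<^sub>R norm (column j1 Q - column j0 Q)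
      in INF x\<in>convex hull {column j0 Q, column j1 Q}. edge_norm1 u (column i0 Q - x))"

definition proper_on :: "'a::topological_space set \<Rightarrow> ('a \<Rightarrow> real) \<Rightarrow> bool" where
  "proper_on M f \<longleftrightarrow> (\<forall>K. compact K \<longrightarrow> compact {x\<in>M. f x \<in> K})"


section \<open>Riemannian metrics on open sets in global coordinates\<close>

definition partial_deriv :: "('a::euclidean_space \<Rightarrow> real) \<Rightarrow> 'a \<Rightarrow> 'a \<Rightarrow> real" where
  "partial_deriv f b x = frechet_derivative f (at x) b"

text \<open>Functions of class \<open>C\<^sup>k\<close>; to be used for open \<open>S\<close>.\<close>

fun Ck_on :: "nat \<Rightarrow> ('a::euclidean_space \<Rightarrow> real) \<Rightarrow> 'a set \<Rightarrow> bool" where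
  "Ck_on 0 f S \<longleftrightarrow> continuous_on S f"
| "Ck_on (Suc k) f S \<longleftrightarrow>
     (\<forall>x\<in>S. f differentiable (at x)) \<and> (\<forall>b\<in>Basis. Ck_on k (partial_deriv f b) S)"

text \<open>The metric is only required to be of class \<open>C\<^sup>2\<close>, so that the Christoffel symbols are \<open>C\<^sup>1\<close> and
  geodesics are determined by their initial data.\<close>

definition riemannian_metric_on :: "(real^'m) set \<Rightarrow> (real^'m \<Rightarrow> real^'m^'m) \<Rightarrow> bool" where
  "riemannian_metric_on U g \<longleftrightarrow>
     open U \<and> (\<forall>a b. Ck_on 2 (\<lambda>x. g x $ a $ b) U) \<and>
     (\<forall>x\<in>U. transpose (g x) = g x \<and> (\<forall>v. v \<noteq> 0 \<longrightarrow> v \<bullet> (g x *v v) > 0))"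

definition christoffel ::
    "(real^'m \<Rightarrow> real^'m^'m) \<Rightarrow> real^'m \<Rightarrow> 'm::finite \<Rightarrow> 'm \<Rightarrow> 'm \<Rightarrow> real" where
  "christoffel g x k i j =
     1/2 * (\<Sum>l\<in>UNIV. matrix_inv (g x) $ k $ l *
       (partial_deriv (\<lambda>y. g y $ j $ l) (axis i 1) x
        + partial_deriv (\<lambda>y. g y $ i $ l) (axis j 1) x
        - partial_deriv (\<lambda>y. g y $ i $ j) (axis l 1) x))"

text \<open>\<open>I\<close> is meant to be an open interval.\<close>

definition geodesic_on ::
    "(real^'m) set \<Rightarrow> (real^'m \<Rightarrow> real^'m^'m) \<Rightarrow> real set \<Rightarrow> (real \<Rightarrow> real^'m::finite) \<Rightarrow> bool" where
  "geodesic_on U g I \<gamma> \<longleftrightarrow>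
     (\<forall>t\<in>I. \<gamma> t \<in> U) \<and>
     (\<exists>v. \<forall>t\<in>I. (\<gamma> has_vector_derivative v t) (at t) \<and>
        (v has_vector_derivative
           (\<chi> k. - (\<Sum>i\<in>UNIV. \<Sum>j\<in>UNIV. christoffel g (\<gamma> t) k i j * v t $ i * v t $ j))) (at t))"

definition geodesically_complete ::
    "(real^'m) set \<Rightarrow> (real^'m \<Rightarrow> real^'m^'m::finite) \<Rightarrow> bool" where
  "geodesically_complete U g \<longleftrightarrow>
     (\<forall>I \<gamma>. open I \<and> is_interval I \<and> I \<noteq> {} \<and> geodesic_on U g I \<gamma> \<longrightarrow>
        (\<exists>\<gamma>'. geodesic_on U g UNIV \<gamma>' \<and> (\<forall>t\<in>I. \<gamma>' t = \<gamma> t)))"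

text \<open>Stacking columns: the coordinate index \<open>(i, r)\<close> is row \<open>r\<close> of column \<open>i\<close>, so that
  \<open>CARD('n \<times> 2) = 2 N\<^sub>V\<close>.\<close>

definition vec_mat :: "real^'n^2 \<Rightarrow> real^('n \<times> 2)" where
  "vec_mat Q = (\<chi> a. Q $ snd a $ fst a)"

definition f_metric :: "(real^'n^2 \<Rightarrow> real) \<Rightarrow> real^('n::finite \<times> 2) \<Rightarrow> real^('n \<times> 2)^('n \<times> 2)" where
  "f_metric f x =
     (\<chi> a b. (if a = b then 1 else 0)
        + partial_deriv (f \<circ> inv vec_mat) (axis a 1) x * partial_deriv (f \<circ> inv vec_mat) (axis b 1) x)"

end

theory Submission
  imports Defs
begin

text \<open>
  Where \<open>f\<close> is bounded, each of its summands is bounded, so the heights of all triangles are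
  bounded below, boundary vertices keep a distance from the boundary edges they do not belong
  to, and the configuration stays in a ball. The point is that a limit \<open>Q\<close> of such
  configurations is again in \<open>M_plus \<Delta> ori\<close> (\<open>limit_in_M_plus\<close>). Heights bounded below make the
  triangles of \<open>Q\<close> nondegenerate and positively oriented (\<open>signed_area_ge_if_heights_ge\<close>); what
  could fail is that two triangles of \<open>Q\<close> meet outside their common face.

  For positively oriented \<open>Q\<close>, membership in \<open>M_plus \<Delta> ori\<close> amounts to linear algebra: any two
  2-faces \<open>\<sigma>\<close>, \<open>\<tau>\<close> are \<open>separated\<close>, i.e. there is no nontrivial affine relation \<open>Q *v w = 0\<close>,
  \<open>\<Sum>w = 0\<close> whose coefficients are nonnegative off \<open>\<tau>\<close> and nonpositive off \<open>\<sigma>\<close> (\<open>M_plus_iff\<close>).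
  This is an open condition, so \<open>M_plus \<Delta> ori\<close> is open. For distinct 2-faces it implies that
  some line has \<open>\<sigma>\<close> on one side and \<open>\<tau>\<close> on the other, which is a closed condition and so
  survives in the limit. Hence the triangles of \<open>Q\<close> have disjoint interiors. Suppose that two of
  them touch in a point \<open>x\<close>, in the relative interior of a face \<open>\<rho>\<close> of the one and \<open>\<pi>\<close> of the
  other. If no boundary edge contains \<open>\<rho>\<close>, then the triangles around \<open>\<rho>\<close> cover a neighbourhood
  of \<open>x\<close> (\<open>interior_star\<close>), so one of them overlaps the other triangle and therefore is that
  triangle: \<open>\<rho>\<close> is a common face. The same holds for \<open>\<pi>\<close>. If both lie in boundary edges, a
  vertex cannot touch an edge it does not belong to, by the lower bound on the distances, and
  two edges touching in relatively interior points are collinear, because the separating line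
  contains both; then an endpoint of one lies on the other, which again forces them to be the
  same edge (\<open>separated_if_weakly_separated\<close>).

  Completeness is a consequence of properness. The metric \<open>I + \<nabla>f \<nabla>f\<^sup>T\<close> is the one that the graph
  of \<open>f\<close> inherits from Euclidean space. A geodesic \<open>\<gamma>\<close> has constant energy
  \<open>\<bar>\<gamma>'\<bar>\<^sup>2 + ((f \<circ> \<gamma>)')\<^sup>2\<close>, so on a bounded time interval \<open>f \<circ> \<gamma>\<close> and \<open>\<gamma>'\<close> are bounded. By
  properness \<open>(\<gamma>, \<gamma>')\<close> then stays in a compact subset of the phase space, and a solution of a
  locally Lipschitz differential equation with this property extends to the whole line
  (\<open>solution_extends_to_UNIV\<close>, \<open>graph_metric_complete\<close>). The extension is obtained from the
  local existence theorem of Picard and Lindelof and a maximal solution given by Zorn's lemma.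
\<close>

section \<open>Functions of class \<open>C\<^sup>k\<close>\<close>

lemma partial_deriv_eq:
  assumes "(f has_derivative f') (at x)"
  shows "partial_deriv f b x = f' b"
  using frechet_derivative_at[OF assms] by (simp add: partial_deriv_def)

text \<open>Partial derivatives of order two and higher see a function only through its values near a
  point; this is why \<open>S\<close> has to be open for all the closure properties below.\<close>

lemma Ck_on_cong_imp:
  assumes "open S" "\<And>x. x \<in> S \<Longrightarrow> f x = g x" "Ck_on k f S"
  shows "Ck_on k g S"
  using assms
proof (induction k arbitrary: f g)
  case 0
  then show ?case by (simp cong: continuous_on_cong)
next
  case (Suc k)
  have der: "(g has_derivative frechet_derivative f (at x)) (at x)" if "x \<in> S" for x
  proof -
    have "(f has_derivative frechet_derivative f (at x)) (at x)"
      using Suc.prems that by (simp add: frechet_derivative_works)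
    then show ?thesis
      using has_derivative_transform_within_open Suc.prems(1,2) that by blast
  qed
  have "Ck_on k (partial_deriv g b) S" if "b \<in> Basis" for b
  proof (rule Suc.IH[OF \<open>open S\<close>])
    show "Ck_on k (partial_deriv f b) S" using Suc.prems that by simp
    show "partial_deriv f b x = partial_deriv g b x" if "x \<in> S" for x
      using partial_deriv_eq[OF der[OF that]] by (simp add: partial_deriv_def)
  qed
  then show ?case using der by (auto simp: differentiable_def)
qed

lemma Ck_on_cong:
  assumes "open S" "\<And>x. x \<in> S \<Longrightarrow> f x = g x"
  shows "Ck_on k f S \<longleftrightarrow> Ck_on k g S"
  using Ck_on_cong_imp[OF assms(1), of f g k] Ck_on_cong_imp[OF assms(1), of g f k] assms(2) by auto

lemma Ck_on_Suc_intro: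
  assumes "open S" and der: "\<And>x. x \<in> S \<Longrightarrow> (f has_derivative f' x) (at x)"
    and "\<And>b. b \<in> Basis \<Longrightarrow> Ck_on k (\<lambda>x. f' x b) S"
  shows "Ck_on (Suc k) f S"
proof -
  have "Ck_on k (partial_deriv f b) S" if "b \<in> Basis" for b
    using Ck_on_cong[OF \<open>open S\<close>, of "partial_deriv f b" "\<lambda>x. f' x b" k]
      partial_deriv_eq[OF der] assms(3)[OF that] by simp
  then show ?thesis using der by (auto simp: differentiable_def)
qed

lemma Ck_on_Suc_derivative:
  assumes "Ck_on (Suc k) f S" "x \<in> S"
  shows "(f has_derivative frechet_derivative f (at x)) (at x)"
  using assms by (simp add: frechet_derivative_works)

lemma Ck_on_Suc_partial:
  assumes "Ck_on (Suc k) f S" "b \<in> Basis"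
  shows "Ck_on k (\<lambda>x. frechet_derivative f (at x) b) S"
  using assms by (simp add: partial_deriv_def[abs_def])

lemma Ck_on_SucD: "Ck_on (Suc k) f S \<Longrightarrow> Ck_on k f S"
proof (induction k arbitrary: f)
  case 0
  then have "f differentiable_on S"
    by (auto simp: differentiable_on_def intro: differentiable_at_withinI)
  then show ?case by (simp add: differentiable_imp_continuous_on)
qed auto

lemma Ck_on_mono: "Ck_on k f S \<Longrightarrow> j \<le> k \<Longrightarrow> Ck_on j f S"
  by (induction k) (auto simp: le_Suc_eq intro: Ck_on_SucD simp del: Ck_on.simps(2))

lemma Ck_on_const: "open S \<Longrightarrow> Ck_on k (\<lambda>x. c) S"
proof (induction k arbitrary: c)
  case (Suc k)
  then show ?case
    by (intro Ck_on_Suc_intro[where f' = "\<lambda>_ _. 0"]) auto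
qed simp

lemma Ck_on_add:
  "open S \<Longrightarrow> Ck_on k f S \<Longrightarrow> Ck_on k g S \<Longrightarrow> Ck_on k (\<lambda>x. f x + g x) S"
proof (induction k arbitrary: f g)
  case 0
  then show ?case by (simp add: continuous_on_add)
next
  case (Suc k)
  show ?case
    by (rule Ck_on_Suc_intro[OF Suc.prems(1) has_derivative_add[OF Ck_on_Suc_derivative Ck_on_Suc_derivative]])
      (use Suc in \<open>auto intro!: Suc.IH Ck_on_Suc_partial simp del: Ck_on.simps(2)\<close>)
qed

lemma Ck_on_sum:
  assumes "open S" "\<And>i. i \<in> I \<Longrightarrow> Ck_on k (f i) S"
  shows "Ck_on k (\<lambda>x. \<Sum>i\<in>I. f i x) S"
  using assms by (induction I rule: infinite_finite_induct) (auto intro: Ck_on_const Ck_on_add)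

lemma Ck_on_mult:
  "open S \<Longrightarrow> Ck_on k f S \<Longrightarrow> Ck_on k g S \<Longrightarrow> Ck_on k (\<lambda>x. f x * g x) S"
proof (induction k arbitrary: f g)
  case 0
  then show ?case by (simp add: continuous_on_mult)
next
  case (Suc k)
  show ?case
    by (rule Ck_on_Suc_intro[OF Suc.prems(1) has_derivative_mult[OF Ck_on_Suc_derivative Ck_on_Suc_derivative]])
      (use Suc in \<open>auto intro!: Ck_on_add Suc.IH Ck_on_Suc_partial Ck_on_SucD[of k f] Ck_on_SucD[of k g]
         simp del: Ck_on.simps(2)\<close>)
qed

lemma Ck_on_cmult: "open S \<Longrightarrow> Ck_on k f S \<Longrightarrow> Ck_on k (\<lambda>x. c * f x) S"
  by (intro Ck_on_mult Ck_on_const)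

lemma Ck_on_diff:
  "open S \<Longrightarrow> Ck_on k f S \<Longrightarrow> Ck_on k g S \<Longrightarrow> Ck_on k (\<lambda>x. f x - g x) S"
  using Ck_on_add[of S k f "\<lambda>x. (-1) * g x"] Ck_on_cmult[of S k g "-1"] by simp

text \<open>The derivative of \<open>1/f\<close> is a product of \<open>1/f\<close> and derivatives of \<open>f\<close>, so the order of
  differentiability climbs by induction.\<close>

lemma Ck_on_inverse:
  "open S \<Longrightarrow> Ck_on k f S \<Longrightarrow> (\<And>x. x \<in> S \<Longrightarrow> f x \<noteq> 0) \<Longrightarrow> Ck_on k (\<lambda>x. inverse (f x)) S"
proof (induction k arbitrary: f)
  case 0
  then show ?case by (simp add: continuous_on_inverse)
next
  case (Suc k)
  have inv: "Ck_on k (\<lambda>x. inverse (f x)) S"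
    using Suc.IH Suc.prems Ck_on_SucD by blast
  show ?case
  proof (rule Ck_on_Suc_intro[OF Suc.prems(1)])
    fix x assume "x \<in> S"
    then show "((\<lambda>x. inverse (f x)) has_derivative
        (\<lambda>h. (-1) * (inverse (f x) * frechet_derivative f (at x) h * inverse (f x)))) (at x)"
      using Deriv.has_derivative_inverse[OF Suc.prems(3) Ck_on_Suc_derivative[OF Suc.prems(2)]] by simp
  next
    fix b :: 'a assume "b \<in> Basis"
    then show "Ck_on k (\<lambda>x. (-1) * (inverse (f x) * frechet_derivative f (at x) b * inverse (f x))) S"
      by (intro Ck_on_cmult Ck_on_mult inv Ck_on_Suc_partial Suc.prems) auto
  qed
qed

lemma Ck_on_divide:
  "open S \<Longrightarrow> Ck_on k f S \<Longrightarrow> Ck_on k g S \<Longrightarrow> (\<And>x. x \<in> S \<Longrightarrow> g x \<noteq> 0) \<Longrightarrow> Ck_on k (\<lambda>x. f x / g x) S"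
  unfolding divide_inverse by (intro Ck_on_mult Ck_on_inverse)

lemma Ck_on_sqrt:
  "open S \<Longrightarrow> Ck_on k f S \<Longrightarrow> (\<And>x. x \<in> S \<Longrightarrow> f x > 0) \<Longrightarrow> Ck_on k (\<lambda>x. sqrt (f x)) S"
proof (induction k arbitrary: f)
  case 0
  then show ?case by (simp add: continuous_on_real_sqrt)
next
  case (Suc k)
  have sq: "Ck_on k (\<lambda>x. sqrt (f x)) S"
    using Suc.IH Suc.prems Ck_on_SucD by blast
  show ?case
  proof (rule Ck_on_Suc_intro[OF Suc.prems(1)])
    fix x assume "x \<in> S"
    then show "((\<lambda>x. sqrt (f x)) has_derivative
        (\<lambda>h. frechet_derivative f (at x) h / (2 * sqrt (f x)))) (at x)"
      using Suc.prems(3)[of x] Ck_on_Suc_derivative[OF Suc.prems(2), of x]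
      by (auto intro!: derivative_eq_intros simp: divide_simps)
  next
    fix b :: 'a assume "b \<in> Basis"
    then show "Ck_on k (\<lambda>x. frechet_derivative f (at x) b / (2 * sqrt (f x))) S"
      using Suc.prems(3)
      by (intro Ck_on_divide Ck_on_cmult sq Ck_on_Suc_partial Suc.prems) (auto simp: less_le)
  qed
qed

lemma Ck_on_linear: "open S \<Longrightarrow> bounded_linear f \<Longrightarrow> Ck_on k f S"
proof (cases k)
  case (Suc j)
  moreover assume "open S" "bounded_linear f"
  ultimately show ?thesis
    by (auto intro!: Ck_on_Suc_intro[where f' = "\<lambda>_. f"] Ck_on_const bounded_linear_imp_has_derivative
        simp del: Ck_on.simps(2))
qed (auto intro: bounded_linear.continuous_on continuous_on_id simp: linear_continuous_on)

text \<open>By the chain rule the partial derivatives of the composition are linear combinations of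
  those of \<open>f\<close>, composed with the same linear map.\<close>

lemma Ck_on_compose_linear:
  fixes L :: "'a::euclidean_space \<Rightarrow> 'b::euclidean_space"
  assumes "open S" "bounded_linear L" "L ` S \<subseteq> T" "Ck_on k f T"
  shows "Ck_on k (\<lambda>x. f (L x)) S"
  using assms(4)
proof (induction k arbitrary: f)
  case 0
  then show ?case
    using continuous_on_compose2[of T f S L] assms by (auto simp: linear_continuous_on)
next
  case (Suc k)
  have L: "bounded_linear L" by fact
  show ?case
  proof (rule Ck_on_Suc_intro[OF \<open>open S\<close>])
    fix x assume "x \<in> S"
    then have "L x \<in> T" using assms by auto
    from Ck_on_Suc_derivative[OF Suc.prems this]
    show "((\<lambda>x. f (L x)) has_derivative (\<lambda>h. \<Sum>c\<in>Basis. (L h \<bullet> c) * frechet_derivative f (at (L x)) c)) (at x)"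
    proof -
      assume D: "(f has_derivative frechet_derivative f (at (L x))) (at (L x))"
      have "frechet_derivative f (at (L x)) (L h) = (\<Sum>c\<in>Basis. (L h \<bullet> c) * frechet_derivative f (at (L x)) c)" for h
      proof -
        have lin: "linear (frechet_derivative f (at (L x)))"
          using D has_derivative_linear by blast
        have "frechet_derivative f (at (L x)) (L h) = frechet_derivative f (at (L x)) (\<Sum>c\<in>Basis. (L h \<bullet> c) *\<^sub>R c)"
          by (simp add: euclidean_representation)
        also have "\<dots> = (\<Sum>c\<in>Basis. (L h \<bullet> c) * frechet_derivative f (at (L x)) c)"
          by (simp add: linear_sum[OF lin] linear_cmul[OF lin])
        finally show ?thesis .
      qed
      with has_derivative_compose[OF bounded_linear_imp_has_derivative[OF L] D]
      show ?thesis by (simp add: o_def)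
    qed
  next
    fix b :: 'a assume "b \<in> Basis"
    show "Ck_on k (\<lambda>x. \<Sum>c\<in>Basis. (L b \<bullet> c) * frechet_derivative f (at (L x)) c) S"
      using Suc.IH[OF Ck_on_Suc_partial[OF Suc.prems]]
      by (intro Ck_on_sum Ck_on_cmult \<open>open S\<close>) auto
  qed
qed

text \<open>The partial derivatives are bounded on the compact ball, and the ball is convex, so the
  mean value inequality applies.\<close>

lemma Ck_on_1_lipschitz_on_cball:
  fixes f :: "'a::euclidean_space \<Rightarrow> real"
  assumes "Ck_on 1 f S" "cball z r \<subseteq> S"
  shows "\<exists>L. L-lipschitz_on (cball z r) f"
proof -
  let ?D = "\<lambda>x. frechet_derivative f (at x)"
  have "\<exists>B. \<forall>x\<in>cball z r. \<bar>?D x b\<bar> \<le> B" if "b \<in> Basis" for b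
  proof -
    have "continuous_on (cball z r) (\<lambda>x. ?D x b)"
      using Ck_on_Suc_partial[of 0 f S b] assms that by (auto intro: continuous_on_subset)
    then have "compact ((\<lambda>x. ?D x b) ` cball z r)"
      by (intro compact_continuous_image compact_cball)
    then show ?thesis using compact_imp_bounded by (force simp: bounded_iff)
  qed
  then obtain B where B: "\<And>b x. b \<in> Basis \<Longrightarrow> x \<in> cball z r \<Longrightarrow> \<bar>?D x b\<bar> \<le> B b"
    by metis
  define C where "C = (\<Sum>b\<in>Basis. \<bar>B b\<bar>)"
  have C0: "C \<ge> 0" by (simp add: C_def sum_nonneg)
  have D: "(f has_derivative ?D x) (at x)" if "x \<in> cball z r" for x
    using Ck_on_Suc_derivative[of 0 f S x] assms that by auto
  have on: "onorm (?D x) \<le> C" if x: "x \<in> cball z r" for x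
  proof (rule onorm_le)
    fix h
    have lin: "linear (?D x)" using D[OF x] has_derivative_linear by blast
    have "?D x h = ?D x (\<Sum>c\<in>Basis. (h \<bullet> c) *\<^sub>R c)" by (simp add: euclidean_representation)
    also have "\<dots> = (\<Sum>c\<in>Basis. (h \<bullet> c) * ?D x c)"
      by (simp add: linear_sum[OF lin] linear_cmul[OF lin])
    finally have "norm (?D x h) \<le> (\<Sum>c\<in>Basis. \<bar>(h \<bullet> c) * ?D x c\<bar>)" by (simp add: sum_abs)
    also have "\<dots> \<le> (\<Sum>c\<in>Basis. norm h * \<bar>B c\<bar>)"
      using B x by (intro sum_mono) (fastforce simp: abs_mult Basis_le_norm intro!: mult_mono)
    also have "\<dots> = C * norm h" by (simp add: C_def sum_distrib_left mult.commute)
    finally show "norm (?D x h) \<le> C * norm h" .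
  qed
  have "norm (f x - f y) \<le> C * norm (x - y)" if "x \<in> cball z r" "y \<in> cball z r" for x y
    by (rule differentiable_bound[OF convex_cball has_derivative_at_withinI[OF D] on that(1,2)])
  then show ?thesis using C0 by (intro exI[of _ C] lipschitz_onI) (auto simp: dist_norm)
qed

section \<open>Continuation of solutions of autonomous differential equations\<close>

text \<open>The Picard operator, with time clamped to the interval so that it acts on bounded
  continuous functions on the whole line, is a contraction there.\<close>

lemma picard_lindelof_global:
  fixes G :: "'a::banach \<Rightarrow> 'a"
  assumes lip: "L-lipschitz_on UNIV G" and "0 \<le> \<epsilon>" "\<epsilon> * L < 1"
  obtains \<psi> where "continuous_on {b..b + \<epsilon>} \<psi>"
    "\<And>t. t \<in> {b..b + \<epsilon>} \<Longrightarrow> \<psi> t = z + integral {b..t} (\<lambda>s. G (\<psi> s))"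
proof -
  have contG: "continuous_on UNIV G" using lip by (rule lipschitz_on_continuous_on)
  have L0: "L \<ge> 0" using lip lipschitz_on_nonneg by blast
  \<comment> \<open>time clamped to the interval\<close>
  define cl where "cl t = max b (min t (b + \<epsilon>))" for t
  have cl: "cl t \<in> {b..b + \<epsilon>}" for t using \<open>0 \<le> \<epsilon>\<close> by (auto simp: cl_def)
  have contcl: "continuous_on UNIV cl" unfolding cl_def by (intro continuous_intros)
  have cG: "continuous_on S (\<lambda>s. G (apply_bcontfun \<phi> s))" for S \<phi>
    using continuous_on_compose2[OF contG, of S "apply_bcontfun \<phi>"] by auto
  define P where "P \<phi> t = z + integral {b..cl t} (\<lambda>s. G (apply_bcontfun \<phi> s))"
    for \<phi> :: "real \<Rightarrow>\<^sub>C 'a" and t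
  have "P \<phi> \<in> bcontfun" for \<phi> :: "real \<Rightarrow>\<^sub>C 'a"
  proof -
    let ?I = "\<lambda>x. z + integral {b..x} (\<lambda>s. G (apply_bcontfun \<phi> s))"
    have c: "continuous_on {b..b + \<epsilon>} ?I"
      by (intro continuous_intros indefinite_integral_continuous_1 integrable_continuous_real cG)
    have "continuous_on UNIV (P \<phi>)"
      unfolding P_def by (rule continuous_on_compose2[OF c contcl]) (use cl in blast)
    moreover have "bounded (?I ` {b..b + \<epsilon>})"
      using c compact_Icc compact_continuous_image compact_imp_bounded by blast
    then have "bounded (range (P \<phi>))"
      by (rule bounded_subset) (auto simp: P_def intro!: imageI cl)
    ultimately show ?thesis by (simp add: bcontfun_def)
  qed
  then have app: "apply_bcontfun (Bcontfun (P \<phi>)) = P \<phi>" for \<phi> :: "real \<Rightarrow>\<^sub>C 'a"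
    by (simp add: Bcontfun_inverse)
  have "\<exists>!\<phi>::real \<Rightarrow>\<^sub>C 'a. Bcontfun (P \<phi>) = \<phi>"
  proof (rule banach_fix_type[of "\<epsilon> * L"])
    show "\<forall>\<phi> \<eta>::real \<Rightarrow>\<^sub>C 'a. dist (Bcontfun (P \<phi>)) (Bcontfun (P \<eta>)) \<le> \<epsilon> * L * dist \<phi> \<eta>"
    proof (intro allI dist_bound)
      fix \<phi> \<eta> :: "real \<Rightarrow>\<^sub>C 'a" and t
      let ?d = "\<lambda>s. G (apply_bcontfun \<phi> s) - G (apply_bcontfun \<eta> s)"
      have "P \<phi> t - P \<eta> t = integral {b..cl t} ?d"
        unfolding P_def by (simp add: integral_diff integrable_continuous_real cG)
      also have "norm \<dots> \<le> (L * dist \<phi> \<eta>) * (cl t - b)"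
      proof (rule integral_bound)
        fix s
        have "norm (?d s) \<le> L * dist (apply_bcontfun \<phi> s) (apply_bcontfun \<eta> s)"
          using lipschitz_onD[OF lip] by (simp add: dist_norm)
        also have "\<dots> \<le> L * dist \<phi> \<eta>" by (intro mult_left_mono dist_bounded L0)
        finally show "norm (?d s) \<le> L * dist \<phi> \<eta>" .
      qed (use cl in \<open>auto intro!: continuous_on_diff cG\<close>)
      also have "\<dots> \<le> (L * dist \<phi> \<eta>) * \<epsilon>"
        using cl[of t] L0 by (intro mult_left_mono) auto
      finally show "dist (apply_bcontfun (Bcontfun (P \<phi>)) t) (apply_bcontfun (Bcontfun (P \<eta>)) t)
          \<le> \<epsilon> * L * dist \<phi> \<eta>"
        by (simp add: app dist_norm mult_ac)
    qed
  qed (use assms L0 in auto)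
  then obtain \<phi> where fix_\<phi>: "Bcontfun (P \<phi>) = \<phi>" by blast
  show ?thesis
  proof (rule that[of "apply_bcontfun \<phi>"])
    fix t assume "t \<in> {b..b + \<epsilon>}"
    then have "cl t = t" by (auto simp: cl_def)
    then show "apply_bcontfun \<phi> t = z + integral {b..t} (\<lambda>s. G (apply_bcontfun \<phi> s))"
      using fun_cong[OF app[of \<phi>, unfolded fix_\<phi>], of t] by (simp only: P_def)
  qed auto
qed

text \<open>Composing the field with the nearest-point projection to the ball makes it globally
  Lipschitz; on a short time interval the solution does not reach the boundary of the ball,
  where the projection would matter.\<close>

lemma picard_lindelof_local:
  fixes F :: "'a::euclidean_space \<Rightarrow> 'a"
  assumes lip: "L-lipschitz_on (cball z r) F" and "r > 0"
  obtains \<epsilon> \<psi> where "\<epsilon> > 0" "\<psi> b = z"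
    "\<And>t. t \<in> {b..b + \<epsilon>} \<Longrightarrow> \<psi> t \<in> cball z r"
    "\<And>t. t \<in> {b..b + \<epsilon>} \<Longrightarrow> (\<psi> has_vector_derivative F (\<psi> t)) (at t within {b..b + \<epsilon>})"
proof -
  let ?p = "closest_point (cball z r)"
  have ne: "cball z r \<noteq> {}" using \<open>r > 0\<close> by auto
  have L0: "L \<ge> 0" using lip lipschitz_on_nonneg by blast
  have p: "?p x \<in> cball z r" for x using closest_point_in_set[OF closed_cball ne] .
  have lipG: "L-lipschitz_on UNIV (\<lambda>x. F (?p x))"
  proof (rule lipschitz_onI[OF _ L0])
    fix x y
    have "dist (F (?p x)) (F (?p y)) \<le> L * dist (?p x) (?p y)"
      using lipschitz_onD[OF lip] p by blast
    also have "\<dots> \<le> L * dist x y"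
      by (intro mult_left_mono closest_point_lipschitz convex_cball closed_cball ne L0)
    finally show "dist (F (?p x)) (F (?p y)) \<le> L * dist x y" .
  qed
  define B where "B = norm (F z) + L * r"
  have B: "norm (F (?p x)) \<le> B" for x
  proof -
    have "norm (F (?p x) - F z) \<le> L * dist (?p x) z"
      using lipschitz_onD[OF lip p, of z x] \<open>r > 0\<close> by (simp add: dist_norm)
    also have "\<dots> \<le> L * r" using p[of x] L0 by (intro mult_left_mono) (auto simp: dist_commute)
    finally show ?thesis unfolding B_def using norm_triangle_sub[of "F (?p x)" "F z"] by linarith
  qed
  have B0: "B \<ge> 0" using L0 \<open>r > 0\<close> by (simp add: B_def)
  \<comment> \<open>the first bound makes the Picard operator a contraction, the second keeps the solution in the ball\<close>
  define \<epsilon> where "\<epsilon> = min (1 / (L + 1)) (r / (B + 1))"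
  have \<epsilon>: "\<epsilon> > 0" "\<epsilon> \<le> 1 / (L + 1)" "\<epsilon> \<le> r / (B + 1)"
    using L0 B0 \<open>r > 0\<close> by (auto simp: \<epsilon>_def)
  have "\<epsilon> * L \<le> 1 / (L + 1) * L" using \<epsilon> L0 by (intro mult_right_mono) auto
  also have "\<dots> < 1" using L0 by (simp add: divide_simps)
  finally have "\<epsilon> * L < 1" .
  then obtain \<psi> where \<psi>: "continuous_on {b..b + \<epsilon>} \<psi>"
    "\<And>t. t \<in> {b..b + \<epsilon>} \<Longrightarrow> \<psi> t = z + integral {b..t} (\<lambda>s. F (?p (\<psi> s)))"
    using picard_lindelof_global[OF lipG, of \<epsilon> b z] \<epsilon> by auto
  have c: "continuous_on {b..b + \<epsilon>} (\<lambda>s. F (?p (\<psi> s)))"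
    using continuous_on_compose2[OF lipschitz_on_continuous_on[OF lipG] \<psi>(1)] by auto
  have "B * \<epsilon> \<le> B * (r / (B + 1))" using \<epsilon> B0 by (intro mult_left_mono) auto
  also have "\<dots> \<le> r" using B0 \<open>r > 0\<close> by (simp add: divide_simps)
  finally have Br: "B * \<epsilon> \<le> r" .
  have inb: "\<psi> t \<in> cball z r" if t: "t \<in> {b..b + \<epsilon>}" for t
  proof -
    have "norm (\<psi> t - z) = norm (integral {b..t} (\<lambda>s. F (?p (\<psi> s))))" using \<psi>(2)[OF t] by simp
    also have "\<dots> \<le> B * (t - b)"
      by (rule integral_bound) (use t B in \<open>auto intro: continuous_on_subset[OF c]\<close>)
    also have "\<dots> \<le> B * \<epsilon>" using t B0 by (intro mult_left_mono) auto
    finally show ?thesis using Br by (simp add: dist_norm norm_minus_commute)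
  qed
  show ?thesis
  proof (rule that[of \<epsilon> \<psi>])
    show "\<psi> b = z" using \<psi>(2)[of b] \<epsilon> by simp
    fix t assume t: "t \<in> {b..b + \<epsilon>}"
    show "\<psi> t \<in> cball z r" using inb t .
    have "((\<lambda>u. z + integral {b..u} (\<lambda>s. F (?p (\<psi> s)))) has_vector_derivative F (?p (\<psi> t)))
        (at t within {b..b + \<epsilon>})"
      using integral_has_vector_derivative[OF c t] by (auto intro!: derivative_eq_intros)
    then have "(\<psi> has_vector_derivative F (?p (\<psi> t))) (at t within {b..b + \<epsilon>})"
      by (rule has_vector_derivative_transform[rotated 2]) (use t \<psi>(2) in auto)
    then show "(\<psi> has_vector_derivative F (\<psi> t)) (at t within {b..b + \<epsilon>})"
      using closest_point_self[OF inb[OF t]] by simp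
  qed (use \<epsilon> in auto)
qed

definition ode_solution :: "('a::real_normed_vector \<Rightarrow> 'a) \<Rightarrow> 'a set \<Rightarrow> real set \<Rightarrow> (real \<Rightarrow> 'a) \<Rightarrow> bool" where
  "ode_solution F \<Omega> J \<phi> \<longleftrightarrow> open J \<and> is_interval J \<and>
     (\<forall>t\<in>J. \<phi> t \<in> \<Omega> \<and> (\<phi> has_vector_derivative F (\<phi> t)) (at t))"

lemma ode_solution_subset:
  "ode_solution F \<Omega> J \<phi> \<Longrightarrow> J' \<subseteq> J \<Longrightarrow> open J' \<Longrightarrow> is_interval J' \<Longrightarrow> ode_solution F \<Omega> J' \<phi>"
  by (auto simp: ode_solution_def)

text \<open>A continuous function that satisfies the equation except at \<open>b\<close> satisfies the integral
  equation, and hence the differential equation at \<open>b\<close> as well.\<close>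

lemma glue_solutions:
  fixes F :: "'a::banach \<Rightarrow> 'a"
  assumes "a < b" "b < c"
    and contF: "continuous_on \<Omega> F" and eta_in: "\<And>t. t \<in> {a..c} \<Longrightarrow> \<eta> t \<in> \<Omega>"
    and cont: "continuous_on {a..c} \<eta>"
    and der: "\<And>t. t \<in> {a<..<c} - {b} \<Longrightarrow> (\<eta> has_vector_derivative F (\<eta> t)) (at t)"
    and t: "t \<in> {a<..<c}"
  shows "(\<eta> has_vector_derivative F (\<eta> t)) (at t)"
proof -
  have cF: "continuous_on {a..c} (\<lambda>t. F (\<eta> t))"
    by (rule continuous_on_compose2[OF contF cont]) (use eta_in in blast)
  have eq: "\<eta> a + integral {a..x} (\<lambda>t. F (\<eta> t)) = \<eta> x" if x: "x \<in> {a..c}" for x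
  proof -
    have "((\<lambda>t. F (\<eta> t)) has_integral (\<eta> x - \<eta> a)) {a..x}"
      by (rule fundamental_theorem_of_calculus_interior_strong[of "{b}"])
        (use x in \<open>auto intro!: der continuous_on_subset[OF cont]\<close>)
    then show ?thesis by (simp add: integral_unique)
  qed
  have "((\<lambda>x. \<eta> a + integral {a..x} (\<lambda>t. F (\<eta> t))) has_vector_derivative F (\<eta> t)) (at t within {a..c})"
    using integral_has_vector_derivative[OF cF, of t] t by (auto intro!: derivative_eq_intros)
  then have "(\<eta> has_vector_derivative F (\<eta> t)) (at t within {a..c})"
    by (rule has_vector_derivative_transform[rotated 2]) (use t eq in auto)
  then show ?thesis using t by (simp add: at_within_Icc_at)
qed

text \<open>The radius is chosen such that the closed ball stays in the domain, so that the ball can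
  serve as the state space of a local solution.\<close>

definition locally_lipschitz_on :: "'a::metric_space set \<Rightarrow> ('a \<Rightarrow> 'b::metric_space) \<Rightarrow> bool" where
  "locally_lipschitz_on \<Omega> F \<longleftrightarrow> (\<forall>z\<in>\<Omega>. \<exists>r>0. \<exists>L. cball z r \<subseteq> \<Omega> \<and> L-lipschitz_on (cball z r) F)"

lemma locally_lipschitz_on_imp_continuous_on:
  assumes "locally_lipschitz_on \<Omega> F"
  shows "continuous_on \<Omega> F"
proof -
  have "isCont F z" if "z \<in> \<Omega>" for z
  proof -
    obtain r L where "r > 0" and L: "L-lipschitz_on (cball z r) F"
      using assms \<open>z \<in> \<Omega>\<close> unfolding locally_lipschitz_on_def by metis
    have "continuous_on (ball z r) F"
      using continuous_on_subset[OF lipschitz_on_continuous_on[OF L] ball_subset_cball] .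
    then show ?thesis using \<open>r > 0\<close> by (simp add: continuous_on_eq_continuous_at)
  qed
  then show ?thesis by (simp add: continuous_at_imp_continuous_on)
qed

text \<open>Inside a compact set the velocity is bounded, so the solution is Lipschitz and has a limit
  at \<open>b\<close>. A local solution that starts there at time \<open>b\<close> is appended.\<close>

lemma extend_solution_right:
  fixes F :: "'a::euclidean_space \<Rightarrow> 'a"
  assumes lip: "locally_lipschitz_on \<Omega> F"
    and sol: "ode_solution F \<Omega> J \<phi>" and "a \<in> J" "a < b" "{a..<b} \<subseteq> J" "\<And>t. t \<in> J \<Longrightarrow> t < b"
    and K: "compact K" "K \<subseteq> \<Omega>" "\<phi> ` {a..<b} \<subseteq> K"
  shows "\<exists>J' \<eta>. ode_solution F \<Omega> J' \<eta> \<and> J \<subseteq> J' \<and> b \<in> J' \<and> (\<forall>t\<in>J. \<eta> t = \<phi> t)"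
proof -
  have contF: "continuous_on \<Omega> F" using lip by (rule locally_lipschitz_on_imp_continuous_on)
  have der: "(\<phi> has_vector_derivative F (\<phi> t)) (at t)" and phi_in: "\<phi> t \<in> \<Omega>" if "t \<in> J" for t
    using sol that by (auto simp: ode_solution_def)
  have "bounded (F ` K)"
    using K contF compact_continuous_image compact_imp_bounded continuous_on_subset by metis
  then obtain B where B: "\<And>x. x \<in> K \<Longrightarrow> norm (F x) \<le> B" by (auto simp: bounded_iff)
  have "\<bar>B\<bar>-lipschitz_on {a..<b} \<phi>"
  proof (rule lipschitz_onI)
    fix s t assume st: "s \<in> {a..<b}" "t \<in> {a..<b}"
    have "norm (\<phi> s - \<phi> t) \<le> \<bar>B\<bar> * norm (s - t)"
    proof (rule differentiable_bound[OF _ _ _ st])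
      fix x assume x: "x \<in> {a..<b}"
      then show "(\<phi> has_derivative (\<lambda>h. h *\<^sub>R F (\<phi> x))) (at x within {a..<b})"
        using der[of x] assms(5) unfolding has_vector_derivative_def
        by (meson has_derivative_at_withinI subsetD)
      have "norm (F (\<phi> x)) \<le> \<bar>B\<bar>" using B[of "\<phi> x"] K(3) x by force
      then show "onorm (\<lambda>h. h *\<^sub>R F (\<phi> x)) \<le> \<bar>B\<bar>"
        by (intro onorm_le) (simp add: mult.commute mult_left_mono)
    qed simp
    then show "dist (\<phi> s) (\<phi> t) \<le> \<bar>B\<bar> * dist s t" by (simp add: dist_norm)
  qed simp
  then have uc: "uniformly_continuous_on {a..<b} \<phi>" by (rule lipschitz_on_uniformly_continuous)
  obtain g where g: "uniformly_continuous_on (closure {a..<b}) g" "\<And>x. x \<in> {a..<b} \<Longrightarrow> \<phi> x = g x"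
    by (rule uniformly_continuous_on_extension_on_closure[OF uc], rule that)
  have cg: "continuous_on {a..b} g"
    using uniformly_continuous_imp_continuous[OF g(1)] \<open>a < b\<close> by simp
  have "g ` closure {a..<b} \<subseteq> K"
    by (rule image_closure_subset)
      (use g(2) K \<open>a < b\<close> cg in \<open>auto simp: compact_imp_closed image_subset_iff\<close>)
  then have gb: "g b \<in> \<Omega>" using K \<open>a < b\<close> by (auto simp: image_subset_iff)
  then obtain r L where rL: "r > 0" "cball (g b) r \<subseteq> \<Omega>" "L-lipschitz_on (cball (g b) r) F"
    using lip unfolding locally_lipschitz_on_def by blast
  obtain \<epsilon> \<psi> where \<psi>: "\<epsilon> > 0" "\<psi> b = g b"
    "\<And>t. t \<in> {b..b + \<epsilon>} \<Longrightarrow> \<psi> t \<in> cball (g b) r"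
    "\<And>t. t \<in> {b..b + \<epsilon>} \<Longrightarrow> (\<psi> has_vector_derivative F (\<psi> t)) (at t within {b..b + \<epsilon>})"
    using picard_lindelof_local[OF rL(3,1)] by metis
  define \<eta> where "\<eta> t = (if t < b then \<phi> t else \<psi> t)" for t
  have c\<psi>: "continuous_on {b..b + \<epsilon>} \<psi>"
    unfolding continuous_on_eq_continuous_within
    using has_vector_derivative_continuous[OF \<psi>(4)] by blast
  have "continuous_on {a..b + \<epsilon>} (\<lambda>t. if t \<le> b then g t else \<psi> t)"
    by (rule continuous_on_cases_le[OF continuous_on_subset[OF cg] continuous_on_subset[OF c\<psi>] continuous_on_id])
      (use \<psi>(2) in auto)
  then have cont: "continuous_on {a..b + \<epsilon>} \<eta>"
    by (rule continuous_on_eq) (use g(2) \<psi>(2) in \<open>auto simp: \<eta>_def\<close>)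
  have eta_in: "\<eta> t \<in> \<Omega>" if "t \<in> J \<union> {a..b + \<epsilon>}" for t
    using that phi_in assms(5,6) \<psi>(3) rL(2) by (auto simp: \<eta>_def subset_iff)
  have der_old: "(\<eta> has_vector_derivative F (\<eta> t)) (at t)" if "t \<in> J" for t
  proof (rule has_vector_derivative_transform_within_open[OF _ _ that])
    show "(\<phi> has_vector_derivative F (\<eta> t)) (at t)"
      using der that assms(6) by (simp add: \<eta>_def)
    show "open J" using sol by (simp add: ode_solution_def)
  qed (use assms(6) in \<open>auto simp: \<eta>_def\<close>)
  have der_new: "(\<eta> has_vector_derivative F (\<eta> t)) (at t)" if "t \<in> {a<..<b + \<epsilon>}" for t
  proof (rule glue_solutions[OF \<open>a < b\<close> _ contF _ cont _ that])
    fix s assume s: "s \<in> {a<..<b + \<epsilon>} - {b}"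
    show "(\<eta> has_vector_derivative F (\<eta> s)) (at s)"
    proof (cases "s < b")
      case True
      then have "s \<in> J" using s assms(5) by auto
      then show ?thesis by (rule der_old)
    next
      case False
      then have s': "s \<in> {b<..<b + \<epsilon>}" using s by auto
      have "(\<psi> has_vector_derivative F (\<psi> s)) (at s)"
        using \<psi>(4)[of s] s' by (simp add: at_within_Icc_at)
      then have "(\<psi> has_vector_derivative F (\<eta> s)) (at s)" using False by (simp add: \<eta>_def)
      then show ?thesis
        by (rule has_vector_derivative_transform_within_open[OF _ open_greaterThanLessThan s'])
          (auto simp: \<eta>_def)
    qed
  qed (use \<psi>(1) eta_in in auto)
  have "J \<union> {a<..<b + \<epsilon>} = J \<union> {a..<b + \<epsilon>}" using \<open>a \<in> J\<close> by force
  moreover have "connected (J \<union> {a..<b + \<epsilon>})"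
    using sol \<open>a \<in> J\<close> \<open>a < b\<close> \<psi>(1)
    by (intro connected_Un) (auto simp: ode_solution_def is_interval_connected_1)
  ultimately have "is_interval (J \<union> {a<..<b + \<epsilon>})" by (simp add: is_interval_connected_1)
  moreover have "open (J \<union> {a<..<b + \<epsilon>})" using sol by (simp add: ode_solution_def open_Un)
  ultimately have "ode_solution F \<Omega> (J \<union> {a<..<b + \<epsilon>}) \<eta>"
    unfolding ode_solution_def using der_old der_new eta_in by (meson Un_iff atLeastAtMost_iff greaterThanLessThan_iff less_imp_le)
  then show ?thesis
    using \<open>a < b\<close> \<psi>(1) assms(6) by (intro exI[of _ "J \<union> {a<..<b + \<epsilon>}"] exI[of _ \<eta>]) (auto simp: \<eta>_def)
qed

lemma ode_solution_reverse:
  assumes "ode_solution F \<Omega> J \<phi>"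
  shows "ode_solution (\<lambda>x. - F x) \<Omega> (uminus ` J) (\<lambda>t. \<phi> (- t))"
proof -
  have "((\<lambda>t. \<phi> (- t)) has_vector_derivative - F (\<phi> s)) (at (- s))" if "s \<in> J" for s
  proof -
    have "(\<phi> has_vector_derivative F (\<phi> s)) (at (- (- s)))"
      using assms that by (auto simp: ode_solution_def)
    moreover have "(uminus has_vector_derivative -1) (at (- s))"
      by (auto intro!: derivative_eq_intros)
    ultimately show ?thesis
      using vector_diff_chain_at[of uminus "-1" "- s" \<phi> "F (\<phi> s)"] by (simp add: o_def)
  qed
  then show ?thesis
    using assms open_negations[of J] by (auto simp: ode_solution_def is_interval_uminusI)
qed

text \<open>Zorn's lemma, applied to the graphs of all solutions that extend \<open>\<phi>\<close>, ordered by
  inclusion.\<close>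

lemma maximal_solution:
  fixes F :: "'a::real_normed_vector \<Rightarrow> 'a"
  assumes "ode_solution F \<Omega> I \<phi>"
  shows "\<exists>J \<psi>. ode_solution F \<Omega> J \<psi> \<and> I \<subseteq> J \<and> (\<forall>t\<in>I. \<psi> t = \<phi> t) \<and>
    (\<forall>J' \<eta>. ode_solution F \<Omega> J' \<eta> \<and> J \<subseteq> J' \<and> (\<forall>t\<in>J. \<eta> t = \<psi> t) \<longrightarrow> J' = J)"
proof -
  define graph where "graph J \<psi> = (\<lambda>t. (t, \<psi> t)) ` J" for J :: "real set" and \<psi> :: "real \<Rightarrow> 'a"
  define \<S> where "\<S> = {graph J \<psi> | J \<psi>. ode_solution F \<Omega> J \<psi> \<and> I \<subseteq> J \<and> (\<forall>t\<in>I. \<psi> t = \<phi> t)}"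
  have "\<exists>M\<in>\<S>. \<forall>X\<in>\<S>. M \<subseteq> X \<longrightarrow> X = M"
  proof (rule subset_Zorn_nonempty)
    show "\<S> \<noteq> {}" using assms by (auto simp: \<S>_def)
    fix \<C> assume ne: "\<C> \<noteq> {}" and chain: "subset.chain \<S> \<C>"
    have mem: "\<exists>J \<psi>. G = graph J \<psi> \<and> ode_solution F \<Omega> J \<psi> \<and> I \<subseteq> J \<and> (\<forall>t\<in>I. \<psi> t = \<phi> t)" if "G \<in> \<C>" for G
      using chain that unfolding subset.chain_def \<S>_def by blast
    have lin: "G \<subseteq> H \<or> H \<subseteq> G" if "G \<in> \<C>" "H \<in> \<C>" for G H
      using chain that unfolding subset.chain_def by blast
    have single: "z = z'" if m: "(t, z) \<in> \<Union>\<C>" "(t, z') \<in> \<Union>\<C>" for t z z'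
    proof -
      obtain G H where "G \<in> \<C>" "H \<in> \<C>" "(t, z) \<in> G" "(t, z') \<in> H" using m by blast
      then obtain G where "G \<in> \<C>" "(t, z) \<in> G" "(t, z') \<in> G" using lin[of G H] by blast
      then show ?thesis using mem[of G] by (auto simp: graph_def)
    qed
    define J where "J = fst ` \<Union>\<C>"
    have domI: "t \<in> J" if "(t, z) \<in> \<Union>\<C>" for t z
      unfolding J_def by (rule image_eqI[of _ _ "(t, z)"]) (use that in simp_all)
    define \<psi> where "\<psi> t = (THE z. (t, z) \<in> \<Union>\<C>)" for t
    have \<psi>: "\<psi> t = z" if "(t, z) \<in> \<Union>\<C>" for t z
      unfolding \<psi>_def by (rule the_equality) (use that single in blast)+
    have part: "\<exists>J' \<psi>'. t \<in> J' \<and> J' \<subseteq> J \<and> ode_solution F \<Omega> J' \<psi>' \<and> I \<subseteq> J' \<and>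
        (\<forall>t\<in>I. \<psi>' t = \<phi> t) \<and> (\<forall>t\<in>J'. \<psi> t = \<psi>' t)" if "t \<in> J" for t
    proof -
      obtain G z where G: "G \<in> \<C>" "(t, z) \<in> G" using \<open>t \<in> J\<close> by (auto simp: J_def)
      obtain J' \<psi>' where J': "G = graph J' \<psi>'" "ode_solution F \<Omega> J' \<psi>'" "I \<subseteq> J'" "\<forall>t\<in>I. \<psi>' t = \<phi> t"
        using mem[OF G(1)] by blast
      have *: "(s, \<psi>' s) \<in> \<Union>\<C>" if "s \<in> J'" for s using that G(1) J'(1) by (auto simp: graph_def)
      have "J' \<subseteq> J"
      proof
        fix s assume "s \<in> J'"
        from *[OF this] show "s \<in> J" by (rule domI)
      qed
      moreover have "t \<in> J'" using G J' by (auto simp: graph_def)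
      ultimately show ?thesis using J' \<psi>[OF *] by blast
    qed
    have "\<Union>\<C> = graph J \<psi>"
    proof
      show "graph J \<psi> \<subseteq> \<Union>\<C>"
      proof
        fix p assume "p \<in> graph J \<psi>"
        then obtain t where "p = (t, \<psi> t)" "t \<in> fst ` \<Union>\<C>" by (auto simp: graph_def J_def)
        moreover from this(2) obtain q where q: "q \<in> \<Union>\<C>" "t = fst q" by blast
        then have "(t, snd q) \<in> \<Union>\<C>" by simp
        ultimately show "p \<in> \<Union>\<C>" using \<psi>[of t "snd q"] by simp
      qed
      show "\<Union>\<C> \<subseteq> graph J \<psi>"
      proof
        fix p assume p: "p \<in> \<Union>\<C>"
        obtain t z where tz: "p = (t, z)" by (cases p)
        then show "p \<in> graph J \<psi>" using p \<psi>[of t z] domI[of t z] by (auto simp: graph_def)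
      qed
    qed
    moreover have "ode_solution F \<Omega> J \<psi>"
    proof -
      have "open J" using part unfolding ode_solution_def open_subopen[of J] by metis
      moreover have "is_interval J" unfolding is_interval_1
      proof (intro ballI allI impI)
        fix t u x assume tu: "t \<in> J" "u \<in> J" and x: "t \<le> x \<and> x \<le> u"
        obtain G H z y where "G \<in> \<C>" "H \<in> \<C>" "(t, z) \<in> G" "(u, y) \<in> H" using tu by (auto simp: J_def)
        then obtain G where G: "G \<in> \<C>" "(t, z) \<in> G" "(u, y) \<in> G" using lin[of G H] by blast
        obtain J' \<psi>' where J': "G = graph J' \<psi>'" "ode_solution F \<Omega> J' \<psi>'" using mem[OF G(1)] by blast
        have "t \<in> J'" "u \<in> J'" using G J'(1) by (auto simp: graph_def)
        then have "x \<in> J'" using J'(2) x unfolding ode_solution_def is_interval_1 by blast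
        then have "(x, \<psi>' x) \<in> \<Union>\<C>" using J' G by (auto simp: graph_def)
        then show "x \<in> J" by (rule domI)
      qed
      moreover have "\<psi> t \<in> \<Omega> \<and> (\<psi> has_vector_derivative F (\<psi> t)) (at t)" if "t \<in> J" for t
      proof -
        obtain J' \<psi>' where J': "t \<in> J'" "ode_solution F \<Omega> J' \<psi>'" "\<forall>t\<in>J'. \<psi> t = \<psi>' t"
          using part[OF \<open>t \<in> J\<close>] by blast
        then have "(\<psi>' has_vector_derivative F (\<psi> t)) (at t)" "open J'" "\<psi> t \<in> \<Omega>"
          by (auto simp: ode_solution_def)
        then show ?thesis
          using has_vector_derivative_transform_within_open[of \<psi>' "F (\<psi> t)" t J' \<psi>] J'(1,3) by metis
      qed
      ultimately show ?thesis by (simp add: ode_solution_def)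
    qed
    moreover have "I \<subseteq> J \<and> (\<forall>t\<in>I. \<psi> t = \<phi> t)"
    proof -
      obtain G where G: "G \<in> \<C>" using ne by blast
      then obtain J' \<psi>' where J': "G = graph J' \<psi>'" "I \<subseteq> J'" "\<forall>t\<in>I. \<psi>' t = \<phi> t"
        using mem[OF G] by blast
      have *: "(t, \<phi> t) \<in> \<Union>\<C>" if "t \<in> I" for t
      proof (rule UnionI[OF G])
        show "(t, \<phi> t) \<in> G" using that J' by (force simp: graph_def)
      qed
      have "t \<in> J" if "t \<in> I" for t using *[OF that] by (rule domI)
      then show ?thesis using \<psi>[OF *] by blast
    qed
    ultimately show "\<Union>\<C> \<in> \<S>" unfolding \<S>_def by blast
  qed
  then obtain M where M: "M \<in> \<S>" and maxM: "\<And>X. X \<in> \<S> \<Longrightarrow> M \<subseteq> X \<Longrightarrow> X = M" by blast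
  then obtain J \<psi> where J: "ode_solution F \<Omega> J \<psi>" "I \<subseteq> J" "\<forall>t\<in>I. \<psi> t = \<phi> t"
    and MJ: "M = graph J \<psi>"
    unfolding \<S>_def by auto
  have "J' = J"
    if sol': "ode_solution F \<Omega> J' \<eta>" and JJ': "J \<subseteq> J'" and eq: "\<forall>t\<in>J. \<eta> t = \<psi> t" for J' \<eta>
  proof -
    have "I \<subseteq> J'" using J(2) JJ' by blast
    moreover have "\<forall>t\<in>I. \<eta> t = \<phi> t" using J(2,3) eq by auto
    ultimately have "graph J' \<eta> \<in> \<S>" unfolding \<S>_def using sol' by auto
    moreover have "graph J \<psi> \<subseteq> graph J' \<eta>" using JJ' eq by (force simp: graph_def)
    ultimately have "graph J' \<eta> = graph J \<psi>" using maxM MJ by simp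
    then have "fst ` graph J' \<eta> = fst ` graph J \<psi>" by simp
    then show "J' = J" by (simp add: graph_def image_image)
  qed
  then show ?thesis using J by blast
qed

lemma interval_gap_right:
  fixes J :: "real set"
  assumes "open J" "is_interval J" "a \<in> J" "x \<notin> J" "a < x"
  obtains b where "a < b" "{a..<b} \<subseteq> J" "\<And>t. t \<in> J \<Longrightarrow> t < b" "b \<notin> J"
proof -
  have up: "t < x" if "t \<in> J" for t
    using that assms mem_is_interval_1_I[of J a t x] by force
  then have bdd: "bdd_above J" by (meson bdd_above.I less_imp_le)
  define b where "b = Sup J"
  have le: "t \<le> b" if "t \<in> J" for t using that bdd by (simp add: b_def cSup_upper)
  have "b \<notin> J"
  proof
    assume "b \<in> J"
    then obtain e where "e > 0" "cball b e \<subseteq> J" using \<open>open J\<close> open_contains_cball by blast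
    moreover have "b + e \<in> cball b e" using \<open>e > 0\<close> by (simp add: dist_real_def)
    ultimately have "b + e \<in> J" by blast
    then show False using le[of "b + e"] \<open>e > 0\<close> by simp
  qed
  moreover have "t < b" if "t \<in> J" for t using le that \<open>b \<notin> J\<close> by (metis order.not_eq_order_implies_strict)
  moreover have "{a..<b} \<subseteq> J"
  proof
    fix t assume t: "t \<in> {a..<b}"
    then obtain s where "s \<in> J" "t < s"
      using less_cSup_iff[of J t] bdd \<open>a \<in> J\<close> by (auto simp: b_def)
    then show "t \<in> J" using t mem_is_interval_1_I[OF assms(2,3), of s t] by auto
  qed
  ultimately show ?thesis using that[of b] \<open>a \<in> J\<close> by blast
qed

text \<open>Otherwise the domain would end at some \<open>b\<close>, and the solution could be continued to \<open>b\<close>,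
  against maximality.\<close>

lemma maximal_solution_unbounded_right:
  fixes F :: "'a::euclidean_space \<Rightarrow> 'a"
  assumes lip: "locally_lipschitz_on \<Omega> F"
    and sol: "ode_solution F \<Omega> J \<psi>"
    and max: "\<And>J' \<eta>. ode_solution F \<Omega> J' \<eta> \<Longrightarrow> J \<subseteq> J' \<Longrightarrow> \<forall>t\<in>J. \<eta> t = \<psi> t \<Longrightarrow> J' = J"
    and cpt: "\<And>J'. J' \<subseteq> J \<Longrightarrow> open J' \<Longrightarrow> is_interval J' \<Longrightarrow> bounded J' \<Longrightarrow> \<exists>K. compact K \<and> K \<subseteq> \<Omega> \<and> \<psi> ` J' \<subseteq> K"
    and a: "a \<in> J" and x: "a < x"
  shows "x \<in> J"
proof (rule ccontr)
  assume "x \<notin> J"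
  have J: "open J" "is_interval J" using sol by (auto simp: ode_solution_def)
  obtain b where b: "a < b" "{a..<b} \<subseteq> J" "\<And>t. t \<in> J \<Longrightarrow> t < b" "b \<notin> J"
    using interval_gap_right[OF J a \<open>x \<notin> J\<close> x] by metis
  define a' where "a' = (a + b) / 2"
  have a': "a < a'" "a' < b" using b(1) by (auto simp: a'_def)
  have sub: "{a<..<b} \<subseteq> J" using b(2) by auto
  obtain K where K: "compact K" "K \<subseteq> \<Omega>" "\<psi> ` {a<..<b} \<subseteq> K"
    using cpt[OF sub] by auto
  have "\<exists>J' \<eta>. ode_solution F \<Omega> J' \<eta> \<and> J \<subseteq> J' \<and> b \<in> J' \<and> (\<forall>t\<in>J. \<eta> t = \<psi> t)"
  proof (rule extend_solution_right[OF lip sol _ a'(2) _ b(3) K(1,2)])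
    show "a' \<in> J" "{a'..<b} \<subseteq> J" using a' b(2) by auto
    show "\<psi> ` {a'..<b} \<subseteq> K" using a' K(3) by (auto simp: image_subset_iff)
  qed
  then obtain J' \<eta> where J': "ode_solution F \<Omega> J' \<eta>" "J \<subseteq> J'" "b \<in> J'" "\<forall>t\<in>J. \<eta> t = \<psi> t"
    by (elim exE conjE)
  have "J' = J" by (rule max[OF J'(1,2,4)])
  then show False using J'(3) b(4) by simp
qed

text \<open>The escape lemma. If the domain of a maximal solution had a right endpoint, the solution
  could be continued past it; a left endpoint is excluded in the same way after reversing time.\<close>

theorem solution_extends_to_UNIV:
  fixes F :: "'a::euclidean_space \<Rightarrow> 'a"
  assumes lip: "locally_lipschitz_on \<Omega> F" and sol: "ode_solution F \<Omega> I \<phi>" and "I \<noteq> {}"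
    and cpt: "\<And>J \<psi>. ode_solution F \<Omega> J \<psi> \<Longrightarrow> bounded J \<Longrightarrow> \<exists>K. compact K \<and> K \<subseteq> \<Omega> \<and> \<psi> ` J \<subseteq> K"
  shows "\<exists>\<psi>. ode_solution F \<Omega> UNIV \<psi> \<and> (\<forall>t\<in>I. \<psi> t = \<phi> t)"
proof -
  obtain J \<psi> where J: "ode_solution F \<Omega> J \<psi>" "I \<subseteq> J" "\<forall>t\<in>I. \<psi> t = \<phi> t"
    and max_all: "\<forall>J' \<eta>. ode_solution F \<Omega> J' \<eta> \<and> J \<subseteq> J' \<and> (\<forall>t\<in>J. \<eta> t = \<psi> t) \<longrightarrow> J' = J"
    using maximal_solution[OF sol] by (elim exE conjE)
  note max = max_all[rule_format, OF conjI[OF _ conjI]]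
  obtain a where a: "a \<in> J" using \<open>I \<noteq> {}\<close> J(2) by blast
  have "x \<in> J" if "a < x" for x
  proof (rule maximal_solution_unbounded_right[OF lip J(1) _ _ a that])
    show "\<exists>K. compact K \<and> K \<subseteq> \<Omega> \<and> \<psi> ` J' \<subseteq> K"
      if "J' \<subseteq> J" "open J'" "is_interval J'" "bounded J'" for J'
      using cpt ode_solution_subset[OF J(1) that(1-3)] that(4) by blast
  qed (rule max)
  moreover have "x \<in> J" if "x < a" for x
  proof -
    let ?r = "\<lambda>J. uminus ` J :: real set"
    have rr: "?r (?r A) = A" for A by (simp add: image_image)
    have "- x \<in> ?r J"
    proof (rule maximal_solution_unbounded_right[of \<Omega> "\<lambda>x. - F x" _ "\<lambda>t. \<psi> (- t)"])
      show "locally_lipschitz_on \<Omega> (\<lambda>x. - F x)" using lip by (simp add: locally_lipschitz_on_def)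
      show "ode_solution (\<lambda>x. - F x) \<Omega> (?r J) (\<lambda>t. \<psi> (- t))" using J(1) by (rule ode_solution_reverse)
      show "- a \<in> ?r J" using a by simp
      show "- a < - x" using that by simp
      show "J' = ?r J" if sol': "ode_solution (\<lambda>x. - F x) \<Omega> J' \<eta>" and sub: "?r J \<subseteq> J'"
        and eq: "\<forall>t\<in>?r J. \<eta> t = \<psi> (- t)" for J' \<eta>
      proof -
        have "?r J' = J"
        proof (rule max)
          show "ode_solution F \<Omega> (?r J') (\<lambda>t. \<eta> (- t))" using ode_solution_reverse[OF sol'] by simp
          show "J \<subseteq> ?r J'" using image_mono[OF sub, of uminus] by (simp add: rr)
          show "\<forall>t\<in>J. \<eta> (- t) = \<psi> t" using eq by simp
        qed
        then show ?thesis using rr[of J'] by simp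
      qed
      show "\<exists>K. compact K \<and> K \<subseteq> \<Omega> \<and> (\<lambda>t. \<psi> (- t)) ` J' \<subseteq> K"
        if J': "J' \<subseteq> ?r J" "open J'" "is_interval J'" "bounded J'" for J'
      proof -
        have "?r J' \<subseteq> J" using image_mono[OF J'(1), of uminus] by (simp add: rr)
        then have "ode_solution F \<Omega> (?r J') \<psi>"
          by (rule ode_solution_subset[OF J(1)]) (use J' open_negations in \<open>auto simp: is_interval_uminusI\<close>)
        from cpt[OF this] show ?thesis using J'(4) by (simp add: image_image)
      qed
    qed
    then show ?thesis by auto
  qed
  ultimately have "J = UNIV" using a by (metis UNIV_eq_I linorder_neqE)
  then show ?thesis using J(1,3) by blast
qed

section \<open>Geodesics as solutions of a first-order equation\<close>

lemma has_derivative_partials: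
  fixes f :: "real^'m \<Rightarrow> real"
  assumes "(f has_derivative D) (at x)"
  shows "D h = (\<Sum>a\<in>UNIV. partial_deriv f (axis a 1) x * h $ a)"
proof -
  have lin: "linear D" using assms has_derivative_linear by blast
  have "D h = D (\<Sum>a\<in>UNIV. h $ a *\<^sub>R axis a 1)"
    using basis_expansion[of h] by (simp add: scalar_mult_eq_scaleR)
  also have "\<dots> = (\<Sum>a\<in>UNIV. partial_deriv f (axis a 1) x * h $ a)"
    by (simp add: linear_sum[OF lin] linear_cmul[OF lin] partial_deriv_eq[OF assms] mult.commute)
  finally show ?thesis .
qed

lemma has_real_derivative_along_curve:
  fixes f :: "real^'m \<Rightarrow> real"
  assumes "f differentiable (at (\<gamma> t))" and "(\<gamma> has_vector_derivative v) (at t)"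
  shows "((\<lambda>s. f (\<gamma> s)) has_real_derivative (\<Sum>a\<in>UNIV. partial_deriv f (axis a 1) (\<gamma> t) * v $ a)) (at t)"
proof -
  have D: "(f has_derivative frechet_derivative f (at (\<gamma> t))) (at (\<gamma> t))"
    using assms(1) frechet_derivative_works by blast
  have "((\<lambda>s. f (\<gamma> s)) has_derivative (\<lambda>h. frechet_derivative f (at (\<gamma> t)) (h *\<^sub>R v))) (at t)"
    using has_derivative_compose[of \<gamma> "\<lambda>h. h *\<^sub>R v" t UNIV f] D assms(2)
    by (simp add: has_vector_derivative_def)
  moreover have "frechet_derivative f (at (\<gamma> t)) (h *\<^sub>R v)
      = (\<Sum>a\<in>UNIV. partial_deriv f (axis a 1) (\<gamma> t) * v $ a) * h" for h
    unfolding has_derivative_partials[OF D] by (simp add: sum_distrib_left sum_distrib_right mult_ac)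
  ultimately show ?thesis unfolding has_field_derivative_def by (simp add: mult_commute_abs)
qed

lemma has_vector_derivative_component:
  fixes v :: "real \<Rightarrow> real^'m"
  assumes "(v has_vector_derivative a) (at t)"
  shows "((\<lambda>s. v s $ i) has_real_derivative a $ i) (at t)"
proof -
  have "((\<lambda>s. v s $ i) has_vector_derivative a $ i) (at t)"
    using bounded_linear.has_vector_derivative[OF bounded_linear_vec_nth assms] .
  then show ?thesis by (simp add: has_real_derivative_iff_has_vector_derivative)
qed

definition geodesic_field :: "(real^'m \<Rightarrow> real^'m^'m) \<Rightarrow> (real^'m) \<times> (real^'m) \<Rightarrow> (real^'m) \<times> (real^'m::finite)" where
  "geodesic_field g z = (snd z,
     \<chi> k. - (\<Sum>i\<in>UNIV. \<Sum>j\<in>UNIV. christoffel g (fst z) k i j * snd z $ i * snd z $ j))"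

lemma geodesic_on_iff_ode_solution:
  assumes "open I" "is_interval I"
  shows "geodesic_on U g I \<gamma> \<longleftrightarrow> (\<exists>v. ode_solution (geodesic_field g) (U \<times> UNIV) I (\<lambda>t. (\<gamma> t, v t)))"
proof -
  have *: "((\<lambda>t. (\<gamma> t, v t)) has_vector_derivative (a, b)) (at t) \<longleftrightarrow>
    (\<gamma> has_vector_derivative a) (at t) \<and> (v has_vector_derivative b) (at t)"
    for v :: "real \<Rightarrow> real^'a" and a b t
  proof
    assume *: "((\<lambda>t. (\<gamma> t, v t)) has_vector_derivative (a, b)) (at t)"
    show "(\<gamma> has_vector_derivative a) (at t) \<and> (v has_vector_derivative b) (at t)"
      using bounded_linear.has_vector_derivative[OF bounded_linear_fst *]
        bounded_linear.has_vector_derivative[OF bounded_linear_snd *] by simp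
  qed (auto intro: has_vector_derivative_Pair)
  show ?thesis
    unfolding geodesic_on_def ode_solution_def geodesic_field_def fst_conv snd_conv *
    using assms by auto
qed

lemma locally_lipschitz_onI_Ck:
  fixes G :: "'a::euclidean_space \<Rightarrow> 'b::euclidean_space"
  assumes "open S" and C1: "\<And>b. b \<in> Basis \<Longrightarrow> Ck_on 1 (\<lambda>z. G z \<bullet> b) S"
  shows "locally_lipschitz_on S G"
  unfolding locally_lipschitz_on_def
proof
  fix z assume "z \<in> S"
  then obtain r where r: "r > 0" "cball z r \<subseteq> S" using \<open>open S\<close> open_contains_cball by blast
  have "\<exists>L :: 'b \<Rightarrow> real. \<forall>b\<in>Basis. (L b)-lipschitz_on (cball z r) (\<lambda>z. G z \<bullet> b)"
    using Ck_on_1_lipschitz_on_cball[OF C1 r(2)] by metis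
  then obtain L :: "'b \<Rightarrow> real" where L: "\<And>b. b \<in> Basis \<Longrightarrow> (L b)-lipschitz_on (cball z r) (\<lambda>z. G z \<bullet> b)" by blast
  have "(\<Sum>b\<in>Basis. L b)-lipschitz_on (cball z r) G"
  proof (rule lipschitz_onI)
    show "(\<Sum>b\<in>Basis. L b) \<ge> 0" using L lipschitz_on_nonneg by (intro sum_nonneg) blast
    fix x y assume xy: "x \<in> cball z r" "y \<in> cball z r"
    have "norm (G x - G y) \<le> (\<Sum>b\<in>Basis. \<bar>(G x - G y) \<bullet> b\<bar>)" by (rule norm_le_l1)
    also have "\<dots> \<le> (\<Sum>b\<in>Basis. L b * dist x y)"
      using lipschitz_onD[OF L xy] by (intro sum_mono) (simp add: dist_norm inner_diff_left)
    finally show "dist (G x) (G y) \<le> (\<Sum>b\<in>Basis. L b) * dist x y"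
      by (simp add: dist_norm sum_distrib_right)
  qed
  then show "\<exists>r>0. \<exists>L. cball z r \<subseteq> S \<and> L-lipschitz_on (cball z r) G" using r by blast
qed

lemma geodesic_field_locally_lipschitz:
  fixes g :: "real^'m \<Rightarrow> real^'m^'m::finite"
  assumes "open U" and "\<And>k i j. Ck_on 1 (\<lambda>x. christoffel g x k i j) U"
  shows "locally_lipschitz_on (U \<times> UNIV) (geodesic_field g)"
proof (rule locally_lipschitz_onI_Ck)
  let ?S = "U \<times> (UNIV :: (real^'m) set)"
  show S: "open ?S" using \<open>open U\<close> by (simp add: open_Times)
  have lin: "Ck_on 1 (\<lambda>z. snd z $ i) ?S" for i
    by (intro Ck_on_linear S bounded_linear_compose[OF bounded_linear_vec_nth bounded_linear_snd])
  have chr: "Ck_on 1 (\<lambda>z. christoffel g (fst z) k i j) ?S" for k i j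
    by (rule Ck_on_compose_linear[OF S bounded_linear_fst _ assms(2)]) auto
  fix b :: "(real^'m) \<times> (real^'m)" assume "b \<in> Basis"
  then consider i where "b = (axis i 1, 0)" | k where "b = (0, axis k 1)"
    by (auto simp: Basis_prod_def Basis_vec_def)
  then show "Ck_on 1 (\<lambda>z. geodesic_field g z \<bullet> b) ?S"
  proof cases
    case 1
    then show ?thesis using lin by (simp add: geodesic_field_def inner_axis)
  next
    case (2 k)
    have "Ck_on 1 (\<lambda>z. (-1) * (\<Sum>i\<in>UNIV. \<Sum>j\<in>UNIV. christoffel g (fst z) k i j * snd z $ i * snd z $ j)) ?S"
      by (intro Ck_on_cmult Ck_on_sum Ck_on_mult S lin chr)
    then show ?thesis using 2 by (simp add: geodesic_field_def inner_axis)
  qed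
qed

text \<open>Differentiating \<open>g(v, v)\<close> gives the cubic form \<open>S = \<Sum> d\<^sub>l g\<^sub>i\<^sub>j v\<^sub>l v\<^sub>i v\<^sub>j\<close> from the metric and
  \<open>2 g(a, v)\<close> from the acceleration \<open>a\<close>. Lowering the index of \<open>a\<close> cancels the inverse metric in
  the Christoffel symbols, and of the three terms that remain two cancel after symmetrization,
  so that \<open>2 g(a, v) = - S\<close>.\<close>

lemma geodesic_energy_constant:
  fixes g :: "real^'m \<Rightarrow> real^'m^'m::finite"
  assumes sol: "ode_solution (geodesic_field g) (U \<times> UNIV) J (\<lambda>t. (\<gamma> t, v t))"
    and diff: "\<And>x a b. x \<in> U \<Longrightarrow> (\<lambda>x. g x $ a $ b) differentiable (at x)"
    and sym: "\<And>x. x \<in> U \<Longrightarrow> transpose (g x) = g x"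
    and inv: "\<And>x. x \<in> U \<Longrightarrow> g x ** matrix_inv (g x) = mat 1"
  shows "\<exists>E. \<forall>t\<in>J. v t \<bullet> (g (\<gamma> t) *v v t) = E"
proof -
  have geo: "\<gamma> t \<in> U" "(\<gamma> has_vector_derivative v t) (at t)"
    "(v has_vector_derivative
           (\<chi> k. - (\<Sum>i\<in>UNIV. \<Sum>j\<in>UNIV. christoffel g (\<gamma> t) k i j * v t $ i * v t $ j))) (at t)"
    if "t \<in> J" for t
    using sol that
      bounded_linear.has_vector_derivative[OF bounded_linear_fst, of "\<lambda>t. (\<gamma> t, v t)" "geodesic_field g (\<gamma> t, v t)" "at t"]
      bounded_linear.has_vector_derivative[OF bounded_linear_snd, of "\<lambda>t. (\<gamma> t, v t)" "geodesic_field g (\<gamma> t, v t)" "at t"]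
    by (auto simp: ode_solution_def geodesic_field_def)
  have "((\<lambda>s. \<Sum>i\<in>UNIV. \<Sum>j\<in>UNIV. g (\<gamma> s) $ i $ j * v s $ i * v s $ j) has_real_derivative 0) (at t)"
    if t: "t \<in> J" for t
  proof -
    define x where "x = \<gamma> t"
    define w where "w = v t"
    have x: "x \<in> U" using geo(1)[OF t] by (simp add: x_def)
    define d where "d l i j = partial_deriv (\<lambda>y. g y $ i $ j) (axis l 1) x" for l i j
    \<comment> \<open>the acceleration with lowered index, up to sign\<close>
    define c where "c = (\<chi> l. 1/2 * (\<Sum>i\<in>UNIV. \<Sum>j\<in>UNIV. (d i j l + d j i l - d l i j) * w $ i * w $ j))"
    define a where "a = (\<chi> k. - (\<Sum>i\<in>UNIV. \<Sum>j\<in>UNIV. christoffel g x k i j * w $ i * w $ j))"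
    define S where "S = (\<Sum>l\<in>UNIV. \<Sum>i\<in>UNIV. \<Sum>j\<in>UNIV. d l i j * w $ l * w $ i * w $ j)"
    have "a = - (matrix_inv (g x) *v c)"
    proof (rule vec_eq_iff[THEN iffD2], rule allI)
      fix k
      have "(\<Sum>i\<in>UNIV. \<Sum>j\<in>UNIV. christoffel g x k i j * w $ i * w $ j)
        = (\<Sum>i\<in>UNIV. \<Sum>j\<in>UNIV. \<Sum>l\<in>UNIV. matrix_inv (g x) $ k $ l * (1/2 * ((d i j l + d j i l - d l i j) * w $ i * w $ j)))"
        unfolding christoffel_def d_def by (simp add: sum_distrib_left sum_distrib_right mult_ac)
      also have "\<dots> = (\<Sum>i\<in>UNIV. \<Sum>l\<in>UNIV. \<Sum>j\<in>UNIV. matrix_inv (g x) $ k $ l * (1/2 * ((d i j l + d j i l - d l i j) * w $ i * w $ j)))"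
        by (rule sum.cong[OF refl], rule sum.swap)
      also have "\<dots> = (\<Sum>l\<in>UNIV. \<Sum>i\<in>UNIV. \<Sum>j\<in>UNIV. matrix_inv (g x) $ k $ l * (1/2 * ((d i j l + d j i l - d l i j) * w $ i * w $ j)))"
        by (rule sum.swap)
      also have "\<dots> = (matrix_inv (g x) *v c) $ k"
        by (simp add: matrix_vector_mult_def c_def sum_distrib_left)
      finally show "a $ k = (- (matrix_inv (g x) *v c)) $ k" by (simp add: a_def)
    qed
    then have "g x *v a = - (g x *v (matrix_inv (g x) *v c))"
      using linear_neg[OF matrix_vector_mul_linear[of "g x"]] by simp
    then have ga: "g x *v a = - c"
      using inv[OF x] by (simp add: matrix_vector_mul_assoc)
    have wc: "w \<bullet> c = 1/2 * S"
    proof -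
      have 1: "(\<Sum>l\<in>UNIV. \<Sum>i\<in>UNIV. \<Sum>j\<in>UNIV. d i j l * w $ i * w $ j * w $ l) = S"
      proof -
        have "(\<Sum>l\<in>UNIV. \<Sum>i\<in>UNIV. \<Sum>j\<in>UNIV. d i j l * w $ i * w $ j * w $ l)
          = (\<Sum>i\<in>UNIV. \<Sum>l\<in>UNIV. \<Sum>j\<in>UNIV. d i j l * w $ i * w $ j * w $ l)" by (rule sum.swap)
        also have "\<dots> = (\<Sum>i\<in>UNIV. \<Sum>j\<in>UNIV. \<Sum>l\<in>UNIV. d i j l * w $ i * w $ j * w $ l)"
          by (rule sum.cong[OF refl], rule sum.swap)
        finally show ?thesis by (simp add: S_def)
      qed
      have "(\<Sum>l\<in>UNIV. \<Sum>i\<in>UNIV. \<Sum>j\<in>UNIV. d j i l * w $ i * w $ j * w $ l)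
        = (\<Sum>l\<in>UNIV. \<Sum>j\<in>UNIV. \<Sum>i\<in>UNIV. d j i l * w $ i * w $ j * w $ l)"
        by (rule sum.cong[OF refl], rule sum.swap)
      also have "\<dots> = S" using 1 by (simp add: mult_ac)
      finally have 2: "(\<Sum>l\<in>UNIV. \<Sum>i\<in>UNIV. \<Sum>j\<in>UNIV. d j i l * w $ i * w $ j * w $ l) = S" .
      have 3: "(\<Sum>l\<in>UNIV. \<Sum>i\<in>UNIV. \<Sum>j\<in>UNIV. d l i j * w $ i * w $ j * w $ l) = S"
        unfolding S_def by (simp add: mult_ac)
      have "w \<bullet> c = 1/2 * (\<Sum>l\<in>UNIV. \<Sum>i\<in>UNIV. \<Sum>j\<in>UNIV. (d i j l + d j i l - d l i j) * w $ i * w $ j * w $ l)"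
        by (simp add: inner_vec_def c_def sum_distrib_left sum_distrib_right mult_ac)
      also have "\<dots> = 1/2 * (S + S - S)"
        unfolding 1[symmetric] 
        by (simp add: 1 2 3 distrib_right left_diff_distrib sum.distrib sum_subtractf)
      finally show ?thesis by simp
    qed
    have gsym: "g x $ i $ j = g x $ j $ i" for i j
      using sym[OF x] by (metis transpose_def vec_lambda_beta)
    have gwa: "(\<Sum>i\<in>UNIV. \<Sum>j\<in>UNIV. g x $ i $ j * w $ i * a $ j) = - (1/2 * S)"
    proof -
      have "(\<Sum>i\<in>UNIV. \<Sum>j\<in>UNIV. g x $ i $ j * w $ i * a $ j) = w \<bullet> (g x *v a)"
        by (simp add: inner_vec_def matrix_vector_mult_def sum_distrib_left mult_ac)
      then show ?thesis using ga wc by simp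
    qed
    have gaw: "(\<Sum>i\<in>UNIV. \<Sum>j\<in>UNIV. g x $ i $ j * a $ i * w $ j) = - (1/2 * S)"
      unfolding gwa[symmetric] by (subst sum.swap) (simp add: gsym mult_ac)
    have dg: "((\<lambda>s. g (\<gamma> s) $ i $ j) has_real_derivative (\<Sum>l\<in>UNIV. d l i j * w $ l)) (at t)" for i j
      using has_real_derivative_along_curve[OF diff[OF geo(1)] geo(2), OF t t, of i j]
      by (simp add: d_def x_def w_def)
    have dv: "((\<lambda>s. v s $ i) has_real_derivative a $ i) (at t)" for i
      using has_vector_derivative_component[OF geo(3)[OF t]] by (simp add: a_def x_def w_def)
    have "((\<lambda>s. \<Sum>i\<in>UNIV. \<Sum>j\<in>UNIV. g (\<gamma> s) $ i $ j * v s $ i * v s $ j) has_real_derivative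
        (\<Sum>i\<in>UNIV. \<Sum>j\<in>UNIV. (((\<Sum>l\<in>UNIV. d l i j * w $ l) * v t $ i + a $ i * g (\<gamma> t) $ i $ j) * v t $ j
          + a $ j * (g (\<gamma> t) $ i $ j * v t $ i)))) (at t)"
      by (intro DERIV_sum DERIV_mult dg dv)
    moreover have "(\<Sum>i\<in>UNIV. \<Sum>j\<in>UNIV. (((\<Sum>l\<in>UNIV. d l i j * w $ l) * v t $ i + a $ i * g (\<gamma> t) $ i $ j) * v t $ j
          + a $ j * (g (\<gamma> t) $ i $ j * v t $ i)))
       = (\<Sum>i\<in>UNIV. \<Sum>j\<in>UNIV. \<Sum>l\<in>UNIV. d l i j * w $ l * w $ i * w $ j)
         + (\<Sum>i\<in>UNIV. \<Sum>j\<in>UNIV. g x $ i $ j * a $ i * w $ j)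
         + (\<Sum>i\<in>UNIV. \<Sum>j\<in>UNIV. g x $ i $ j * w $ i * a $ j)"
      unfolding x_def[symmetric] w_def[symmetric]
      by (simp add: sum.distrib[symmetric] sum_distrib_left sum_distrib_right algebra_simps)
    moreover have "(\<Sum>i\<in>UNIV. \<Sum>j\<in>UNIV. \<Sum>l\<in>UNIV. d l i j * w $ l * w $ i * w $ j) = S"
    proof -
      have "(\<Sum>i\<in>UNIV. \<Sum>j\<in>UNIV. \<Sum>l\<in>UNIV. d l i j * w $ l * w $ i * w $ j)
        = (\<Sum>i\<in>UNIV. \<Sum>l\<in>UNIV. \<Sum>j\<in>UNIV. d l i j * w $ l * w $ i * w $ j)"
        by (rule sum.cong[OF refl], rule sum.swap)
      also have "\<dots> = S" unfolding S_def by (rule sum.swap)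
      finally show ?thesis .
    qed
    ultimately show ?thesis using gwa gaw by simp
  qed
  moreover have "v s \<bullet> (g (\<gamma> s) *v v s) = (\<Sum>i\<in>UNIV. \<Sum>j\<in>UNIV. g (\<gamma> s) $ i $ j * v s $ i * v s $ j)" for s
    by (simp add: inner_vec_def matrix_vector_mult_def sum_distrib_left mult_ac)
  ultimately have "((\<lambda>t. v t \<bullet> (g (\<gamma> t) *v v t)) has_derivative (\<lambda>h. 0)) (at t within J)" if "t \<in> J" for t
    using that by (simp add: has_field_derivative_def has_derivative_at_withinI lambda_zero)
  moreover have "convex J" using sol by (simp add: ode_solution_def is_interval_convex)
  ultimately show ?thesis by (intro has_derivative_zero_constant)
qed

section \<open>The metric induced on a graph\<close>

text \<open>The pullback of the Euclidean metric under \<open>x \<mapsto> (x, F x)\<close>.\<close>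

definition graph_metric :: "(real^'m \<Rightarrow> real) \<Rightarrow> real^'m \<Rightarrow> real^'m^'m::finite" where
  "graph_metric F x = (\<chi> a b. (if a = b then 1 else 0)
     + partial_deriv F (axis a 1) x * partial_deriv F (axis b 1) x)"

definition gradient :: "(real^'m \<Rightarrow> real) \<Rightarrow> real^'m \<Rightarrow> real^'m::finite" where
  "gradient F x = (\<chi> a. partial_deriv F (axis a 1) x)"

lemma rank_one_update_mult:
  fixes n x :: "real^'m"
  shows "(\<chi> a b. (if a = b then 1 else 0) + k * (n $ a * n $ b)) *v x = x + (k * (n \<bullet> x)) *\<^sub>R n"
proof -
  have "(\<Sum>b\<in>UNIV. ((if a = b then 1 else 0) + k * (n $ a * n $ b)) * x $ b)
      = x $ a + k * (\<Sum>b\<in>UNIV. n $ b * x $ b) * n $ a" for a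
  proof -
    have "(\<Sum>b\<in>UNIV. ((if a = b then 1 else 0) + k * (n $ a * n $ b)) * x $ b)
      = (\<Sum>b\<in>UNIV. (if a = b then x $ b else 0) + k * (n $ b * x $ b) * n $ a)"
      by (rule sum.cong) (auto simp: algebra_simps)
    then show ?thesis by (simp add: sum.distrib sum_distrib_left sum_distrib_right)
  qed
  then show ?thesis by (simp add: vec_eq_iff matrix_vector_mult_def inner_vec_def)
qed

lemma graph_metric_mult:
  "graph_metric F x *v v = v + (gradient F x \<bullet> v) *\<^sub>R gradient F x"
  using rank_one_update_mult[of 1 "gradient F x" v] by (simp add: graph_metric_def gradient_def)

lemma graph_metric_norm:
  "v \<bullet> (graph_metric F x *v v) = (norm v)\<^sup>2 + (gradient F x \<bullet> v)\<^sup>2"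
  unfolding graph_metric_mult power2_norm_eq_inner
  by (simp add: inner_add_right power2_eq_square inner_commute)

text \<open>The Sherman--Morrison formula. It displays the entries of the inverse as smooth functions
  of the gradient, from which the regularity of the Christoffel symbols follows.\<close>

lemma graph_metric_inverse:
  fixes F :: "real^'m::finite \<Rightarrow> real"
  defines "h \<equiv> \<lambda>x. \<chi> a b. (if a = b then 1 else 0)
    + (- inverse (1 + gradient F x \<bullet> gradient F x)) * (gradient F x $ a * gradient F x $ b)"
  shows "graph_metric F x ** matrix_inv (graph_metric F x) = mat 1" "matrix_inv (graph_metric F x) = h x"
proof -
  let ?n = "gradient F x" and ?g = "graph_metric F x"
  have s: "1 + ?n \<bullet> ?n \<noteq> 0" using inner_ge_zero[of ?n] by linarith
  have "?g *v (h x *v v) = v" for v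
  proof -
    define c where "c = (?n \<bullet> v) / (1 + ?n \<bullet> ?n)"
    have c: "?n \<bullet> v - c * (?n \<bullet> ?n) = c" using s by (simp add: c_def divide_simps) (simp add: algebra_simps)
    have "h x *v v = v - c *\<^sub>R ?n"
      unfolding h_def rank_one_update_mult by (simp add: c_def divide_inverse mult.commute)
    moreover have "?g *v (v - c *\<^sub>R ?n) = (v - c *\<^sub>R ?n) + (?n \<bullet> v - c * (?n \<bullet> ?n)) *\<^sub>R ?n"
      by (simp add: graph_metric_mult inner_diff_right)
    ultimately show ?thesis unfolding c by simp
  qed
  then have gh: "?g ** h x = mat 1"
    by (simp add: matrix_eq matrix_vector_mul_assoc[symmetric])
  then have hg: "h x ** ?g = mat 1" using matrix_left_right_inverse by blast
  have *: "?g ** matrix_inv ?g = mat 1 \<and> matrix_inv ?g ** ?g = mat 1"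
    unfolding matrix_inv_def by (rule someI[of _ "h x"]) (use gh hg in blast)
  then show "?g ** matrix_inv ?g = mat 1" by blast
  have "matrix_inv ?g = h x ** (?g ** matrix_inv ?g)"
    using hg by (simp add: matrix_mul_assoc)
  then show "matrix_inv ?g = h x" using * by simp
qed

text \<open>The energy bounds both the speed of a geodesic and the rate of change of \<open>F\<close> along it, so
  within bounded time a geodesic stays in a compact sublevel region of \<open>F\<close>.\<close>

theorem graph_metric_complete:
  fixes F :: "real^'m::finite \<Rightarrow> real"
  assumes U: "open U" and C3: "Ck_on 3 F U" and proper: "proper_on U F"
  shows "riemannian_metric_on U (graph_metric F)" and "geodesically_complete U (graph_metric F)"
proof -
  let ?g = "graph_metric F"
  have C3': "Ck_on (Suc 2) F U" using C3 by (simp add: numeral_3_eq_3 numeral_2_eq_2)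
  have Cn: "Ck_on 2 (partial_deriv F (axis a 1)) U" for a
    using C3' by (simp add: numeral_2_eq_2)
  have Cg: "Ck_on 2 (\<lambda>x. ?g x $ a $ b) U" for a b
    unfolding graph_metric_def vec_lambda_beta by (intro Ck_on_add Ck_on_const Ck_on_mult Cn U)
  have sym: "transpose (?g x) = ?g x" for x
    by (simp add: transpose_def graph_metric_def vec_eq_iff)
  show "riemannian_metric_on U ?g"
    unfolding riemannian_metric_on_def
    by (intro conjI ballI allI impI U Cg sym) (simp add: graph_metric_norm add_pos_nonneg)
  have Cn1: "Ck_on 1 (\<lambda>x. gradient F x $ a) U" for a
    using Ck_on_mono[OF Cn, of 1 a] by (simp add: gradient_def)
  have Cinv: "Ck_on 1 (\<lambda>x. matrix_inv (?g x) $ k $ l) U" for k l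
  proof -
    have pos: "1 + (\<Sum>i\<in>UNIV. gradient F x $ i * gradient F x $ i) \<noteq> 0" for x
    proof -
      have "(\<Sum>i\<in>UNIV. gradient F x $ i * gradient F x $ i) \<ge> 0" by (intro sum_nonneg) simp
      then show ?thesis by linarith
    qed
    have "Ck_on 1 (\<lambda>x. (if k = l then 1 else 0) + ((-1) *
        inverse (1 + (\<Sum>i\<in>UNIV. gradient F x $ i * gradient F x $ i))) * (gradient F x $ k * gradient F x $ l)) U"
      using pos by (intro Ck_on_add Ck_on_const Ck_on_mult Ck_on_inverse Ck_on_sum Cn1 U)
    then show ?thesis by (simp add: graph_metric_inverse(2) inner_vec_def)
  qed
  have Cdg: "Ck_on 1 (partial_deriv (\<lambda>y. ?g y $ a $ b) (axis c 1)) U" for a b c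
    using Cg[of a b] by (simp add: numeral_2_eq_2)
  have Cchr: "Ck_on 1 (\<lambda>x. christoffel ?g x k i j) U" for k i j
    unfolding christoffel_def
    by (intro Ck_on_cmult Ck_on_sum Ck_on_mult Ck_on_add Ck_on_diff Cinv Cdg U)
  note lip = geodesic_field_locally_lipschitz[OF U Cchr]
  have diffg: "(\<lambda>x. ?g x $ a $ b) differentiable (at x)" if "x \<in> U" for x a b
    using Cg[of a b] that by (simp add: numeral_2_eq_2)
  have diffF: "F differentiable (at x)" if "x \<in> U" for x
    using C3' that unfolding Ck_on.simps by blast
  have cpt: "\<exists>K. compact K \<and> K \<subseteq> U \<times> UNIV \<and> \<phi> ` J \<subseteq> K"
    if sol: "ode_solution (geodesic_field ?g) (U \<times> UNIV) J \<phi>" and bJ: "bounded J" for J \<phi>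
  proof (cases "J = {}")
    case False
    then obtain t0 where t0: "t0 \<in> J" by blast
    define \<gamma> where "\<gamma> t = fst (\<phi> t)" for t
    define v where "v t = snd (\<phi> t)" for t
    have \<phi>: "\<phi> = (\<lambda>t. (\<gamma> t, v t))" by (simp add: \<gamma>_def v_def)
    obtain E where E: "\<forall>t\<in>J. v t \<bullet> (?g (\<gamma> t) *v v t) = E"
      using geodesic_energy_constant[OF sol[unfolded \<phi>] diffg sym graph_metric_inverse(1)] ..
    have E2: "(norm (v t))\<^sup>2 + (gradient F (\<gamma> t) \<bullet> v t)\<^sup>2 = E" if "t \<in> J" for t
      using E that by (simp add: graph_metric_norm)
    have nv: "norm (v t) \<le> sqrt E" if "t \<in> J" for t
    proof (rule real_le_rsqrt)
      show "(norm (v t))\<^sup>2 \<le> E" using E2[OF that] zero_le_power2[of "gradient F (\<gamma> t) \<bullet> v t"] by linarith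
    qed
    have nF: "\<bar>gradient F (\<gamma> t) \<bullet> v t\<bar> \<le> sqrt E" if "t \<in> J" for t
    proof (rule real_le_rsqrt)
      show "\<bar>gradient F (\<gamma> t) \<bullet> v t\<bar>\<^sup>2 \<le> E"
        unfolding power2_abs using E2[OF that] zero_le_power2[of "norm (v t)"] by linarith
    qed
    have \<gamma>U: "\<gamma> t \<in> U" and d\<gamma>: "(\<gamma> has_vector_derivative v t) (at t)" if "t \<in> J" for t
      using sol that bounded_linear.has_vector_derivative[OF bounded_linear_fst, of \<phi> "geodesic_field ?g (\<phi> t)" "at t"]
      by (auto simp: ode_solution_def geodesic_field_def \<phi>)
    obtain d where d: "\<And>s t. s \<in> J \<Longrightarrow> t \<in> J \<Longrightarrow> dist s t \<le> d"
      using bJ unfolding bounded_two_points by blast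
    have Fb: "F (\<gamma> t) \<in> cball (F (\<gamma> t0)) (sqrt E * d)" if t: "t \<in> J" for t
    proof -
      have "norm (F (\<gamma> t0) - F (\<gamma> t)) \<le> sqrt E * norm (t0 - t)"
      proof (rule field_differentiable_bound[OF _ _ _ t0 t])
        show "convex J" using sol by (simp add: ode_solution_def is_interval_convex)
        fix s assume s: "s \<in> J"
        show "((\<lambda>s. F (\<gamma> s)) has_field_derivative (gradient F (\<gamma> s) \<bullet> v s)) (at s within J)"
          using has_real_derivative_along_curve[OF diffF[OF \<gamma>U[OF s]] d\<gamma>[OF s]]
          by (simp add: inner_vec_def gradient_def has_field_derivative_at_within)
        show "norm (gradient F (\<gamma> s) \<bullet> v s) \<le> sqrt E" using nF[OF s] by simp
      qed
      also have "\<dots> \<le> sqrt E * d"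
        using d[OF t0 t] E2[OF t0] by (intro mult_left_mono) (auto simp: dist_norm)
      finally show ?thesis by (simp add: dist_norm)
    qed
    let ?K = "{x\<in>U. F x \<in> cball (F (\<gamma> t0)) (sqrt E * d)} \<times> cball (0 :: real^'m) (sqrt E)"
    have "compact {x\<in>U. F x \<in> cball (F (\<gamma> t0)) (sqrt E * d)}"
      by (rule proper[unfolded proper_on_def, rule_format, OF compact_cball])
    then have "compact ?K" by (intro compact_Times compact_cball)
    moreover have "?K \<subseteq> U \<times> UNIV" by blast
    moreover have "\<phi> ` J \<subseteq> ?K"
    proof (rule image_subsetI)
      fix t assume "t \<in> J"
      then have "v t \<in> cball 0 (sqrt E)" using nv by simp
      then show "\<phi> t \<in> ?K" unfolding \<phi> using Fb[OF \<open>t \<in> J\<close>] \<gamma>U[OF \<open>t \<in> J\<close>] by blast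
    qed
    ultimately show ?thesis by (intro exI[of _ ?K] conjI)
  next
    case True
    then show ?thesis by (intro exI[of _ "{}"]) simp
  qed
  show "geodesically_complete U ?g"
    unfolding geodesically_complete_def
  proof (intro allI impI)
    fix I \<gamma> assume *: "open I \<and> is_interval I \<and> I \<noteq> {} \<and> geodesic_on U ?g I \<gamma>"
    then have "\<exists>v. ode_solution (geodesic_field ?g) (U \<times> UNIV) I (\<lambda>t. (\<gamma> t, v t))"
      using geodesic_on_iff_ode_solution[of I U ?g \<gamma>] by blast
    then obtain v where "ode_solution (geodesic_field ?g) (U \<times> UNIV) I (\<lambda>t. (\<gamma> t, v t))" ..
    moreover have "I \<noteq> {}" using * by blast
    ultimately have "\<exists>\<psi>. ode_solution (geodesic_field ?g) (U \<times> UNIV) UNIV \<psi> \<and> (\<forall>t\<in>I. \<psi> t = (\<gamma> t, v t))"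
      using cpt by (rule solution_extends_to_UNIV[OF lip])
    then obtain \<psi> where \<psi>: "ode_solution (geodesic_field ?g) (U \<times> UNIV) UNIV \<psi>" "\<forall>t\<in>I. \<psi> t = (\<gamma> t, v t)"
      by (elim exE conjE)
    have "ode_solution (geodesic_field ?g) (U \<times> UNIV) UNIV (\<lambda>t. (fst (\<psi> t), snd (\<psi> t)))"
      using \<psi>(1) by simp
    then have "geodesic_on U ?g UNIV (\<lambda>t. fst (\<psi> t))"
      unfolding geodesic_on_iff_ode_solution[OF open_UNIV is_interval_univ]
      by (rule exI[of _ "\<lambda>t. snd (\<psi> t)"])
    then show "\<exists>\<gamma>'. geodesic_on U ?g UNIV \<gamma>' \<and> (\<forall>t\<in>I. \<gamma>' t = \<gamma> t)"
      using \<psi>(2) by (intro exI[of _ "\<lambda>t. fst (\<psi> t)"]) simp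
  qed
qed

section \<open>Cells and barycentric weights\<close>

abbreviation cell :: "real^'n^2 \<Rightarrow> 'n set \<Rightarrow> (real^2) set" where
  "cell Q \<sigma> \<equiv> convex hull ((\<lambda>i. column i Q) ` \<sigma>)"

definition weights :: "'n set \<Rightarrow> (real^'n::finite) set" where
  "weights \<sigma> = {w. (\<forall>i. 0 \<le> w $ i) \<and> (\<forall>i. i \<notin> \<sigma> \<longrightarrow> w $ i = 0) \<and> (\<Sum>i\<in>UNIV. w $ i) = 1}"

text \<open>A nonzero \<open>w\<close> of this kind, split into its positive and its negative part, is a point with
  barycentric coordinates in \<open>\<sigma>\<close> and in \<open>\<tau>\<close> with disjoint supports. So separation says that any
  coordinates in \<open>\<sigma>\<close> and any coordinates in \<open>\<tau>\<close> of the same point agree. In particular,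
  \<open>separated Q \<sigma> \<sigma>\<close> is affine independence on \<open>\<sigma>\<close>. The point of the formulation is that the
  admissible \<open>w\<close> form a closed cone that does not depend on \<open>Q\<close>.\<close>

definition separated :: "real^'n::finite^2 \<Rightarrow> 'n set \<Rightarrow> 'n set \<Rightarrow> bool" where
  "separated Q \<sigma> \<tau> \<longleftrightarrow> (\<forall>w. Q *v w = 0 \<and> (\<Sum>i\<in>UNIV. w $ i) = 0 \<and>
     (\<forall>i. i \<notin> \<tau> \<longrightarrow> 0 \<le> w $ i) \<and> (\<forall>i. i \<notin> \<sigma> \<longrightarrow> w $ i \<le> 0) \<longrightarrow> w = 0)"

lemma mult_columns: "Q *v w = (\<Sum>i\<in>UNIV. w $ i *\<^sub>R column i Q)" for Q :: "real^'n^'m"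
  by (simp add: matrix_mult_sum scalar_mult_eq_scaleR)

lemma mult_columns_on:
  fixes Q :: "real^'n::finite^'m"
  assumes "\<And>i. i \<notin> \<sigma> \<Longrightarrow> w $ i = 0"
  shows "Q *v w = (\<Sum>i\<in>\<sigma>. w $ i *\<^sub>R column i Q)"
  unfolding mult_columns by (rule sum.mono_neutral_right) (use assms in auto)

lemma sum_weights_on:
  fixes w :: "real^'n::finite"
  assumes "\<And>i. i \<notin> \<sigma> \<Longrightarrow> w $ i = 0"
  shows "(\<Sum>i\<in>UNIV. w $ i) = (\<Sum>i\<in>\<sigma>. w $ i)"
  by (rule sum.mono_neutral_right) (use assms in auto)

lemma weights_mono: "\<sigma> \<subseteq> \<tau> \<Longrightarrow> weights \<sigma> \<subseteq> weights \<tau>"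
  by (auto simp: weights_def)

lemma axis_in_weights: "i \<in> \<sigma> \<Longrightarrow> axis i 1 \<in> weights \<sigma>"
  by (auto simp: weights_def axis_def)

lemma convex_weights: "convex (weights \<sigma>)"
  by (auto simp: weights_def convex_def sum.distrib sum_distrib_left[symmetric])

text \<open>Coordinates are indexed by vertices, not by points, so this holds even if \<open>Q\<close> maps several
  vertices of \<open>\<sigma>\<close> to the same point.\<close>

lemma cell_eq_weights: "cell Q \<sigma> = (\<lambda>w. Q *v w) ` weights \<sigma>"
proof
  have "column i Q \<in> (\<lambda>w. Q *v w) ` weights \<sigma>" if "i \<in> \<sigma>" for i
    using axis_in_weights[OF that] matrix_vector_mult_basis[of Q i] by (metis image_eqI)
  moreover have "convex ((\<lambda>w. Q *v w) ` weights \<sigma>)"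
    by (intro convex_linear_image matrix_vector_mul_linear convex_weights)
  ultimately show "cell Q \<sigma> \<subseteq> (\<lambda>w. Q *v w) ` weights \<sigma>" by (intro hull_minimal) auto
  show "(\<lambda>w. Q *v w) ` weights \<sigma> \<subseteq> cell Q \<sigma>"
  proof (rule image_subsetI)
    fix w :: "real^'a" assume w: "w \<in> weights \<sigma>"
    then have off: "\<And>i. i \<notin> \<sigma> \<Longrightarrow> w $ i = 0" by (simp add: weights_def)
    have "(\<Sum>i\<in>\<sigma>. w $ i *\<^sub>R column i Q) \<in> cell Q \<sigma>"
      using w sum_weights_on[of \<sigma> w] off
      by (intro convex_sum) (auto simp: weights_def intro: hull_inc)
    then show "Q *v w \<in> cell Q \<sigma>" using mult_columns_on[of \<sigma> w Q] off by simp
  qed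
qed

lemma cell_mono: "\<sigma> \<subseteq> \<tau> \<Longrightarrow> cell Q \<sigma> \<subseteq> cell Q \<tau>"
  by (intro hull_mono image_mono)

text \<open>For weights, the face whose cell contains the point with these coordinates in its relative
  interior.\<close>

definition support :: "real^'n::finite \<Rightarrow> 'n set" where
  "support w = {i. w $ i > 0}"

lemma weights_support:
  assumes "w \<in> weights \<sigma>"
  shows "w \<in> weights (support w)" "support w \<subseteq> \<sigma>" "support w \<noteq> {}"
proof -
  show 1: "w \<in> weights (support w)" using assms by (auto simp: weights_def support_def order.order_iff_strict)
  show "support w \<subseteq> \<sigma>" using assms by (force simp: weights_def support_def)
  show "support w \<noteq> {}" using 1 by (auto simp: weights_def)
qed

section \<open>Separated cells\<close>

lemma separated_mono: "separated Q \<sigma> \<tau> \<Longrightarrow> \<sigma>' \<subseteq> \<sigma> \<Longrightarrow> \<tau>' \<subseteq> \<tau> \<Longrightarrow> separated Q \<sigma>' \<tau>'"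
  unfolding separated_def by (meson subsetD)

lemma separated_weights_eq:
  assumes "separated Q \<sigma> \<tau>" "w \<in> weights \<sigma>" "w' \<in> weights \<tau>" "Q *v w = Q *v w'"
  shows "w = w'"
proof -
  have "w - w' = 0"
    using assms(1)[unfolded separated_def, rule_format, of "w - w'"] assms(2-)
    by (simp add: weights_def matrix_vector_mult_diff_distrib sum_subtractf)
  then show ?thesis by simp
qed

lemma separated_cell_Int:
  assumes "separated Q \<sigma> \<tau>"
  shows "cell Q \<sigma> \<inter> cell Q \<tau> = cell Q (\<sigma> \<inter> \<tau>)"
proof
  show "cell Q \<sigma> \<inter> cell Q \<tau> \<subseteq> cell Q (\<sigma> \<inter> \<tau>)"
  proof
    fix x assume "x \<in> cell Q \<sigma> \<inter> cell Q \<tau>"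
    then obtain w w' where *: "x = Q *v w" "w \<in> weights \<sigma>" "x = Q *v w'" "w' \<in> weights \<tau>"
      unfolding cell_eq_weights by blast
    then have "w = w'" using separated_weights_eq[OF assms] by simp
    then have "w \<in> weights (\<sigma> \<inter> \<tau>)" using * by (auto simp: weights_def)
    then show "x \<in> cell Q (\<sigma> \<inter> \<tau>)" unfolding cell_eq_weights using * by blast
  qed
qed (use cell_mono[of "\<sigma> \<inter> \<tau>"] in blast)

text \<open>If \<open>w\<close> is a relation as in the definition of separation, its normalized positive and
  negative parts are coordinates, in \<open>\<sigma>\<close> and in \<open>\<tau>\<close>, of a common point of the cells. This point
  also has coordinates in \<open>\<sigma> \<inter> \<tau>\<close>, and uniqueness of coordinates in \<open>\<sigma>\<close> and in \<open>\<tau>\<close> identifies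
  all three, so that \<open>w = 0\<close>.\<close>

lemma separated_if_cell_Int:
  assumes \<sigma>: "separated Q \<sigma> \<sigma>" and \<tau>: "separated Q \<tau> \<tau>"
    and Int: "cell Q \<sigma> \<inter> cell Q \<tau> \<subseteq> cell Q (\<sigma> \<inter> \<tau>)"
  shows "separated Q \<sigma> \<tau>"
  unfolding separated_def
proof (intro allI impI, rule ccontr)
  fix w assume w: "Q *v w = 0 \<and> (\<Sum>i\<in>UNIV. w $ i) = 0 \<and> (\<forall>i. i \<notin> \<tau> \<longrightarrow> 0 \<le> w $ i) \<and> (\<forall>i. i \<notin> \<sigma> \<longrightarrow> w $ i \<le> 0)"
    and "w \<noteq> 0"
  \<comment> \<open>positive and negative part, which have the same total mass \<open>s\<close>\<close>
  define p where "p = (\<chi> i. max (w $ i) 0)"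
  define n where "n = (\<chi> i. max (- w $ i) 0)"
  define s where "s = (\<Sum>i\<in>UNIV. p $ i)"
  have wpn: "w = p - n" by (simp add: vec_eq_iff p_def n_def max_def)
  have sn: "s = (\<Sum>i\<in>UNIV. n $ i)"
    using w unfolding wpn s_def by (simp add: sum_subtractf)
  have "s > 0"
  proof (rule ccontr)
    assume "\<not> s > 0"
    moreover have "s \<ge> 0" unfolding s_def p_def by (auto intro: sum_nonneg)
    ultimately have "s = 0" by simp
    then have "p = 0" "n = 0"
      using sn unfolding s_def p_def n_def by (auto simp: sum_nonneg_eq_0_iff vec_eq_iff)
    then show False using wpn \<open>w \<noteq> 0\<close> by simp
  qed
  define l where "l = (1 / s) *\<^sub>R p"
  define m where "m = (1 / s) *\<^sub>R n"
  have l: "l \<in> weights \<sigma>"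
    using \<open>s > 0\<close> w by (auto simp: weights_def l_def p_def s_def sum_divide_distrib[symmetric])
  have m: "m \<in> weights \<tau>"
    using \<open>s > 0\<close> w by (auto simp: weights_def m_def n_def sn sum_divide_distrib[symmetric])
  have "l - m = (1 / s) *\<^sub>R w" by (simp add: l_def m_def wpn scaleR_diff_right)
  then have "Q *v (l - m) = 0" using w by (simp add: matrix_vector_mult_scaleR)
  then have lm: "Q *v l = Q *v m" by (simp add: matrix_vector_mult_diff_distrib)
  have "Q *v l \<in> cell Q \<sigma>" using l unfolding cell_eq_weights by (rule imageI)
  moreover have "Q *v l \<in> cell Q \<tau>" using m unfolding cell_eq_weights lm by (rule imageI)
  ultimately have "Q *v l \<in> cell Q \<sigma> \<inter> cell Q \<tau>" by blast
  then obtain k where k: "k \<in> weights (\<sigma> \<inter> \<tau>)" "Q *v l = Q *v k"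
    using Int unfolding cell_eq_weights by blast
  have "k \<in> weights \<sigma>" "k \<in> weights \<tau>"
    using k(1) weights_mono[of "\<sigma> \<inter> \<tau>" \<sigma>] weights_mono[of "\<sigma> \<inter> \<tau>" \<tau>] by blast+
  then have "l = k" "m = k"
    using separated_weights_eq[OF \<sigma> l _ k(2)] separated_weights_eq[OF \<tau> m, of k] k(2) lm by simp_all
  then show False using \<open>l - m = (1 / s) *\<^sub>R w\<close> \<open>w \<noteq> 0\<close> \<open>s > 0\<close> by simp
qed

lemma separated_self_inj_on:
  assumes "separated Q \<sigma> \<sigma>"
  shows "inj_on (\<lambda>i. column i Q) \<sigma>"
proof (rule inj_onI)
  fix i j assume ij: "i \<in> \<sigma>" "j \<in> \<sigma>" "column i Q = column j Q"
  then have "Q *v axis i 1 = Q *v axis j 1" by (simp add: matrix_vector_mult_basis)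
  then have "axis i 1 = (axis j 1 :: real^'a)"
    by (rule separated_weights_eq[OF assms axis_in_weights[OF ij(1)] axis_in_weights[OF ij(2)]])
  then show "i = j" by (simp add: axis_eq_axis)
qed

lemma separated_self_affine_independent:
  assumes sep: "separated Q \<sigma> \<sigma>"
  shows "\<not> affine_dependent ((\<lambda>i. column i Q) ` \<sigma>)"
proof
  note inj = separated_self_inj_on[OF sep]
  assume "affine_dependent ((\<lambda>i. column i Q) ` \<sigma>)"
  then obtain U i where U: "sum U ((\<lambda>i. column i Q) ` \<sigma>) = 0" "i \<in> \<sigma>" "U (column i Q) \<noteq> 0"
    "(\<Sum>v\<in>(\<lambda>i. column i Q) ` \<sigma>. U v *\<^sub>R v) = 0"
    by (auto simp: affine_dependent_explicit_finite)
  define w where "w = (\<chi> i. if i \<in> \<sigma> then U (column i Q) else 0)"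
  have off: "\<And>i. i \<notin> \<sigma> \<Longrightarrow> w $ i = 0" by (simp add: w_def)
  have "Q *v w = 0"
    using U(4) mult_columns_on[of \<sigma> w Q] off by (simp add: sum.reindex[OF inj] w_def cong: sum.cong)
  moreover have "(\<Sum>i\<in>UNIV. w $ i) = 0"
    using U(1) sum_weights_on[of \<sigma> w] off by (simp add: sum.reindex[OF inj] w_def cong: sum.cong)
  ultimately have "w = 0"
    by (intro sep[unfolded separated_def, rule_format, of w] conjI allI impI) (simp_all add: off)
  then have "w $ i = 0" by simp
  then show False using U(2,3) by (simp add: w_def)
qed

section \<open>Signed areas\<close>

text \<open>Twice the signed area of the triangle \<open>p q r\<close>.\<close>

definition area2 :: "real^2 \<Rightarrow> real^2 \<Rightarrow> real^2 \<Rightarrow> real" where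
  "area2 p q r = (q$1 - p$1) * (r$2 - p$2) - (q$2 - p$2) * (r$1 - p$1)"

lemma signed_area_eq: "signed_area Q t = area2 (column (t 0) Q) (column (t 1) Q) (column (t 2) Q) / 2"
  by (simp add: signed_area_def area2_def det_2 transpose_def vector_2 algebra_simps)

lemma area2_rotate: "area2 q r p = area2 p q r"
  by (simp add: area2_def algebra_simps)

lemma area2_swap: "area2 q p r = - area2 p q r"
  by (simp add: area2_def algebra_simps)

text \<open>The barycentric coordinates of \<open>x\<close> are quotients of areas.\<close>

lemma area2_barycentric:
  fixes p q r x :: "real^2"
  assumes "u + v + w = (1::real)" and x_def: "x = u *\<^sub>R p + v *\<^sub>R q + w *\<^sub>R r"
  shows "area2 x q r = u * area2 p q r" "area2 p x r = v * area2 p q r" "area2 p q x = w * area2 p q r"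
proof -
  have u: "u = 1 - v - w" using assms by simp
  show "area2 x q r = u * area2 p q r" "area2 p x r = v * area2 p q r" "area2 p q x = w * area2 p q r"
    unfolding area2_def x_def u by (simp_all add: algebra_simps)
qed

lemma in_triangle_if_areas_nonneg:
  assumes A: "area2 p q r > 0" and "area2 y q r \<ge> 0" "area2 p y r \<ge> 0" "area2 p q y \<ge> 0"
  shows "y \<in> convex hull {p, q, r}"
proof -
  let ?A = "area2 p q r"
  have "area2 y q r / ?A + area2 p y r / ?A + area2 p q y / ?A = 1"
  proof -
    have "area2 y q r + area2 p y r + area2 p q y = ?A" by (simp add: area2_def algebra_simps)
    then show ?thesis using A by (simp add: add_divide_distrib[symmetric])
  qed
  moreover have "y = (area2 y q r / ?A) *\<^sub>R p + (area2 p y r / ?A) *\<^sub>R q + (area2 p q y / ?A) *\<^sub>R r"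
  proof -
    have "?A *\<^sub>R y = area2 y q r *\<^sub>R p + area2 p y r *\<^sub>R q + area2 p q y *\<^sub>R r"
      by (simp add: vec_eq_iff forall_2 area2_def algebra_simps)
    then have "(1 / ?A) *\<^sub>R (?A *\<^sub>R y) = (1 / ?A) *\<^sub>R (area2 y q r *\<^sub>R p + area2 p y r *\<^sub>R q + area2 p q y *\<^sub>R r)"
      by simp
    then show ?thesis using A by (simp add: scaleR_add_right)
  qed
  ultimately show ?thesis using assms unfolding convex_hull_3 by (auto intro!: exI divide_nonneg_pos)
qed

lemma continuous_on_area2 [continuous_intros]:
  "continuous_on S f \<Longrightarrow> continuous_on S g \<Longrightarrow> continuous_on S h \<Longrightarrow> continuous_on S (\<lambda>x. area2 (f x) (g x) (h x))"
  unfolding area2_def by (intro continuous_intros)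

lemma bounded_linear_column: "bounded_linear (\<lambda>Q :: real^'n^'m. column i Q)"
  by (rule linear_conv_bounded_linear[THEN iffD1]) (auto intro!: linearI simp: column_def vec_eq_iff)

lemma continuous_on_column [continuous_intros]:
  fixes f :: "'a::topological_space \<Rightarrow> real^'n^'m"
  shows "continuous_on S f \<Longrightarrow> continuous_on S (\<lambda>x. column i (f x))"
  by (rule bounded_linear.continuous_on[OF bounded_linear_column])

text \<open>A relation among the vertices is a relation between two edge vectors; Cramer's rule for
  the two coordinates makes it trivial.\<close>

lemma separated_triangle:
  assumes "area2 (column a Q) (column b Q) (column c Q) \<noteq> 0"
  shows "separated Q {a, b, c} {a, b, c}"
  unfolding separated_def
proof (intro allI impI)
  let ?A = "column a Q" and ?B = "column b Q" and ?C = "column c Q"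
  have d: "a \<noteq> b" "a \<noteq> c" "b \<noteq> c" using assms by (auto simp: area2_def)
  fix w assume w: "Q *v w = 0 \<and> (\<Sum>i\<in>UNIV. w $ i) = 0 \<and> (\<forall>i. i \<notin> {a, b, c} \<longrightarrow> 0 \<le> w $ i) \<and> (\<forall>i. i \<notin> {a, b, c} \<longrightarrow> w $ i \<le> 0)"
  then have off: "\<And>i. i \<notin> {a, b, c} \<Longrightarrow> w $ i = 0" by (meson order_antisym)
  have comb: "w $ a *\<^sub>R ?A + w $ b *\<^sub>R ?B + w $ c *\<^sub>R ?C = 0"
    using w mult_columns_on[of "{a, b, c}" w Q] off d by (simp add: add_ac)
  have 1: "w $ a * ?A $ k + w $ b * ?B $ k + w $ c * ?C $ k = 0" for k
    using arg_cong[OF comb, of "\<lambda>x. x $ k"] by simp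
  have 2: "w $ a = - w $ b - w $ c"
    using w sum_weights_on[of "{a, b, c}" w] off d by simp
  have e: "w $ b * (?B $ k - ?A $ k) + w $ c * (?C $ k - ?A $ k) = 0" for k
    using 1[of k] unfolding 2 by (simp add: algebra_simps)
  have "w $ b * area2 ?A ?B ?C = (w $ b * (?B $ 1 - ?A $ 1) + w $ c * (?C $ 1 - ?A $ 1)) * (?C $ 2 - ?A $ 2)
     - (w $ b * (?B $ 2 - ?A $ 2) + w $ c * (?C $ 2 - ?A $ 2)) * (?C $ 1 - ?A $ 1)"
    by (simp add: area2_def algebra_simps)
  then have b: "w $ b = 0" unfolding e using assms by simp
  have "w $ c * area2 ?A ?B ?C = (w $ b * (?B $ 2 - ?A $ 2) + w $ c * (?C $ 2 - ?A $ 2)) * (?B $ 1 - ?A $ 1)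
     - (w $ b * (?B $ 1 - ?A $ 1) + w $ c * (?C $ 1 - ?A $ 1)) * (?B $ 2 - ?A $ 2)"
    by (simp add: area2_def algebra_simps)
  then have "w $ c = 0" unfolding e using assms by simp
  then have "w $ i = 0" for i using b 2 off by (cases "i \<in> {a, b, c}") auto
  then show "w = 0" by (simp add: vec_eq_iff)
qed

section \<open>Orientations\<close>

lemma mod_3: "(3 :: 3) = 0" "(4 :: 3) = 1"
  by simp_all

lemma UNIV_3_zero: "(UNIV :: 3 set) = {0, 1, 2}"
  using UNIV_3 by auto

lemma oriented_class_refl: "t \<in> oriented_class t"
  unfolding oriented_class_def by (rule CollectI, rule exI[of _ id]) (simp add: permutes_id evenperm_id)

lemma induced_edgesI:
  assumes "t \<in> C"
  shows "(t 0, t 1) \<in> induced_edges C" "(t 1, t 2) \<in> induced_edges C" "(t 2, t 0) \<in> induced_edges C"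
proof -
  have *: "(t (l + 1), t (l + 2)) \<in> induced_edges C" for l
    using assms by (auto simp: induced_edges_def)
  show "(t 0, t 1) \<in> induced_edges C" "(t 1, t 2) \<in> induced_edges C" "(t 2, t 0) \<in> induced_edges C"
    using *[of 2] *[of 0] *[of 1] by (simp_all add: mod_3)
qed

section \<open>Realizations as separated configurations\<close>

definition positively_oriented :: "'n::finite set set \<Rightarrow> ('n set \<Rightarrow> (3 \<Rightarrow> 'n) set) \<Rightarrow> real^'n^2 \<Rightarrow> bool" where
  "positively_oriented \<Delta> ori Q \<longleftrightarrow> (\<forall>\<sigma>\<in>faces 2 \<Delta>. \<forall>t\<in>ori \<sigma>. signed_area Q t > 0)"

locale oriented_complex =
  fixes \<Delta> :: "'n::finite set set" and ori :: "'n set \<Rightarrow> (3 \<Rightarrow> 'n) set"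
  assumes connectivity: "connectivity_complex \<Delta>" and vertices: "\<Union>\<Delta> = UNIV"
    and oriented: "consistently_oriented \<Delta> ori"
begin

lemma face_subset: "\<sigma> \<in> \<Delta> \<Longrightarrow> \<tau> \<subseteq> \<sigma> \<Longrightarrow> \<tau> \<noteq> {} \<Longrightarrow> \<tau> \<in> \<Delta>"
  and empty_notin: "{} \<notin> \<Delta>" and card_face: "\<sigma> \<in> \<Delta> \<Longrightarrow> card \<sigma> \<le> 3"
  and nonempty: "\<Delta> \<noteq> {}"
  using connectivity
  unfolding connectivity_complex_def simplicial_2_complex_def abstract_simplicial_complex_def by auto

lemma face_in_2_face:
  assumes "\<sigma> \<in> \<Delta>"
  obtains \<tau> where "\<tau> \<in> faces 2 \<Delta>" "\<sigma> \<subseteq> \<tau>"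
proof -
  obtain \<tau> where \<tau>: "\<tau> \<in> \<Delta>" "\<sigma> \<subseteq> \<tau>" "\<And>\<tau>'. \<tau>' \<in> \<Delta> \<Longrightarrow> \<tau> \<subseteq> \<tau>' \<Longrightarrow> \<tau> = \<tau>'"
    using finite_has_maximal2[of \<Delta> \<sigma>] assms by auto
  then have "\<tau> \<in> faces 2 \<Delta>"
    using connectivity unfolding connectivity_complex_def pure_2_complex_def by blast
  then show ?thesis using that \<tau>(2) by blast
qed

lemma faces_2: "\<sigma> \<in> faces 2 \<Delta> \<Longrightarrow> \<sigma> \<in> \<Delta> \<and> card \<sigma> = 3"
  by (simp add: faces_def)

lemma ori_class:
  assumes "\<sigma> \<in> faces 2 \<Delta>"
  obtains t where "bij_betw t UNIV \<sigma>" "ori \<sigma> = oriented_class t"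
proof -
  have "\<forall>\<sigma>\<in>faces 2 \<Delta>. orientation_of \<sigma> (ori \<sigma>)"
    using oriented unfolding consistently_oriented_def by (rule conjunct1)
  then have "orientation_of \<sigma> (ori \<sigma>)" using assms by (rule bspec)
  then show ?thesis unfolding orientation_of_def using that by (elim exE conjE)
qed

lemma ori_bij:
  assumes "\<sigma> \<in> faces 2 \<Delta>" "t \<in> ori \<sigma>"
  shows "bij_betw t UNIV \<sigma>"
proof -
  obtain t0 where t0: "bij_betw t0 UNIV \<sigma>" "ori \<sigma> = oriented_class t0"
    using ori_class[OF assms(1)] .
  then obtain p where p: "t = t0 \<circ> p" "p permutes (UNIV :: 3 set)"
    using assms(2) by (auto simp: oriented_class_def)
  show ?thesis unfolding p(1) by (rule bij_betw_trans[OF permutes_imp_bij[OF p(2)] t0(1)])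
qed

lemma ori_nonempty:
  assumes "\<sigma> \<in> faces 2 \<Delta>"
  shows "\<exists>t. t \<in> ori \<sigma>"
proof -
  obtain t where "ori \<sigma> = oriented_class t" using ori_class[OF assms] .
  then show ?thesis using oriented_class_refl by auto
qed

lemma ori_vertices:
  assumes "\<sigma> \<in> faces 2 \<Delta>" "t \<in> ori \<sigma>"
  shows "\<sigma> = {t 0, t 1, t 2}" "t 0 \<noteq> t 1" "t 1 \<noteq> t 2" "t 0 \<noteq> t 2"
  using ori_bij[OF assms] unfolding UNIV_3_zero bij_betw_def by (auto simp: inj_on_def)

lemma induced_edge_total:
  assumes "\<sigma> \<in> faces 2 \<Delta>" "a \<in> \<sigma>" "b \<in> \<sigma>" "a \<noteq> b"
  shows "(a, b) \<in> induced_edges (ori \<sigma>) \<or> (b, a) \<in> induced_edges (ori \<sigma>)"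
proof -
  obtain t where t: "t \<in> ori \<sigma>" using ori_nonempty assms(1) by blast
  show ?thesis using assms(2-4) induced_edgesI[OF t] unfolding ori_vertices(1)[OF assms(1) t] by auto
qed

text \<open>A cyclic rotation, which preserves the area, brings an induced edge to the first two
  positions.\<close>

lemma induced_edge_area:
  assumes pos: "positively_oriented \<Delta> ori Q" and \<sigma>: "\<sigma> \<in> faces 2 \<Delta>"
    and ab: "(a, b) \<in> induced_edges (ori \<sigma>)"
  obtains c where "\<sigma> = {a, b, c}" "area2 (column a Q) (column b Q) (column c Q) > 0"
proof -
  obtain t l where t: "t \<in> ori \<sigma>" and l: "a = t (l + 1)" "b = t (l + 2)"
    using ab unfolding induced_edges_def by blast
  have A: "area2 (column (t 0) Q) (column (t 1) Q) (column (t 2) Q) > 0"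
    using pos \<sigma> t unfolding positively_oriented_def by (force simp: signed_area_eq)
  have "l \<in> {0, 1, 2}" using UNIV_3_zero by blast
  then consider "l = 0" | "l = 1" | "l = 2" by blast
  then have "area2 (column a Q) (column b Q) (column (t l) Q) > 0 \<and> \<sigma> = {a, b, t l}"
  proof cases
    case 1
    then have *: "a = t 1" "b = t 2" "t l = t 0" using l by simp_all
    show ?thesis
      using A ori_vertices(1)[OF \<sigma> t] unfolding * area2_rotate[of "column (t 1) Q" "column (t 2) Q" "column (t 0) Q"]
      by blast
  next
    case 2
    then have *: "a = t 2" "b = t 0" "t l = t 1" using l by (simp_all add: mod_3)
    have "area2 (column (t 2) Q) (column (t 0) Q) (column (t 1) Q) > 0"
      using A area2_rotate[of "column (t 2) Q" "column (t 0) Q" "column (t 1) Q"]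
        area2_rotate[of "column (t 1) Q" "column (t 2) Q" "column (t 0) Q"] by linarith
    then show ?thesis using ori_vertices(1)[OF \<sigma> t] unfolding * by blast
  next
    case 3
    then have *: "a = t 0" "b = t 1" "t l = t 2" using l by (simp_all add: mod_3)
    show ?thesis using A ori_vertices(1)[OF \<sigma> t] unfolding * by blast
  qed
  then show ?thesis using that by blast
qed

lemma separated_self:
  assumes pos: "positively_oriented \<Delta> ori Q" and "\<sigma> \<in> \<Delta>"
  shows "separated Q \<sigma> \<sigma>"
proof -
  obtain \<tau> where \<tau>: "\<tau> \<in> faces 2 \<Delta>" "\<sigma> \<subseteq> \<tau>" using face_in_2_face[OF assms(2)] .
  obtain t where t: "t \<in> ori \<tau>" using ori_nonempty \<tau>(1) by blast
  have "signed_area Q t > 0" using pos \<tau>(1) t by (simp add: positively_oriented_def)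
  then have "separated Q \<tau> \<tau>"
    unfolding ori_vertices(1)[OF \<tau>(1) t] by (intro separated_triangle) (simp add: signed_area_eq)
  then show ?thesis using separated_mono \<tau>(2) by blast
qed

text \<open>From left to right, the intersection of two cells is a face of both, say the cell of
  \<open>\<sigma>' \<subseteq> \<sigma>\<close> and of \<open>\<tau>' \<subseteq> \<tau>\<close>. Then it is also the cell of \<open>\<sigma>' \<union> \<tau>'\<close>, which is a face because \<open>\<Delta>\<close>
  is the associated complex; its affine independence forces \<open>\<sigma>' = \<tau>'\<close>, a face of \<open>\<sigma> \<inter> \<tau>\<close>. From
  right to left, separation passes from 2-faces to all faces by purity; a set of vertices with
  the same cell as \<open>\<tau> \<in> \<Delta>\<close> is contained in \<open>\<tau>\<close>, since a vertex in a cell belongs to the face.\<close>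

lemma M_plus_iff:
  "Q \<in> M_plus \<Delta> ori \<longleftrightarrow>
     positively_oriented \<Delta> ori Q \<and> (\<forall>\<sigma>\<in>faces 2 \<Delta>. \<forall>\<tau>\<in>faces 2 \<Delta>. separated Q \<sigma> \<tau>)"
proof
  assume Q: "Q \<in> M_plus \<Delta> ori"
  then have pos: "positively_oriented \<Delta> ori Q" by (simp add: M_plus_def positively_oriented_def)
  have geo: "geometric_simplicial_complex (realization \<Delta> Q)" and ass: "associated_complex \<Delta> Q = \<Delta>"
    using Q by (auto simp: M_plus_def M_zero_def)
  have "separated Q \<sigma> \<tau>" if "\<sigma> \<in> faces 2 \<Delta>" "\<tau> \<in> faces 2 \<Delta>" for \<sigma> \<tau>
  proof -
    have \<sigma>\<tau>: "\<sigma> \<in> \<Delta>" "\<tau> \<in> \<Delta>" using that by (auto simp: faces_def)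
    have "cell Q \<sigma> \<inter> cell Q \<tau> \<subseteq> cell Q (\<sigma> \<inter> \<tau>)"
    proof (cases "cell Q \<sigma> \<inter> cell Q \<tau> = {}")
      case False
      let ?F = "cell Q \<sigma> \<inter> cell Q \<tau>"
      have "cell Q \<sigma> \<in> realization \<Delta> Q" "cell Q \<tau> \<in> realization \<Delta> Q"
        using \<sigma>\<tau> by (auto simp: realization_def)
      then have "?F face_of cell Q \<sigma>" "?F face_of cell Q \<tau>"
        using geo False unfolding geometric_simplicial_complex_def by blast+
      then have "\<exists>c\<subseteq>(\<lambda>i. column i Q) ` \<sigma>. ?F = convex hull c" "\<exists>d\<subseteq>(\<lambda>i. column i Q) ` \<tau>. ?F = convex hull d"
        unfolding face_of_convex_hull_affine_independent[OF separated_self_affine_independent[OF separated_self[OF pos \<sigma>\<tau>(1)]]]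
          face_of_convex_hull_affine_independent[OF separated_self_affine_independent[OF separated_self[OF pos \<sigma>\<tau>(2)]]]
        by blast+
      then obtain c d where c: "c \<subseteq> (\<lambda>i. column i Q) ` \<sigma>" "?F = convex hull c"
        and d: "d \<subseteq> (\<lambda>i. column i Q) ` \<tau>" "?F = convex hull d"
        by (elim exE conjE)
      obtain \<sigma>' \<tau>' where *: "\<sigma>' \<subseteq> \<sigma>" "\<tau>' \<subseteq> \<tau>"
        and "c = (\<lambda>i. column i Q) ` \<sigma>'" "d = (\<lambda>i. column i Q) ` \<tau>'"
        using c(1) d(1) unfolding subset_image_iff by blast
      then have F: "?F = cell Q \<sigma>'" "?F = cell Q \<tau>'" using c(2) d(2) by simp_all
      \<comment> \<open>the union has the same cell and is therefore a face\<close>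
      let ?\<rho> = "\<sigma>' \<union> \<tau>'"
      have "(\<lambda>i. column i Q) ` ?\<rho> \<subseteq> ?F"
        using hull_subset[of "(\<lambda>i. column i Q) ` \<sigma>'" convex] hull_subset[of "(\<lambda>i. column i Q) ` \<tau>'" convex] F
        by blast
      then have "cell Q ?\<rho> \<subseteq> ?F"
        by (intro hull_minimal convex_Int convex_convex_hull)
      moreover have "?F \<subseteq> cell Q ?\<rho>" using F(1) cell_mono[of \<sigma>' ?\<rho> Q] by blast
      ultimately have F\<rho>: "cell Q ?\<rho> = ?F" by blast
      have "\<sigma>' \<noteq> {}" using F(1) False by auto
      then have "\<sigma>' \<in> \<Delta>" using face_subset \<sigma>\<tau>(1) *(1) by blast
      then have "cell Q ?\<rho> \<in> realization \<Delta> Q" unfolding F\<rho> F(1) by (auto simp: realization_def)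
      then have "?\<rho> \<in> \<Delta>" using ass unfolding associated_complex_def by blast
      then have sep: "separated Q ?\<rho> ?\<rho>" using separated_self pos by blast
      have sub: "?\<rho> \<subseteq> \<alpha>" if \<alpha>: "\<alpha> \<subseteq> ?\<rho>" "cell Q \<alpha> = ?F" for \<alpha>
      proof
        fix i assume i: "i \<in> ?\<rho>"
        then have "column i Q \<in> cell Q ?\<rho>" by (intro hull_inc) blast
        then have "column i Q \<in> cell Q \<alpha>" by (simp only: F\<rho> \<alpha>(2))
        then obtain w where w: "w \<in> weights \<alpha>" "column i Q = Q *v w"
          unfolding cell_eq_weights by blast
        then have "w \<in> weights ?\<rho>" "Q *v axis i 1 = Q *v w"
          using weights_mono[OF \<alpha>(1)] by (auto simp: matrix_vector_mult_basis)
        then have "axis i 1 = w"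
          by (rule separated_weights_eq[OF sep axis_in_weights[OF i]])
        then show "i \<in> \<alpha>" using w(1) by (auto simp: weights_def axis_def split: if_splits)
      qed
      have "\<sigma>' = \<tau>'" using sub[of \<sigma>'] sub[of \<tau>'] F by blast
      then show ?thesis using F(1) * cell_mono[of \<sigma>' "\<sigma> \<inter> \<tau>" Q] by simp
    qed simp
    then show ?thesis using separated_if_cell_Int separated_self[OF pos] \<sigma>\<tau> by blast
  qed
  with pos show "positively_oriented \<Delta> ori Q \<and> (\<forall>\<sigma>\<in>faces 2 \<Delta>. \<forall>\<tau>\<in>faces 2 \<Delta>. separated Q \<sigma> \<tau>)" by blast
next
  assume *: "positively_oriented \<Delta> ori Q \<and> (\<forall>\<sigma>\<in>faces 2 \<Delta>. \<forall>\<tau>\<in>faces 2 \<Delta>. separated Q \<sigma> \<tau>)"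
  then have pos: "positively_oriented \<Delta> ori Q" by blast
  have sep: "separated Q \<sigma> \<tau>" if "\<sigma> \<in> \<Delta>" "\<tau> \<in> \<Delta>" for \<sigma> \<tau>
  proof -
    obtain \<sigma>' where "\<sigma>' \<in> faces 2 \<Delta>" "\<sigma> \<subseteq> \<sigma>'" using face_in_2_face[OF \<open>\<sigma> \<in> \<Delta>\<close>] .
    moreover obtain \<tau>' where "\<tau>' \<in> faces 2 \<Delta>" "\<tau> \<subseteq> \<tau>'" using face_in_2_face[OF \<open>\<tau> \<in> \<Delta>\<close>] .
    ultimately show ?thesis using * separated_mono[of Q \<sigma>' \<tau>' \<sigma> \<tau>] by blast
  qed
  have ind: "\<not> affine_dependent ((\<lambda>i. column i Q) ` \<sigma>)" if "\<sigma> \<in> \<Delta>" for \<sigma>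
    using separated_self_affine_independent sep[OF that that] .
  have sub_face: "cell Q \<rho> face_of cell Q \<sigma>" if "\<sigma> \<in> \<Delta>" "\<rho> \<subseteq> \<sigma>" for \<rho> \<sigma>
    unfolding face_of_convex_hull_affine_independent[OF ind[OF that(1)]]
    by (rule exI[of _ "(\<lambda>i. column i Q) ` \<rho>"]) (use image_mono[OF that(2)] in simp)
  have "geometric_simplicial_complex (realization \<Delta> Q)"
    unfolding geometric_simplicial_complex_def
  proof (intro conjI ballI allI impI)
    show "realization \<Delta> Q \<noteq> {}" using nonempty by (auto simp: realization_def)
    have "realization \<Delta> Q = cell Q ` \<Delta>" by (auto simp: realization_def)
    then show "finite (realization \<Delta> Q)" by simp
    fix S assume "S \<in> realization \<Delta> Q"
    then obtain \<sigma> where \<sigma>: "\<sigma> \<in> \<Delta>" "S = cell Q \<sigma>" by (auto simp: realization_def)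
    have "card \<sigma> \<noteq> 0" using \<sigma>(1) empty_notin by auto
    then show "\<exists>n\<ge>0. n simplex S"
      unfolding simplex_def \<sigma>(2) using ind[OF \<sigma>(1)] card_image[OF separated_self_inj_on[OF sep[OF \<sigma>(1) \<sigma>(1)]]]
      by (intro exI[of _ "int (card \<sigma>) - 1"]) force
    show "F \<in> realization \<Delta> Q" if Fc: "F face_of S \<and> F \<noteq> {}" for F
    proof -
      have "\<exists>c\<subseteq>(\<lambda>i. column i Q) ` \<sigma>. F = convex hull c"
        using Fc unfolding \<sigma>(2) face_of_convex_hull_affine_independent[OF ind[OF \<sigma>(1)]] by (rule conjunct1)
      then obtain c where "c \<subseteq> (\<lambda>i. column i Q) ` \<sigma>" "F = convex hull c" by (elim exE conjE)
      then obtain \<sigma>' where "\<sigma>' \<subseteq> \<sigma>" "F = cell Q \<sigma>'" unfolding subset_image_iff by blast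
      moreover from this have "\<sigma>' \<noteq> {}" using Fc by auto
      ultimately show ?thesis using face_subset[OF \<sigma>(1)] by (auto simp: realization_def)
    qed
    fix S' assume "S' \<in> realization \<Delta> Q" and ne: "S \<inter> S' \<noteq> {}"
    then obtain \<tau> where \<tau>: "\<tau> \<in> \<Delta>" "S' = cell Q \<tau>" by (auto simp: realization_def)
    have "S \<inter> S' = cell Q (\<sigma> \<inter> \<tau>)"
      unfolding \<sigma>(2) \<tau>(2) by (rule separated_cell_Int[OF sep[OF \<sigma>(1) \<tau>(1)]])
    then show "(S \<inter> S') face_of S" "(S \<inter> S') face_of S'"
      using sub_face[OF \<sigma>(1), of "\<sigma> \<inter> \<tau>"] sub_face[OF \<tau>(1), of "\<sigma> \<inter> \<tau>"] \<sigma>(2) \<tau>(2) by auto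
  qed
  moreover have "associated_complex \<Delta> Q = \<Delta>"
  proof
    show "\<Delta> \<subseteq> associated_complex \<Delta> Q" by (auto simp: associated_complex_def realization_def)
    show "associated_complex \<Delta> Q \<subseteq> \<Delta>"
    proof
      fix \<rho> assume "\<rho> \<in> associated_complex \<Delta> Q"
      then obtain \<tau> where \<tau>: "\<tau> \<in> \<Delta>" "cell Q \<rho> = cell Q \<tau>"
        by (auto simp: associated_complex_def realization_def)
      have "\<rho> \<subseteq> \<tau>"
      proof
        fix i assume "i \<in> \<rho>"
        then have "column i Q \<in> cell Q \<tau>" unfolding \<tau>(2)[symmetric] by (intro hull_inc) blast
        have "i \<in> \<Union>\<Delta>" by (simp add: vertices)
        then obtain \<sigma> where "\<sigma> \<in> \<Delta>" "i \<in> \<sigma>" by (rule UnionE)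
        then have "{i} \<in> \<Delta>" by (intro face_subset[of \<sigma> "{i}"]) simp_all
        then have "cell Q {i} \<inter> cell Q \<tau> = cell Q ({i} \<inter> \<tau>)"
          by (intro separated_cell_Int sep \<tau>(1))
        moreover have "column i Q \<in> cell Q {i} \<inter> cell Q \<tau>" using \<open>column i Q \<in> cell Q \<tau>\<close> by simp
        ultimately show "i \<in> \<tau>" by (cases "i \<in> \<tau>") auto
      qed
      moreover have "\<tau> \<noteq> {}" using \<tau>(1) empty_notin by blast
      then have "cell Q \<tau> \<noteq> {}" by simp
      then have "\<rho> \<noteq> {}" using \<tau>(2) by (metis convex_hull_empty image_empty)
      ultimately show "\<rho> \<in> \<Delta>" using face_subset[OF \<tau>(1)] by blast
    qed
  qed
  ultimately show "Q \<in> M_plus \<Delta> ori"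
    using pos by (simp add: M_plus_def M_zero_def positively_oriented_def)
qed

end

section \<open>Separation is an open condition and weak separation a closed one\<close>

text \<open>A line separates the vertices of \<open>\<sigma>\<close> from those of \<open>\<tau>\<close>, both of which may touch it.\<close>

definition weakly_separated :: "real^'n^2 \<Rightarrow> 'n set \<Rightarrow> 'n set \<Rightarrow> bool" where
  "weakly_separated Q \<sigma> \<tau> \<longleftrightarrow>
     (\<exists>a. norm a = 1 \<and> (\<forall>i\<in>\<sigma>. \<forall>j\<in>\<tau>. a \<bullet> column i Q \<le> a \<bullet> column j Q))"

text \<open>The unit normals of separating lines range over a compact set, and projections along
  compact sets are closed.\<close>

lemma closed_weakly_separated:
  fixes \<sigma> \<tau> :: "'n::finite set"
  shows "closed {Q :: real^'n^2. weakly_separated Q \<sigma> \<tau>}"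
proof -
  let ?T = "{p :: (real^2) \<times> (real^'n^2). \<forall>i\<in>\<sigma>. \<forall>j\<in>\<tau>. fst p \<bullet> column i (snd p) \<le> fst p \<bullet> column j (snd p)}"
  have "?T = (\<Inter>i\<in>\<sigma>. \<Inter>j\<in>\<tau>. {p. fst p \<bullet> column i (snd p) \<le> fst p \<bullet> column j (snd p)})" by blast
  also have "closed \<dots>" by (intro closed_INT ballI closed_Collect_le continuous_intros)
  finally have "closed {Q. \<exists>a. a \<in> sphere 0 1 \<and> (a, Q) \<in> ?T}"
    by (intro closed_compact_projection compact_sphere)
  then show ?thesis by (simp add: weakly_separated_def)
qed

text \<open>By homogeneity it suffices to exclude relations of norm 1, which range over a compact
  set.\<close>

lemma open_separated:
  fixes \<sigma> \<tau> :: "'n::finite set"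
  shows "open {Q :: real^'n^2. separated Q \<sigma> \<tau>}"
proof -
  let ?C = "{w :: real^'n. (\<Sum>i\<in>UNIV. w $ i) = 0} \<inter> (\<Inter>i\<in>- \<tau>. {w. 0 \<le> w $ i}) \<inter> (\<Inter>i\<in>- \<sigma>. {w. w $ i \<le> 0})"
  let ?T = "{p :: (real^'n) \<times> (real^'n^2). snd p *v fst p = 0}"
  have "closed ?C"
    by (intro closed_Int closed_INT ballI closed_Collect_le closed_Collect_eq continuous_intros)
  then have "compact (sphere 0 1 \<inter> ?C)" by (intro compact_Int_closed compact_sphere)
  moreover have "closed ?T"
    unfolding mult_columns by (intro closed_Collect_eq continuous_intros)
  ultimately have "closed {Q. \<exists>w. w \<in> sphere 0 1 \<inter> ?C \<and> (w, Q) \<in> ?T}"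
    by (rule closed_compact_projection)
  moreover have "{Q. separated Q \<sigma> \<tau>} = - {Q. \<exists>w. w \<in> sphere 0 1 \<inter> ?C \<and> (w, Q) \<in> ?T}"
  proof (intro set_eqI iffI)
    fix Q :: "real^'n^2" assume "Q \<in> {Q. separated Q \<sigma> \<tau>}"
    then have sep: "separated Q \<sigma> \<tau>" by simp
    show "Q \<in> - {Q. \<exists>w. w \<in> sphere 0 1 \<inter> ?C \<and> (w, Q) \<in> ?T}"
    proof (rule ComplI)
      assume "Q \<in> {Q. \<exists>w. w \<in> sphere 0 1 \<inter> ?C \<and> (w, Q) \<in> ?T}"
      then obtain w where w: "norm w = 1" "w \<in> ?C" "Q *v w = 0" by auto
      then have "w = 0" by (intro sep[unfolded separated_def, rule_format]) simp
      then show False using w(1) by simp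
    qed
  next
    fix Q :: "real^'n^2" assume Q: "Q \<in> - {Q. \<exists>w. w \<in> sphere 0 1 \<inter> ?C \<and> (w, Q) \<in> ?T}"
    have "w = 0" if w: "Q *v w = 0" "(\<Sum>i\<in>UNIV. w $ i) = 0" "\<forall>i. i \<notin> \<tau> \<longrightarrow> 0 \<le> w $ i" "\<forall>i. i \<notin> \<sigma> \<longrightarrow> w $ i \<le> 0" for w
    proof (rule ccontr)
      assume "w \<noteq> 0"
      let ?v = "(1 / norm w) *\<^sub>R w"
      have sph: "?v \<in> sphere 0 1" using \<open>w \<noteq> 0\<close> by simp
      have inC: "?v \<in> ?C"
        using w(2-4) \<open>w \<noteq> 0\<close> by (simp add: sum_divide_distrib[symmetric] divide_nonpos_pos)
      have inT: "(?v, Q) \<in> ?T" using w(1) by (simp add: matrix_vector_mult_scaleR)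
      from conjI[OF IntI[OF sph inC] inT] have "\<exists>w. w \<in> sphere 0 1 \<inter> ?C \<and> (w, Q) \<in> ?T" by (rule exI)
      with Q show False by blast
    qed
    then show "Q \<in> {Q. separated Q \<sigma> \<tau>}" unfolding separated_def by blast
  qed
  ultimately show ?thesis by (simp add: open_Compl)
qed

text \<open>On an affinely independent cell, the weights of the points of its relative interior.\<close>

definition positive_weights :: "'n set \<Rightarrow> (real^'n::finite) set" where
  "positive_weights \<sigma> = {w\<in>weights \<sigma>. \<forall>i\<in>\<sigma>. w $ i > 0}"

lemma positive_weights_nonempty:
  assumes "\<sigma> \<noteq> {}"
  obtains w where "w \<in> positive_weights \<sigma>"
proof
  have "card \<sigma> > 0" using assms by (simp add: card_gt_0_iff)
  then show "(\<chi> i. if i \<in> \<sigma> then 1 / card \<sigma> else 0) \<in> positive_weights \<sigma>"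
    by (auto simp: positive_weights_def weights_def sum.If_cases)
qed

lemma positive_weights_mix:
  assumes "w \<in> weights \<sigma>" "c \<in> positive_weights \<sigma>" "0 < e" "e < (1::real)"
  shows "(1 - e) *\<^sub>R w + e *\<^sub>R c \<in> positive_weights \<sigma>"
proof -
  have "(1 - e) *\<^sub>R w + e *\<^sub>R c \<in> weights \<sigma>"
    using assms by (intro convexD[OF convex_weights]) (auto simp: positive_weights_def)
  moreover have "(1 - e) * w $ i + e * c $ i > 0" if "i \<in> \<sigma>" for i
    using assms that by (intro add_nonneg_pos mult_nonneg_nonneg mult_pos_pos) (auto simp: positive_weights_def weights_def)
  ultimately show ?thesis by (simp add: positive_weights_def)
qed

lemma inner_mult_columns: "a \<bullet> (Q *v w) = (\<Sum>i\<in>UNIV. w $ i * (a \<bullet> column i Q))"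
  for Q :: "real^'n^'m"
  by (simp add: mult_columns inner_sum_right)

lemma le_on_closure_of_positive_weights:
  assumes le: "\<And>w. w \<in> positive_weights \<sigma> \<Longrightarrow> a \<bullet> (Q *v w) \<le> b" and i: "i \<in> \<sigma>"
  shows "a \<bullet> column i Q \<le> b"
proof -
  obtain c where c: "c \<in> positive_weights \<sigma>" using positive_weights_nonempty i by blast
  let ?p = "a \<bullet> column i Q" and ?q = "a \<bullet> (Q *v c)"
  have "((\<lambda>e. (1 - e) * ?p + e * ?q) \<longlongrightarrow> (1 - 0) * ?p + 0 * ?q) (at_right (0::real))"
    by (intro tendsto_intros)
  moreover have "\<forall>\<^sub>F e in at_right (0::real). (1 - e) * ?p + e * ?q \<le> b"
  proof (rule eventually_at_rightI[of 0 1])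
    fix e :: real assume "e \<in> {0<..<1}"
    then have "a \<bullet> (Q *v ((1 - e) *\<^sub>R axis i 1 + e *\<^sub>R c)) \<le> b"
      using le positive_weights_mix[OF axis_in_weights[OF i] c] by simp
    then show "(1 - e) * ?p + e * ?q \<le> b"
      by (simp add: matrix_vector_right_distrib matrix_vector_mult_scaleR matrix_vector_mult_basis inner_add_right)
  qed simp
  ultimately show ?thesis using tendsto_upperbound[of _ "(1 - 0) * ?p + 0 * ?q" "at_right (0::real)" b] by simp
qed

text \<open>A common point of the relative interiors would have coordinates positive on \<open>\<sigma>\<close> and
  coordinates vanishing off \<open>\<tau>\<close>; by separation they agree, contradicting \<open>i \<in> \<sigma> - \<tau>\<close>. So the
  relative interiors are disjoint convex sets and a line separates them, and the cells by
  closure.\<close>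

lemma separated_imp_weakly_separated:
  fixes Q :: "real^'n::finite^2"
  assumes sep: "separated Q \<sigma> \<tau>" and i: "i \<in> \<sigma>" "i \<notin> \<tau>" and "\<tau> \<noteq> {}"
  shows "weakly_separated Q \<sigma> \<tau>"
proof -
  let ?C = "\<lambda>\<sigma>. (\<lambda>w. Q *v w) ` positive_weights \<sigma>"
  have convex: "convex (?C \<sigma>)" for \<sigma>
  proof -
    have "convex (positive_weights \<sigma>)"
    proof (rule convexI)
      fix x y :: "real^'n" and u v :: real
      assume xy: "x \<in> positive_weights \<sigma>" "y \<in> positive_weights \<sigma>" and uv: "0 \<le> u" "0 \<le> v" "u + v = 1"
      show "u *\<^sub>R x + v *\<^sub>R y \<in> positive_weights \<sigma>"
      proof (cases "0 < v \<and> v < 1")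
        case True
        then show ?thesis using positive_weights_mix[of x \<sigma> y v] xy uv
          by (simp add: positive_weights_def eq_diff_eq[symmetric])
      next
        case False
        then have "u = 1 \<and> v = 0 \<or> u = 0 \<and> v = 1" using uv by linarith
        then show ?thesis using xy by auto
      qed
    qed
    then show ?thesis by (intro convex_linear_image matrix_vector_mul_linear)
  qed
  have ne: "?C \<sigma> \<noteq> {}" "?C \<tau> \<noteq> {}"
    using positive_weights_nonempty[of \<sigma>] positive_weights_nonempty[of \<tau>] i \<open>\<tau> \<noteq> {}\<close> by auto
  have "?C \<sigma> \<inter> ?C \<tau> = {}"
  proof (rule ccontr)
    assume "?C \<sigma> \<inter> ?C \<tau> \<noteq> {}"
    then obtain w w' where w: "w \<in> positive_weights \<sigma>" "w' \<in> positive_weights \<tau>" "Q *v w = Q *v w'" by auto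
    then have "w = w'" by (intro separated_weights_eq[OF sep]) (auto simp: positive_weights_def)
    then show False using w(1,2) i by (auto simp: positive_weights_def weights_def)
  qed
  then obtain a b where ab: "a \<noteq> 0" "\<forall>x\<in>?C \<sigma>. a \<bullet> x \<le> b" "\<forall>x\<in>?C \<tau>. a \<bullet> x \<ge> b"
    using separating_hyperplane_sets[OF convex[of \<sigma>] convex[of \<tau>] ne] by blast
  have 1: "a \<bullet> column i Q \<le> b" if "i \<in> \<sigma>" for i
    by (rule le_on_closure_of_positive_weights[OF _ that]) (use ab(2) in auto)
  have 2: "- a \<bullet> column j Q \<le> - b" if "j \<in> \<tau>" for j
    by (rule le_on_closure_of_positive_weights[OF _ that]) (use ab(3) in auto)
  have "a \<bullet> column i Q \<le> a \<bullet> column j Q" if "i \<in> \<sigma>" "j \<in> \<tau>" for i j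
    using 1[OF that(1)] 2[OF that(2)] by simp
  then have "norm (a /\<^sub>R norm a) = 1 \<and> (\<forall>i\<in>\<sigma>. \<forall>j\<in>\<tau>. (a /\<^sub>R norm a) \<bullet> column i Q \<le> (a /\<^sub>R norm a) \<bullet> column j Q)"
    using ab(1) by (simp add: divide_right_mono mult_left_mono)
  then show ?thesis unfolding weakly_separated_def by blast
qed

section \<open>Weighted means and points on a line\<close>

lemma weighted_mean_eq:
  fixes f :: "'n::finite \<Rightarrow> real"
  assumes w: "w \<in> weights \<sigma>" and le: "\<And>i. i \<in> support w \<Longrightarrow> f i \<le> c" and eq: "(\<Sum>i\<in>UNIV. w $ i * f i) = c"
    and i: "i \<in> support w"
  shows "f i = c"
proof -
  have "w $ j * (c - f j) \<ge> 0" for j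
  proof (cases "j \<in> support w")
    case True
    then show ?thesis using le[of j] by (auto simp: support_def intro!: mult_nonneg_nonneg)
  next
    case False
    then have "w $ j = 0" using w by (auto simp: support_def weights_def order.order_iff_strict)
    then show ?thesis by simp
  qed
  moreover have "(\<Sum>j\<in>UNIV. w $ j * (c - f j)) = 0"
    using w eq by (simp add: right_diff_distrib sum_subtractf sum_distrib_right[symmetric] weights_def)
  ultimately have "w $ i * (c - f i) = 0" by (simp add: sum_nonneg_eq_0_iff)
  then show ?thesis using i by (simp add: support_def)
qed

lemma weighted_mean_le:
  fixes f :: "'n::finite \<Rightarrow> real"
  assumes w: "w \<in> weights \<sigma>" and le: "\<And>i. i \<in> \<sigma> \<Longrightarrow> f i \<le> c"
  shows "(\<Sum>i\<in>UNIV. w $ i * f i) \<le> c"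
proof -
  have "w $ i * f i \<le> w $ i * c" for i
    using w le[of i] by (cases "i \<in> \<sigma>") (auto simp: weights_def intro!: mult_left_mono)
  then have "(\<Sum>i\<in>UNIV. w $ i * f i) \<le> (\<Sum>i\<in>UNIV. w $ i * c)" by (intro sum_mono)
  also have "\<dots> = c" using w by (simp add: sum_distrib_right[symmetric] weights_def)
  finally show ?thesis .
qed

lemma area2_collinear:
  assumes "a \<noteq> 0" "a \<bullet> p = c" "a \<bullet> q = c" "a \<bullet> r = c"
  shows "area2 p q r = 0"
proof -
  have a: "a $ 1 * p $ 1 + a $ 2 * p $ 2 = c" "a $ 1 * q $ 1 + a $ 2 * q $ 2 = c" "a $ 1 * r $ 1 + a $ 2 * r $ 2 = c"
    using assms(2-4) by (simp_all add: inner_vec_def sum_2)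
  have "a $ 1 * area2 p q r = (a $ 1 * (q $ 1 - p $ 1) + a $ 2 * (q $ 2 - p $ 2)) * (r $ 2 - p $ 2)
      - (a $ 1 * (r $ 1 - p $ 1) + a $ 2 * (r $ 2 - p $ 2)) * (q $ 2 - p $ 2)"
    by (simp add: area2_def algebra_simps)
  also have "\<dots> = 0" using a by (simp add: algebra_simps)
  finally have 1: "a $ 1 * area2 p q r = 0" .
  have "a $ 2 * area2 p q r = (a $ 1 * (r $ 1 - p $ 1) + a $ 2 * (r $ 2 - p $ 2)) * (q $ 1 - p $ 1)
      - (a $ 1 * (q $ 1 - p $ 1) + a $ 2 * (q $ 2 - p $ 2)) * (r $ 1 - p $ 1)"
    by (simp add: area2_def algebra_simps)
  also have "\<dots> = 0" using a by (simp add: algebra_simps)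
  finally have "a $ 2 * area2 p q r = 0" .
  moreover have "a $ 1 \<noteq> 0 \<or> a $ 2 \<noteq> 0" using assms(1) by (auto simp: vec_eq_iff forall_2)
  ultimately show ?thesis using 1 by auto
qed

lemma zero_if_orthogonal:
  fixes a d :: "real^2"
  assumes "a \<noteq> 0" "a \<bullet> d = 0" "perp a \<bullet> d = 0"
  shows "d = 0"
proof -
  have e: "a $ 1 * d $ 1 + a $ 2 * d $ 2 = 0" "- a $ 2 * d $ 1 + a $ 1 * d $ 2 = 0"
    using assms(2,3) by (simp_all add: inner_vec_def sum_2 perp_def)
  have n: "(a $ 1)\<^sup>2 + (a $ 2)\<^sup>2 \<noteq> 0"
    using assms(1) by (auto simp: vec_eq_iff forall_2 sum_power2_eq_zero_iff)
  have "((a $ 1)\<^sup>2 + (a $ 2)\<^sup>2) * d $ 1 = a $ 1 * (a $ 1 * d $ 1 + a $ 2 * d $ 2) - a $ 2 * (- a $ 2 * d $ 1 + a $ 1 * d $ 2)"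
    "((a $ 1)\<^sup>2 + (a $ 2)\<^sup>2) * d $ 2 = a $ 2 * (a $ 1 * d $ 1 + a $ 2 * d $ 2) + a $ 1 * (- a $ 2 * d $ 1 + a $ 1 * d $ 2)"
    by (simp_all add: power2_eq_square algebra_simps)
  then have "d $ 1 = 0" "d $ 2 = 0" unfolding e using n by (simp_all only: mult_zero_right diff_0_right add_0_right mult_eq_0_iff) blast+
  then show ?thesis by (simp add: vec_eq_iff forall_2)
qed

text \<open>On the line with normal \<open>a\<close>, the inner product with \<open>perp a\<close> is a coordinate.\<close>

lemma line_coordinate_in_segment:
  fixes a :: "real^2"
  assumes a: "a \<noteq> 0" "a \<bullet> p = c" "a \<bullet> q = c" "a \<bullet> z = c"
    and t: "perp a \<bullet> p < perp a \<bullet> q" "perp a \<bullet> p \<le> perp a \<bullet> z" "perp a \<bullet> z \<le> perp a \<bullet> q"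
  shows "z \<in> convex hull {p, q}"
proof -
  let ?t = "\<lambda>x. perp a \<bullet> x"
  define u where "u = (?t z - ?t p) / (?t q - ?t p)"
  have u: "0 \<le> u" "u \<le> 1" using t by (auto simp: u_def divide_simps)
  define d where "d = z - ((1 - u) *\<^sub>R p + u *\<^sub>R q)"
  have "a \<bullet> d = 0" using a by (simp add: d_def inner_diff_right inner_add_right algebra_simps)
  moreover have "?t d = 0"
  proof -
    have "u * (?t q - ?t p) = ?t z - ?t p" using t by (simp add: u_def)
    then show ?thesis by (simp add: d_def inner_diff_right inner_add_right algebra_simps)
  qed
  ultimately have "d = 0" using zero_if_orthogonal[OF a(1)] by blast
  then have "z = (1 - u) *\<^sub>R p + u *\<^sub>R q" by (simp add: d_def)
  then show ?thesis unfolding convex_hull_2 using u by force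
qed

section \<open>Stars of faces off the boundary\<close>

lemma weights_3:
  assumes "w \<in> weights {a, b, c}" "a \<noteq> b" "b \<noteq> c" "a \<noteq> c"
  shows "Q *v w = w $ a *\<^sub>R column a Q + w $ b *\<^sub>R column b Q + w $ c *\<^sub>R column c Q"
    and "w $ a + w $ b + w $ c = 1"
proof -
  have off: "\<And>i. i \<notin> {a, b, c} \<Longrightarrow> w $ i = 0" using assms(1) by (simp add: weights_def)
  show "Q *v w = w $ a *\<^sub>R column a Q + w $ b *\<^sub>R column b Q + w $ c *\<^sub>R column c Q"
    using mult_columns_on[of "{a, b, c}" w Q] off assms(2-4) by (simp add: add_ac)
  show "w $ a + w $ b + w $ c = 1"
    using sum_weights_on[of "{a, b, c}" w] off assms by (simp add: add_ac weights_def)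
qed

context oriented_complex
begin

lemma M_plus_open: "open (M_plus \<Delta> ori)"
proof -
  have "M_plus \<Delta> ori = (\<Inter>\<sigma>\<in>faces 2 \<Delta>. \<Inter>t\<in>ori \<sigma>. {Q. 0 < signed_area Q t})
      \<inter> (\<Inter>\<sigma>\<in>faces 2 \<Delta>. \<Inter>\<tau>\<in>faces 2 \<Delta>. {Q. separated Q \<sigma> \<tau>})"
    by (rule set_eqI) (simp only: M_plus_iff positively_oriented_def Int_iff INT_iff mem_Collect_eq)
  moreover have "open {Q :: real^'n^2. 0 < signed_area Q t}" for t
    unfolding signed_area_eq
    by (rule open_Collect_less[OF continuous_on_const]) (intro continuous_on_divide continuous_intros; simp)
  then have "open (\<Inter>\<sigma>\<in>faces 2 \<Delta>. \<Inter>t\<in>ori \<sigma>. {Q :: real^'n^2. 0 < signed_area Q t})"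
    by (intro open_INT ballI finite)
  moreover have "open (\<Inter>\<sigma>\<in>faces 2 \<Delta>. \<Inter>\<tau>\<in>faces 2 \<Delta>. {Q :: real^'n^2. separated Q \<sigma> \<tau>})"
    by (intro open_INT ballI finite open_separated)
  ultimately show ?thesis by (simp only: open_Int)
qed

definition star :: "real^'n^2 \<Rightarrow> 'n set \<Rightarrow> (real^2) set" where
  "star Q \<rho> = (\<Union>\<sigma>\<in>{\<sigma>\<in>faces 2 \<Delta>. \<rho> \<subseteq> \<sigma>}. cell Q \<sigma>)"

lemma star_mono: "\<rho> \<subseteq> \<rho>' \<Longrightarrow> star Q \<rho>' \<subseteq> star Q \<rho>"
  unfolding star_def by blast

lemma interior_star_2_face:
  assumes pos: "positively_oriented \<Delta> ori Q" and \<rho>: "\<rho> \<in> faces 2 \<Delta>" and w: "w \<in> positive_weights \<rho>"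
  shows "Q *v w \<in> interior (star Q \<rho>)"
proof -
  obtain t where t: "t \<in> ori \<rho>" using ori_nonempty[OF \<rho>] by blast
  note v = ori_vertices[OF \<rho> t]
  let ?p = "column (t 0) Q" and ?q = "column (t 1) Q" and ?r = "column (t 2) Q"
  have A: "area2 ?p ?q ?r > 0" using pos \<rho> t by (force simp: positively_oriented_def signed_area_eq)
  have w': "w \<in> weights {t 0, t 1, t 2}" "w $ t 0 > 0" "w $ t 1 > 0" "w $ t 2 > 0"
    using w v(1) by (auto simp: positive_weights_def)
  note b = area2_barycentric[OF weights_3(2)[OF w'(1) v(2,3,4)] weights_3(1)[OF w'(1) v(2,3,4), of Q]]
  let ?V = "{y. 0 < area2 y ?q ?r} \<inter> {y. 0 < area2 ?p y ?r} \<inter> {y. 0 < area2 ?p ?q y}"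
  show ?thesis
  proof (rule interiorI)
    show "open ?V" by (intro open_Int open_Collect_less continuous_intros)
    show "Q *v w \<in> ?V" unfolding Int_iff mem_Collect_eq b using A w'(2-4) by simp
    have "?V \<subseteq> convex hull {?p, ?q, ?r}" using in_triangle_if_areas_nonneg[OF A] by auto
    also have "\<dots> = cell Q \<rho>" unfolding v(1) by simp
    also have "\<dots> \<subseteq> star Q \<rho>" using \<rho> unfolding star_def by blast
    finally show "?V \<subseteq> star Q \<rho>" .
  qed
qed

text \<open>Near a relatively interior point of the edge, the inequalities of the other two sides of
  the triangle are strict, so only the side of the edge matters.\<close>

lemma half_disc_in_2_face:
  assumes pos: "positively_oriented \<Delta> ori Q" and \<sigma>: "\<sigma> \<in> faces 2 \<Delta>"
    and ab: "(a, b) \<in> induced_edges (ori \<sigma>)" and w: "w \<in> positive_weights {a, b}" "a \<noteq> b"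
  shows "\<exists>V. open V \<and> Q *v w \<in> V \<and> (\<forall>y\<in>V. area2 (column a Q) (column b Q) y \<ge> 0 \<longrightarrow> y \<in> cell Q \<sigma>)"
proof -
  obtain c where c: "\<sigma> = {a, b, c}" and A: "area2 (column a Q) (column b Q) (column c Q) > 0"
    using induced_edge_area[OF pos \<sigma> ab] .
  let ?p = "column a Q" and ?q = "column b Q" and ?r = "column c Q"
  have d: "b \<noteq> c" "a \<noteq> c" using A by (auto simp: area2_def)
  have w': "w \<in> weights {a, b, c}" "w $ a > 0" "w $ b > 0"
    using w weights_mono[of "{a, b}" "{a, b, c}"] by (auto simp: positive_weights_def)
  note bc = area2_barycentric[OF weights_3(2)[OF w'(1) w(2) d] weights_3(1)[OF w'(1) w(2) d, of Q]]
  let ?V = "{y. 0 < area2 y ?q ?r} \<inter> {y. 0 < area2 ?p y ?r}"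
  have "open ?V" by (intro open_Int open_Collect_less continuous_intros)
  moreover have "Q *v w \<in> ?V" unfolding Int_iff mem_Collect_eq bc using A w'(2-3) by simp
  moreover have "\<forall>y\<in>?V. area2 ?p ?q y \<ge> 0 \<longrightarrow> y \<in> cell Q \<sigma>"
    using in_triangle_if_areas_nonneg[OF A] unfolding c by auto
  ultimately show ?thesis by blast
qed

text \<open>An interior edge belongs to two triangles. Being consistently and positively oriented,
  they lie on different sides of the edge and contain complementary half discs.\<close>

lemma interior_star_edge:
  assumes pos: "positively_oriented \<Delta> ori Q" and e: "{a, b} \<in> \<Delta>" "a \<noteq> b" "{a, b} \<notin> boundary_edges \<Delta>"
    and w: "w \<in> positive_weights {a, b}"
  shows "Q *v w \<in> interior (star Q {a, b})"
proof -
  have f1: "{a, b} \<in> faces 1 \<Delta>" using e(1,2) by (simp add: faces_def)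
  obtain \<sigma> where \<sigma>: "\<sigma> \<in> faces 2 \<Delta>" "{a, b} \<subseteq> \<sigma>" using face_in_2_face[OF e(1)] .
  have "\<exists>\<sigma>'\<in>faces 2 \<Delta>. {a, b} \<subseteq> \<sigma>' \<and> \<sigma>' \<noteq> \<sigma>"
  proof (rule ccontr)
    assume *: "\<not> ?thesis"
    have "{\<sigma>\<in>faces 2 \<Delta>. {a, b} \<subseteq> \<sigma>} \<subseteq> {\<sigma>}"
    proof
      fix \<sigma>' assume "\<sigma>' \<in> {\<sigma>\<in>faces 2 \<Delta>. {a, b} \<subseteq> \<sigma>}"
      then have "\<sigma>' \<in> faces 2 \<Delta>" "{a, b} \<subseteq> \<sigma>'" by (simp_all only: mem_Collect_eq)
      with * have "\<not> \<sigma>' \<noteq> \<sigma>" by (meson bexI)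
      then show "\<sigma>' \<in> {\<sigma>}" by simp
    qed
    moreover have "\<sigma> \<in> {\<sigma>\<in>faces 2 \<Delta>. {a, b} \<subseteq> \<sigma>}" using \<sigma> by (intro CollectI conjI)
    ultimately have "{\<sigma>\<in>faces 2 \<Delta>. {a, b} \<subseteq> \<sigma>} = {\<sigma>}" by (intro subset_antisym) simp_all
    then have "card {\<sigma>\<in>faces 2 \<Delta>. {a, b} \<subseteq> \<sigma>} = 1" by simp
    then have "{a, b} \<in> boundary_edges \<Delta>" unfolding boundary_edges_def using f1 by (intro CollectI conjI)
    then show False using e(3) by (rule notE[rotated])
  qed
  then obtain \<sigma>' where \<sigma>': "\<sigma>' \<in> faces 2 \<Delta>" "{a, b} \<subseteq> \<sigma>'" "\<sigma>' \<noteq> \<sigma>" by (elim bexE conjE)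
  have cons: "(x, y) \<in> induced_edges (ori \<sigma>) \<longleftrightarrow> (y, x) \<in> induced_edges (ori \<sigma>')" if "{x, y} = {a, b}" for x y
  proof -
    have "\<forall>\<sigma>\<in>faces 2 \<Delta>. \<forall>\<sigma>'\<in>faces 2 \<Delta>. \<forall>a b. \<sigma> \<noteq> \<sigma>' \<and> {a, b} \<in> faces 1 \<Delta> \<and> {a, b} \<subseteq> \<sigma> \<inter> \<sigma>' \<longrightarrow>
        ((a, b) \<in> induced_edges (ori \<sigma>) \<longleftrightarrow> (b, a) \<in> induced_edges (ori \<sigma>'))"
      using oriented unfolding consistently_oriented_def by (rule conjunct2)
    then have "\<sigma> \<noteq> \<sigma>' \<and> {x, y} \<in> faces 1 \<Delta> \<and> {x, y} \<subseteq> \<sigma> \<inter> \<sigma>' \<longrightarrow>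
        ((x, y) \<in> induced_edges (ori \<sigma>) \<longleftrightarrow> (y, x) \<in> induced_edges (ori \<sigma>'))"
      using \<sigma>(1) \<sigma>'(1) by blast
    moreover have "\<sigma> \<noteq> \<sigma>' \<and> {x, y} \<in> faces 1 \<Delta> \<and> {x, y} \<subseteq> \<sigma> \<inter> \<sigma>'"
      unfolding that using f1 \<sigma>(2) \<sigma>'(2,3) by (intro conjI Int_greatest) simp_all
    ultimately show ?thesis by (rule mp)
  qed
  have main: "Q *v w \<in> interior (star Q {a, b})"
    if xy: "{x, y} = {a, b}" and i1: "(x, y) \<in> induced_edges (ori \<sigma>)" for x y
  proof -
    have i2: "(y, x) \<in> induced_edges (ori \<sigma>')" using cons[OF xy] i1 by blast
    have ne: "x \<noteq> y"
    proof
      assume "x = y"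
      then have "{a, b} = {x}" using xy by simp
      then have "a \<in> {x}" "b \<in> {x}" by blast+
      then show False using e(2) by simp
    qed
    have yx: "{y, x} = {a, b}" unfolding xy[symmetric] by (rule insert_commute)
    have wxy: "w \<in> positive_weights {x, y}" "w \<in> positive_weights {y, x}"
      unfolding xy yx using w by blast+
    obtain V where V: "open V" "Q *v w \<in> V" "\<forall>z\<in>V. area2 (column x Q) (column y Q) z \<ge> 0 \<longrightarrow> z \<in> cell Q \<sigma>"
      using half_disc_in_2_face[OF pos \<sigma>(1) i1 wxy(1) ne] by blast
    obtain V' where V': "open V'" "Q *v w \<in> V'" "\<forall>z\<in>V'. area2 (column y Q) (column x Q) z \<ge> 0 \<longrightarrow> z \<in> cell Q \<sigma>'"
      using half_disc_in_2_face[OF pos \<sigma>'(1) i2 wxy(2) ne[symmetric]] by blast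
    show ?thesis
    proof (rule interiorI)
      show "open (V \<inter> V')" "Q *v w \<in> V \<inter> V'" using V V' by auto
      show "V \<inter> V' \<subseteq> star Q {a, b}"
      proof
        fix z assume z: "z \<in> V \<inter> V'"
        have "area2 (column y Q) (column x Q) z = - area2 (column x Q) (column y Q) z" by (rule area2_swap)
        then have "z \<in> cell Q \<sigma> \<or> z \<in> cell Q \<sigma>'" using V(3) V'(3) z by (cases "area2 (column x Q) (column y Q) z \<ge> 0") auto
        then show "z \<in> star Q {a, b}" using \<sigma> \<sigma>' unfolding star_def by blast
      qed
    qed
  qed
  have "(a, b) \<in> induced_edges (ori \<sigma>) \<or> (b, a) \<in> induced_edges (ori \<sigma>)"
    using induced_edge_total[OF \<sigma>(1), of a b] \<sigma>(2) e(2) by simp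
  then show ?thesis using main[OF refl] main[OF insert_commute] by (elim disjE)
qed

lemma interior_star_if_card_ge_2:
  assumes pos: "positively_oriented \<Delta> ori Q" and \<rho>: "\<rho> \<in> \<Delta>" "card \<rho> \<ge> 2" "\<rho> \<notin> boundary_edges \<Delta>"
    and w: "w \<in> positive_weights \<rho>"
  shows "Q *v w \<in> interior (star Q \<rho>)"
proof (cases "card \<rho> = 2")
  case True
  then obtain a b where ab: "\<rho> = {a, b}" "a \<noteq> b" by (auto simp: card_2_iff)
  show ?thesis using interior_star_edge[OF pos, of a b w] \<rho> w ab by simp
next
  case False
  then have "\<rho> \<in> faces 2 \<Delta>" using \<rho> card_face[OF \<rho>(1)] by (simp add: faces_def)
  then show ?thesis using interior_star_2_face[OF pos _ w] by blast
qed

lemma support_positive_weights: "w \<in> weights \<sigma> \<Longrightarrow> w \<in> positive_weights (support w)"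
  using weights_support(1)[of w \<sigma>] by (auto simp: positive_weights_def support_def)

lemma boundary_edge_card: "e \<in> boundary_edges \<Delta> \<Longrightarrow> e \<in> \<Delta> \<and> card e = 2"
  by (simp add: boundary_edges_def faces_def)

text \<open>In a small punctured disc around an interior vertex, the star of the vertex is closed. It
  is also open: each of its points lies in the relative interior of a triangle or an edge at the
  vertex, the edge is not a boundary edge, and so the previous cases apply. Since the punctured
  disc is connected, it is contained in the star.\<close>

lemma interior_star_vertex:
  assumes pos: "positively_oriented \<Delta> ori Q" and v: "{v} \<in> \<Delta>" "\<And>e. e \<in> boundary_edges \<Delta> \<Longrightarrow> v \<notin> e"
  shows "column v Q \<in> interior (star Q {v})"
proof -
  let ?v = "column v Q"
  \<comment> \<open>\<open>Z\<close> is the union of the sides opposite to \<open>v\<close>; a disc that misses it sees only faces through \<open>v\<close>\<close>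
  define S where "S = {\<sigma>\<in>faces 2 \<Delta>. {v} \<subseteq> \<sigma>}"
  define Z where "Z = (\<Union>\<sigma>\<in>S. cell Q (\<sigma> - {v}))"
  have closed_cell: "closed (cell Q \<sigma>)" for \<sigma>
    by (intro compact_imp_closed finite_imp_compact_convex_hull) simp
  have "?v \<notin> Z"
  proof
    assume "?v \<in> Z"
    then obtain \<sigma> w where \<sigma>: "\<sigma> \<in> faces 2 \<Delta>" "v \<in> \<sigma>" and w: "w \<in> weights (\<sigma> - {v})" "?v = Q *v w"
      unfolding Z_def S_def cell_eq_weights by blast
    have eq: "Q *v axis v 1 = Q *v w" using w(2) by (simp add: matrix_vector_mult_basis)
    have w\<sigma>: "w \<in> weights \<sigma>" using w(1) weights_mono[of "\<sigma> - {v}" \<sigma>] by blast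
    have sep: "separated Q \<sigma> \<sigma>" using separated_self[OF pos] faces_2[OF \<sigma>(1)] by blast
    have "axis v 1 = w" by (rule separated_weights_eq[OF sep axis_in_weights[OF \<sigma>(2)] w\<sigma> eq])
    then have "w $ v = 1" by (auto simp: axis_def)
    then show False using w(1) by (simp add: weights_def)
  qed
  moreover have "closed Z" unfolding Z_def by (intro closed_UN ballI closed_cell) simp
  ultimately obtain r where r: "r > 0" "ball ?v r \<subseteq> - Z"
    using open_contains_ball[of "- Z"] by auto
  define X where "X = ball ?v r - {?v}"
  have conn: "connected X" unfolding X_def by (rule connected_punctured_ball) simp
  have star: "star Q {v} = (\<Union>\<sigma>\<in>S. cell Q \<sigma>)" by (simp add: star_def S_def)
  have closed_star: "closed (star Q {v})" unfolding star by (intro closed_UN ballI closed_cell) simp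
  have int: "y \<in> interior (star Q {v})" if y: "y \<in> X" "y \<in> star Q {v}" for y
  proof -
    obtain \<sigma> w where \<sigma>: "\<sigma> \<in> faces 2 \<Delta>" "v \<in> \<sigma>" and w: "w \<in> weights \<sigma>" "y = Q *v w"
      using y(2) unfolding star S_def cell_eq_weights by blast
    let ?\<rho> = "support w"
    have "v \<in> ?\<rho>"
    proof (rule ccontr)
      assume "v \<notin> ?\<rho>"
      then have "w \<in> weights (\<sigma> - {v})" using w(1) by (auto simp: weights_def support_def order.order_iff_strict)
      then have "y \<in> Z" using \<sigma> w(2) unfolding Z_def S_def cell_eq_weights by blast
      then show False using y(1) r(2) unfolding X_def by blast
    qed
    moreover have "?\<rho> \<noteq> {v}"
    proof
      assume "?\<rho> = {v}"
      then have "w \<in> weights {v}" using weights_support(1)[OF w(1)] by simp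
      then have "y \<in> cell Q {v}" using w(2) unfolding cell_eq_weights by blast
      then show False using y(1) by (simp add: X_def)
    qed
    ultimately have "{v} \<subset> ?\<rho>" by blast
    then have "card {v} < card ?\<rho>" by (intro psubset_card_mono) simp
    then have "card ?\<rho> \<ge> 2" by simp
    moreover have "?\<rho> \<in> \<Delta>"
      using face_subset[of \<sigma> ?\<rho>] weights_support(2,3)[OF w(1)] faces_2[OF \<sigma>(1)] by blast
    moreover have "?\<rho> \<notin> boundary_edges \<Delta>" using v(2) \<open>v \<in> ?\<rho>\<close> by blast
    ultimately have "Q *v w \<in> interior (star Q ?\<rho>)"
      using interior_star_if_card_ge_2[OF pos] support_positive_weights[OF w(1)] by blast
    moreover have "interior (star Q ?\<rho>) \<subseteq> interior (star Q {v})"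
      by (intro interior_mono star_mono) (use \<open>v \<in> ?\<rho>\<close> in blast)
    ultimately show ?thesis using w(2) by blast
  qed
  have ne: "interior (star Q {v}) \<inter> X \<noteq> {}"
  proof -
    obtain \<sigma> where \<sigma>: "\<sigma> \<in> faces 2 \<Delta>" "{v} \<subseteq> \<sigma>" using face_in_2_face[OF v(1)] .
    have "\<sigma> \<noteq> {v}" using faces_2[OF \<sigma>(1)] by auto
    then obtain b where b: "b \<in> \<sigma>" "b \<noteq> v" using \<sigma>(2) by blast
    let ?b = "column b Q"
    have sep: "separated Q \<sigma> \<sigma>" using separated_self[OF pos] faces_2[OF \<sigma>(1)] by blast
    have vb: "?b \<noteq> ?v"
      using inj_onD[OF separated_self_inj_on[OF sep], of b v] b \<sigma>(2) by auto
    define e where "e = min (1/2) (r / (2 * norm (?b - ?v)))"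
    have e: "0 < e" "e < 1" "e * norm (?b - ?v) < r"
    proof -
      have n: "norm (?b - ?v) > 0" using vb by simp
      show "0 < e" "e < 1" using n r(1) by (auto simp: e_def)
      have "e * norm (?b - ?v) \<le> r / (2 * norm (?b - ?v)) * norm (?b - ?v)"
        using n by (intro mult_right_mono) (auto simp: e_def)
      also have "\<dots> = r / 2" using n by simp
      finally show "e * norm (?b - ?v) < r" using r(1) by simp
    qed
    define y where "y = (1 - e) *\<^sub>R ?v + e *\<^sub>R ?b"
    have yv: "y - ?v = e *\<^sub>R (?b - ?v)" by (simp add: y_def algebra_simps)
    then have "norm (y - ?v) = e * norm (?b - ?v)" using e(1) by simp
    then have "dist ?v y < r" using e(3) by (simp add: dist_norm norm_minus_commute)
    moreover have "y \<noteq> ?v" using yv vb e(1) by auto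
    ultimately have "y \<in> X" by (simp add: X_def)
    moreover have "y \<in> cell Q \<sigma>"
      unfolding y_def using e(1,2) b(1) \<sigma>(2)
      by (intro convexD[OF convex_convex_hull] hull_inc) auto
    then have "y \<in> star Q {v}" using \<sigma> unfolding star_def by blast
    ultimately show ?thesis using int by blast
  qed
  have cover: "X \<subseteq> star Q {v}"
  proof (rule ccontr)
    assume "\<not> X \<subseteq> star Q {v}"
    then have "- star Q {v} \<inter> X \<noteq> {}" by blast
    moreover have "interior (star Q {v}) \<inter> - star Q {v} \<inter> X = {}" using interior_subset by blast
    moreover have "X \<subseteq> interior (star Q {v}) \<union> - star Q {v}" using int by blast
    ultimately show False
      using connectedD[OF conn open_interior open_Compl[OF closed_star]] ne by blast
  qed
  obtain \<sigma> where \<sigma>: "\<sigma> \<in> faces 2 \<Delta>" "{v} \<subseteq> \<sigma>" using face_in_2_face[OF v(1)] .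
  then have "?v \<in> cell Q \<sigma>" by (intro hull_inc) blast
  then have "?v \<in> star Q {v}" using \<sigma> unfolding star_def by blast
  then have "ball ?v r \<subseteq> star Q {v}" using cover unfolding X_def by blast
  then show ?thesis using r(1) by (intro interiorI[OF open_ball]) auto
qed

text \<open>The local picture at a point away from the boundary: the triangles around \<open>\<rho>\<close> leave no gap
  at a relatively interior point of \<open>\<rho>\<close>.\<close>

theorem interior_star:
  assumes pos: "positively_oriented \<Delta> ori Q" and \<rho>: "\<rho> \<in> \<Delta>" "\<And>e. e \<in> boundary_edges \<Delta> \<Longrightarrow> \<not> \<rho> \<subseteq> e"
    and w: "w \<in> positive_weights \<rho>"
  shows "Q *v w \<in> interior (star Q \<rho>)"
proof (cases "card \<rho> \<ge> 2")
  case True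
  then show ?thesis using interior_star_if_card_ge_2[OF pos \<rho>(1) _ _ w] \<rho>(2) by blast
next
  case False
  moreover have "card \<rho> \<noteq> 0" using \<rho>(1) empty_notin by auto
  ultimately have "card \<rho> = 1" by linarith
  then obtain v where v: "\<rho> = {v}" by (auto simp: card_1_singleton_iff)
  have "w \<in> weights {v}" using w v by (simp add: positive_weights_def)
  then have "Q *v w \<in> cell Q {v}" unfolding cell_eq_weights by blast
  then have "Q *v w = column v Q" by simp
  then show ?thesis using interior_star_vertex[OF pos, of v] \<rho> v by auto
qed

text \<open>A point of the interior of \<open>\<tau>\<close> in the cell of \<open>\<sigma>\<close> has minimal height over the separating
  line among the points of \<open>\<tau>\<close>; attained at a strictly positive mean of the vertices, the
  minimum is attained at all of them, and \<open>\<tau>\<close> would be degenerate.\<close>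

lemma weakly_separated_no_overlap:
  assumes pos: "positively_oriented \<Delta> ori Q" and ws: "weakly_separated Q \<sigma> \<tau>" and \<tau>: "\<tau> \<in> faces 2 \<Delta>"
    and y: "y \<in> cell Q \<sigma>" and v: "v \<in> positive_weights \<tau>" "y = Q *v v"
  shows False
proof -
  obtain a where a: "norm a = 1" "\<forall>i\<in>\<sigma>. \<forall>j\<in>\<tau>. a \<bullet> column i Q \<le> a \<bullet> column j Q"
    using ws unfolding weakly_separated_def by blast
  obtain w where w: "w \<in> weights \<sigma>" "y = Q *v w" using y unfolding cell_eq_weights by blast
  define c where "c = a \<bullet> y"
  have le: "c \<le> a \<bullet> column j Q" if "j \<in> \<tau>" for j
  proof -
    have "(\<Sum>i\<in>UNIV. w $ i * (a \<bullet> column i Q)) \<le> a \<bullet> column j Q"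
      by (rule weighted_mean_le[OF w(1)]) (use a(2) that in blast)
    then show ?thesis unfolding c_def w(2) inner_mult_columns .
  qed
  have v\<tau>: "v \<in> weights \<tau>" using v(1) by (simp add: positive_weights_def)
  note sup = weights_support(2)[OF v\<tau>]
  have eq: "a \<bullet> column j Q = c" if j: "j \<in> \<tau>" for j
  proof -
    have "- (a \<bullet> column j Q) = - c"
    proof (rule weighted_mean_eq[where w = v and \<sigma> = \<tau>])
      show "v \<in> weights \<tau>" by (rule v\<tau>)
      show "- (a \<bullet> column i Q) \<le> - c" if "i \<in> support v" for i
        using le[OF subsetD[OF sup that]] by simp
      have "(\<Sum>i\<in>UNIV. v $ i * (a \<bullet> column i Q)) = c" unfolding c_def v(2) inner_mult_columns ..
      then show "(\<Sum>i\<in>UNIV. v $ i * - (a \<bullet> column i Q)) = - c" by (simp add: sum_negf)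
      show "j \<in> support v" using v(1) j by (simp add: positive_weights_def support_def)
    qed
    then show ?thesis by simp
  qed
  obtain t where t: "t \<in> ori \<tau>" using ori_nonempty[OF \<tau>] by blast
  have tt: "t 0 \<in> \<tau>" "t 1 \<in> \<tau>" "t 2 \<in> \<tau>" unfolding ori_vertices(1)[OF \<tau> t] by simp_all
  have "a \<noteq> 0" using a(1) by auto
  then have "area2 (column (t 0) Q) (column (t 1) Q) (column (t 2) Q) = 0"
    using eq[OF tt(1)] eq[OF tt(2)] eq[OF tt(3)] by (rule area2_collinear)
  then show False using pos \<tau> t by (force simp: positively_oriented_def signed_area_eq)
qed

end

section \<open>Cells that touch\<close>

text \<open>Removes the choice of labelling from the comparison of two edges on the same line.\<close>

lemma ordered_edge:
  fixes Q :: "real^'n::finite^2"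
  assumes e: "card e = 2" and sep: "separated Q e e" and a: "a \<noteq> 0"
    and line: "\<And>i. i \<in> e \<Longrightarrow> a \<bullet> column i Q = c" and w: "w \<in> positive_weights e"
  obtains p q where "e = {p, q}" "perp a \<bullet> column p Q < perp a \<bullet> (Q *v w)" "perp a \<bullet> (Q *v w) < perp a \<bullet> column q Q"
proof -
  obtain x y where xy: "e = {x, y}" "x \<noteq> y" using e unfolding card_2_iff by blast
  let ?t = "\<lambda>i. perp a \<bullet> column i Q"
  have off: "\<And>i. i \<notin> {x, y} \<Longrightarrow> w $ i = 0" and pos: "w $ x > 0" "w $ y > 0" and one: "w $ x + w $ y = 1"
    using w xy sum_weights_on[of "{x, y}" w] by (auto simp: positive_weights_def weights_def)
  have Qw: "perp a \<bullet> (Q *v w) = w $ x * ?t x + w $ y * ?t y"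
    using mult_columns_on[of "{x, y}" w Q] off xy(2) by (simp add: inner_add_right)
  have ne: "?t x \<noteq> ?t y"
  proof
    assume "?t x = ?t y"
    then have "perp a \<bullet> (column x Q - column y Q) = 0" "a \<bullet> (column x Q - column y Q) = 0"
      using line[of x] line[of y] xy(1) by (simp_all add: inner_diff_right)
    then have "column x Q = column y Q" using zero_if_orthogonal[OF a, of "column x Q - column y Q"] by simp
    then have "x = y" using inj_onD[OF separated_self_inj_on[OF sep], of x y] xy(1) by simp
    then show False using xy(2) by simp
  qed
  have wx: "w $ x = 1 - w $ y" using one by simp
  have 1: "perp a \<bullet> (Q *v w) - ?t x = w $ y * (?t y - ?t x)"
    unfolding Qw wx by (simp add: algebra_simps)
  have wy: "w $ y = 1 - w $ x" using one by simp
  have 2: "perp a \<bullet> (Q *v w) - ?t y = w $ x * (?t x - ?t y)"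
    unfolding Qw wy by (simp add: algebra_simps)
  show ?thesis
  proof (cases "?t x < ?t y")
    case True
    have "w $ y * (?t y - ?t x) > 0" "w $ x * (?t x - ?t y) < 0"
      using True pos by (simp_all add: mult_pos_neg)
    then show ?thesis using that[of x y] xy(1) 1 2 by simp
  next
    case False
    then have "?t y < ?t x" using ne by simp
    then have "w $ y * (?t y - ?t x) < 0" "w $ x * (?t x - ?t y) > 0"
      using pos by (simp_all add: mult_pos_neg)
    then show ?thesis using that[of y x] xy(1) 1 2 by (simp add: insert_commute)
  qed
qed

context oriented_complex
begin

text \<open>The triangles around \<open>support l\<close> cover a neighbourhood of the common point, in particular
  some interior points of \<open>\<tau>\<close>. A triangle containing such a point is \<open>\<tau>\<close> itself.\<close>

lemma support_subset_if_interior: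
  assumes pos: "positively_oriented \<Delta> ori Q"
    and ws: "\<And>\<sigma> \<tau>. \<sigma> \<in> faces 2 \<Delta> \<Longrightarrow> \<tau> \<in> faces 2 \<Delta> \<Longrightarrow> \<sigma> \<noteq> \<tau> \<Longrightarrow> weakly_separated Q \<sigma> \<tau>"
    and \<sigma>: "\<sigma> \<in> faces 2 \<Delta>" "l \<in> weights \<sigma>" and \<tau>: "\<tau> \<in> faces 2 \<Delta>" "m \<in> weights \<tau>"
    and eq: "Q *v l = Q *v m" and int: "\<And>e. e \<in> boundary_edges \<Delta> \<Longrightarrow> \<not> support l \<subseteq> e"
  shows "support l \<subseteq> \<tau>"
proof -
  let ?x = "Q *v l"
  have "support l \<in> \<Delta>"
    using face_subset[of \<sigma> "support l"] weights_support(2,3)[OF \<sigma>(2)] faces_2[OF \<sigma>(1)] by blast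
  then have "?x \<in> interior (star Q (support l))"
    using interior_star[OF pos _ int support_positive_weights[OF \<sigma>(2)]] by blast
  then obtain d where d: "d > 0" "ball ?x d \<subseteq> star Q (support l)"
    unfolding mem_interior by blast
  have "\<tau> \<noteq> {}" using faces_2[OF \<tau>(1)] by auto
  then obtain k where k: "k \<in> positive_weights \<tau>" using positive_weights_nonempty by blast
  define n where "n = norm (Q *v k - ?x)"
  \<comment> \<open>a point of the interior of \<open>\<tau>\<close>, moved towards \<open>?x\<close> into the disc of radius \<open>d\<close>\<close>
  define e where "e = min (1/2) (d / (2 * (n + 1)))"
  have n0: "n \<ge> 0" by (simp add: n_def)
  have e: "0 < e" "e < 1" using d(1) n0 by (auto simp: e_def)
  have "e * n \<le> d / (2 * (n + 1)) * n" using n0 by (intro mult_right_mono) (auto simp: e_def)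
  also have "\<dots> < d" using n0 d(1) by (simp add: divide_simps)
  finally have en: "e * n < d" .
  define v where "v = (1 - e) *\<^sub>R m + e *\<^sub>R k"
  have v: "v \<in> positive_weights \<tau>" unfolding v_def by (rule positive_weights_mix[OF \<tau>(2) k e])
  have "Q *v v - ?x = e *\<^sub>R (Q *v k - ?x)"
    unfolding v_def eq by (simp add: matrix_vector_right_distrib matrix_vector_mult_scaleR algebra_simps)
  then have "norm (Q *v v - ?x) = e * n" using e(1) by (simp add: n_def)
  then have "Q *v v \<in> ball ?x d" using en by (simp add: dist_norm norm_minus_commute)
  then have "Q *v v \<in> star Q (support l)" using d(2) by blast
  then obtain \<sigma>' where \<sigma>': "\<sigma>' \<in> faces 2 \<Delta>" "support l \<subseteq> \<sigma>'" "Q *v v \<in> cell Q \<sigma>'"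
    unfolding star_def by blast
  have "\<sigma>' = \<tau>"
  proof (rule ccontr)
    assume "\<sigma>' \<noteq> \<tau>"
    then show False using weakly_separated_no_overlap[OF pos ws[OF \<sigma>'(1) \<tau>(1)] \<tau>(1) \<sigma>'(3) v refl] by blast
  qed
  then show ?thesis using \<sigma>'(2) by simp
qed

text \<open>Weak separation becomes separation as soon as boundary vertices are off the boundary edges
  that do not contain them. This is where the boundary distances in the potential are needed:
  without them, two parts of the boundary could come to touch.\<close>

theorem separated_if_weakly_separated:
  assumes pos: "positively_oriented \<Delta> ori Q"
    and ws: "\<And>\<sigma> \<tau>. \<sigma> \<in> faces 2 \<Delta> \<Longrightarrow> \<tau> \<in> faces 2 \<Delta> \<Longrightarrow> \<sigma> \<noteq> \<tau> \<Longrightarrow> weakly_separated Q \<sigma> \<tau>"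
    and bd: "\<And>e i. e \<in> boundary_edges \<Delta> \<Longrightarrow> i \<in> boundary_vertices \<Delta> \<Longrightarrow> i \<notin> e \<Longrightarrow> column i Q \<notin> cell Q e"
    and \<sigma>: "\<sigma> \<in> faces 2 \<Delta>" and \<tau>: "\<tau> \<in> faces 2 \<Delta>"
  shows "separated Q \<sigma> \<tau>"
proof -
  have sep: "separated Q \<rho> \<rho>" if "\<rho> \<in> \<Delta>" for \<rho> using separated_self[OF pos that] .
  have bsep: "separated Q e e" if "e \<in> boundary_edges \<Delta>" for e
    using sep boundary_edge_card[OF that] by blast
  have bv: "i \<in> boundary_vertices \<Delta>" if "e \<in> boundary_edges \<Delta>" "i \<in> e" for e i
    using that unfolding boundary_vertices_def by blast
  \<comment> \<open>the common point is a boundary vertex and lies on a boundary edge\<close>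
  have vertex: "support l = support m"
    if l: "l \<in> weights \<sigma>1" "support l = {i}" "support l \<subseteq> e" "e \<in> boundary_edges \<Delta>"
      and m: "m \<in> weights \<tau>1" "support m \<subseteq> e'" "e' \<in> boundary_edges \<Delta>"
      and eq: "Q *v l = Q *v m" for l m i e e' \<sigma>1 \<tau>1
  proof -
    have l': "l \<in> weights {i}" using weights_support(1)[OF l(1)] l(2) by simp
    have m': "m \<in> weights e'" using weights_support(1)[OF m(1)] weights_mono[OF m(2)] by blast
    have "Q *v l \<in> cell Q {i}" using l' unfolding cell_eq_weights by (rule imageI)
    then have i: "column i Q = Q *v m" using eq by simp
    then have "column i Q \<in> cell Q e'" using m' unfolding cell_eq_weights by (rule image_eqI)
    moreover have "i \<in> boundary_vertices \<Delta>" using bv[OF l(4)] l(2,3) by simp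
    ultimately have ie: "i \<in> e'" using bd[OF m(3)] by blast
    have "Q *v axis i 1 = Q *v m" using i by (simp add: matrix_vector_mult_basis)
    then have "axis i 1 = m" by (rule separated_weights_eq[OF bsep[OF m(3)] axis_in_weights[OF ie] m'])
    then have "support m = {i}" by (auto simp: support_def axis_def split: if_splits)
    then show ?thesis using l(2) by simp
  qed
  \<comment> \<open>the common point is relatively interior to two boundary edges\<close>
  have edge: "e = e'"
    if l: "l \<in> weights \<sigma>" "support l = e" "e \<in> boundary_edges \<Delta>"
      and m: "m \<in> weights \<tau>" "support m = e'" "e' \<in> boundary_edges \<Delta>"
      and eq: "Q *v l = Q *v m" and ne: "\<sigma> \<noteq> \<tau>" for l m e e'
  proof -
    obtain a where a: "norm a = 1" "\<forall>i\<in>\<sigma>. \<forall>j\<in>\<tau>. a \<bullet> column i Q \<le> a \<bullet> column j Q"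
      using ws[OF \<sigma> \<tau> ne] unfolding weakly_separated_def by blast
    have a0: "a \<noteq> 0" using a(1) by auto
    define c where "c = a \<bullet> (Q *v l)"
    have cl: "(\<Sum>i\<in>UNIV. l $ i * (a \<bullet> column i Q)) = c" unfolding c_def inner_mult_columns ..
    have cm: "(\<Sum>i\<in>UNIV. m $ i * (a \<bullet> column i Q)) = c" unfolding c_def eq inner_mult_columns ..
    have up: "a \<bullet> column i Q \<le> c" if "i \<in> \<sigma>" for i
    proof -
      have "(\<Sum>j\<in>UNIV. m $ j * - (a \<bullet> column j Q)) \<le> - (a \<bullet> column i Q)"
        by (rule weighted_mean_le[OF m(1)]) (use a(2) that in simp)
      then show ?thesis using cm by (simp add: sum_negf)
    qed
    have low: "c \<le> a \<bullet> column j Q" if "j \<in> \<tau>" for j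
    proof -
      have "(\<Sum>i\<in>UNIV. l $ i * (a \<bullet> column i Q)) \<le> a \<bullet> column j Q"
        by (rule weighted_mean_le[OF l(1)]) (use a(2) that in simp)
      then show ?thesis using cl by simp
    qed
    have line: "a \<bullet> column i Q = c" if "i \<in> e" for i
    proof (rule weighted_mean_eq[OF l(1) _ cl])
      show "i \<in> support l" using that l(2) by simp
      show "a \<bullet> column j Q \<le> c" if "j \<in> support l" for j
        using up[OF subsetD[OF weights_support(2)[OF l(1)] that]] .
    qed
    have line': "a \<bullet> column i Q = c" if i: "i \<in> e'" for i
    proof -
      have "- (a \<bullet> column i Q) = - c"
      proof (rule weighted_mean_eq[OF m(1)])
        show "i \<in> support m" using i m(2) by simp
        show "- (a \<bullet> column j Q) \<le> - c" if "j \<in> support m" for j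
          using low[OF subsetD[OF weights_support(2)[OF m(1)] that]] by simp
        show "(\<Sum>j\<in>UNIV. m $ j * - (a \<bullet> column j Q)) = - c" using cm by (simp add: sum_negf)
      qed
      then show ?thesis by simp
    qed
    let ?t = "\<lambda>i. perp a \<bullet> column i Q"
    have lw: "l \<in> positive_weights e" "m \<in> positive_weights e'"
      using support_positive_weights[OF l(1)] support_positive_weights[OF m(1)] l(2) m(2) by simp_all
    obtain p q where pq: "e = {p, q}" "?t p < perp a \<bullet> (Q *v l)" "perp a \<bullet> (Q *v l) < ?t q"
      using ordered_edge[OF _ bsep[OF l(3)] a0 line lw(1)] boundary_edge_card[OF l(3)] by blast
    obtain r s where rs: "e' = {r, s}" "?t r < perp a \<bullet> (Q *v l)" "perp a \<bullet> (Q *v l) < ?t s"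
      using ordered_edge[OF _ bsep[OF m(3)] a0 line' lw(2)] boundary_edge_card[OF m(3)] unfolding eq by blast
    \<comment> \<open>the only boundary vertices on a boundary edge are its endpoints\<close>
    have hit: "i = u \<or> i = v"
      if uv: "{u, v} \<in> boundary_edges \<Delta>" "a \<bullet> column u Q = c" "a \<bullet> column v Q = c" "?t u < ?t v"
        and i: "i \<in> boundary_vertices \<Delta>" "a \<bullet> column i Q = c" "?t u \<le> ?t i" "?t i \<le> ?t v" for i u v
    proof -
      have "column i Q \<in> convex hull {column u Q, column v Q}"
        by (rule line_coordinate_in_segment[OF a0 uv(2,3) i(2) uv(4) i(3,4)])
      then have "column i Q \<in> cell Q {u, v}" by simp
      then have "i \<in> {u, v}" using bd[OF uv(1) i(1)] by blast
      then show ?thesis by simp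
    qed
    have be: "{p, q} \<in> boundary_edges \<Delta>" "{r, s} \<in> boundary_edges \<Delta>" using l(3) m(3) pq(1) rs(1) by simp_all
    have v: "p \<in> boundary_vertices \<Delta>" "q \<in> boundary_vertices \<Delta>" "r \<in> boundary_vertices \<Delta>" "s \<in> boundary_vertices \<Delta>"
      using bv[OF be(1)] bv[OF be(2)] by simp_all
    have ln: "a \<bullet> column p Q = c" "a \<bullet> column q Q = c" "a \<bullet> column r Q = c" "a \<bullet> column s Q = c"
      using line line' pq(1) rs(1) by simp_all
    \<comment> \<open>the two segments overlap around the common point\<close>
    have pltq: "?t p < ?t q" and rlts: "?t r < ?t s" and rltq: "?t r < ?t q" and plts: "?t p < ?t s"
      using pq(2,3) rs(2,3) by linarith+
    have "p = r"
    proof (cases "?t p \<le> ?t r")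
      case True
      have "r = p \<or> r = q"
        by (rule hit[OF be(1) ln(1,2) pltq v(3) ln(3) True]) (use rltq in simp)
      then show ?thesis using rltq by auto
    next
      case False
      have "p = r \<or> p = s"
        by (rule hit[OF be(2) ln(3,4) rlts v(1) ln(1)]) (use False plts in simp_all)
      then show ?thesis using plts by auto
    qed
    moreover have "q = s"
    proof (cases "?t q \<le> ?t s")
      case True
      have "q = r \<or> q = s"
        by (rule hit[OF be(2) ln(3,4) rlts v(2) ln(2) _ True]) (use rltq in simp)
      then show ?thesis using rltq by auto
    next
      case False
      have "s = p \<or> s = q"
        by (rule hit[OF be(1) ln(1,2) pltq v(4) ln(4)]) (use False plts in simp_all)
      then show ?thesis using plts by auto
    qed
    ultimately show ?thesis using pq(1) rs(1) by simp
  qed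
  have "cell Q \<sigma> \<inter> cell Q \<tau> \<subseteq> cell Q (\<sigma> \<inter> \<tau>)"
  proof
    fix x assume "x \<in> cell Q \<sigma> \<inter> cell Q \<tau>"
    then have "x \<in> cell Q \<sigma>" "x \<in> cell Q \<tau>" by simp_all
    then obtain l m where l: "l \<in> weights \<sigma>" "x = Q *v l" and m: "m \<in> weights \<tau>" "x = Q *v m"
      unfolding cell_eq_weights by (elim imageE)
    have eq: "Q *v l = Q *v m" using l(2) m(2) by simp
    note sl = weights_support(2)[OF l(1)] and sm = weights_support(2)[OF m(1)]
    have "support l \<subseteq> \<tau> \<or> support m \<subseteq> \<sigma>"
    proof (cases "\<sigma> = \<tau>")
      case True
      then show ?thesis using sl by simp
    next
      case False
      show ?thesis
      proof (cases "(\<forall>e\<in>boundary_edges \<Delta>. \<not> support l \<subseteq> e) \<or> (\<forall>e\<in>boundary_edges \<Delta>. \<not> support m \<subseteq> e)")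
        case True
        then show ?thesis
        proof
          assume "\<forall>e\<in>boundary_edges \<Delta>. \<not> support l \<subseteq> e"
          then have "support l \<subseteq> \<tau>"
            by (intro support_subset_if_interior[OF pos ws \<sigma> l(1) \<tau> m(1) eq]) simp_all
          then show ?thesis ..
        next
          assume "\<forall>e\<in>boundary_edges \<Delta>. \<not> support m \<subseteq> e"
          then have "support m \<subseteq> \<sigma>"
            by (intro support_subset_if_interior[OF pos ws \<tau> m(1) \<sigma> l(1) eq[symmetric]]) simp_all
          then show ?thesis ..
        qed
      next
        case nb: False
        then obtain e e' where e: "e \<in> boundary_edges \<Delta>" "support l \<subseteq> e"
          and e': "e' \<in> boundary_edges \<Delta>" "support m \<subseteq> e'" by blast
        have one_or_all: "(\<exists>i. support k = {i}) \<or> support k = d"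
          if "k \<in> weights \<rho>" "support k \<subseteq> d" "d \<in> boundary_edges \<Delta>" for k d \<rho>
        proof (cases "card (support k) = 2")
          case True
          have "support k = d"
            by (rule card_subset_eq[OF finite that(2)]) (simp add: True boundary_edge_card[OF that(3)])
          then show ?thesis ..
        next
          case False
          have "card (support k) \<le> 2" using card_mono[OF finite that(2)] boundary_edge_card[OF that(3)] by simp
          moreover have "card (support k) \<noteq> 0" using weights_support(3)[OF that(1)] by simp
          ultimately have "card (support k) = 1" using False by linarith
          then show ?thesis by (simp add: card_1_singleton_iff)
        qed
        have "support l = support m"
          using one_or_all[OF l(1) e(2,1)]
        proof
          assume "\<exists>i. support l = {i}"
          then obtain i where i: "support l = {i}" ..
          show ?thesis by (rule vertex[OF l(1) i e(2,1) m(1) e'(2,1) eq])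
        next
          assume le: "support l = e"
          show ?thesis using one_or_all[OF m(1) e'(2,1)]
          proof
            assume "\<exists>i. support m = {i}"
            then obtain i where i: "support m = {i}" ..
            show ?thesis by (rule vertex[OF m(1) i e'(2,1) l(1) e(2,1) eq[symmetric], symmetric])
          next
            assume me: "support m = e'"
            show ?thesis unfolding le me by (rule edge[OF l(1) le e(1) m(1) me e'(1) eq False])
          qed
        qed
        then show ?thesis using sm by simp
      qed
    qed
    then show "x \<in> cell Q (\<sigma> \<inter> \<tau>)"
    proof
      assume "support l \<subseteq> \<tau>"
      then have "l \<in> weights (\<sigma> \<inter> \<tau>)"
        using weights_support(1)[OF l(1)] weights_mono[of "support l" "\<sigma> \<inter> \<tau>"] sl by blast
      then show ?thesis unfolding cell_eq_weights l(2) by (rule imageI)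
    next
      assume "support m \<subseteq> \<sigma>"
      then have "m \<in> weights (\<sigma> \<inter> \<tau>)"
        using weights_support(1)[OF m(1)] weights_mono[of "support m" "\<sigma> \<inter> \<tau>"] sm by blast
      then show ?thesis unfolding cell_eq_weights m(2) by (rule imageI)
    qed
  qed
  then show ?thesis
    by (rule separated_if_cell_Int[OF sep sep, rotated 2]) (use faces_2[OF \<sigma>] faces_2[OF \<tau>] in simp_all)
qed

end

section \<open>Heights and distances bound the configuration\<close>

lemma area2_le_norms: "area2 p q r \<le> norm (q - p) * norm (r - p)"
proof -
  have n: "norm (perp u) = norm u" for u by (simp add: norm_eq_sqrt_inner inner_vec_def sum_2 perp_def)
  have "area2 p q r = perp (q - p) \<bullet> (r - p)"
    by (simp add: area2_def inner_vec_def sum_2 perp_def algebra_simps)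
  also have "\<dots> \<le> norm (perp (q - p)) * norm (r - p)" by (rule norm_cauchy_schwarz)
  finally show ?thesis by (simp add: n)
qed

text \<open>No edge is shorter than a height onto another one, and twice the area is edge length times
  height. A degenerate edge would have height 0 because of \<open>x / 0 = 0\<close>, and is excluded by
  \<open>c > 0\<close>.\<close>

lemma signed_area_ge_if_heights_ge:
  assumes h: "\<And>l. height Q l t \<ge> c" and c: "c > 0"
  shows "signed_area Q t \<ge> c\<^sup>2 / 2"
proof -
  let ?p = "column (t 0) Q" and ?q = "column (t 1) Q" and ?r = "column (t 2) Q"
  have A: "signed_area Q t = area2 ?p ?q ?r / 2" by (rule signed_area_eq)
  have le: "c * norm (column (t (l + 1)) Q - column (t (l + 2)) Q) \<le> 2 * signed_area Q t
      \<and> norm (column (t (l + 1)) Q - column (t (l + 2)) Q) > 0" for l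
  proof -
    let ?n = "norm (column (t (l + 1)) Q - column (t (l + 2)) Q)"
    have "c \<le> 2 * signed_area Q t / ?n" using h[of l] by (simp add: height_def)
    moreover from this have "?n \<noteq> 0" using c by auto
    then have "?n > 0" by simp
    ultimately show ?thesis by (simp add: pos_le_divide_eq)
  qed
  have pr: "c * norm (?r - ?p) \<le> 2 * signed_area Q t" "norm (?r - ?p) > 0"
    using le[of 1] by (simp_all add: mod_3)
  have pq: "c * norm (?q - ?p) \<le> 2 * signed_area Q t"
    using le[of 2] by (simp add: mod_3 norm_minus_commute)
  have "c * norm (?r - ?p) \<le> norm (?q - ?p) * norm (?r - ?p)"
    using pr(1) area2_le_norms[of ?p ?q ?r] A by simp
  then have "c \<le> norm (?q - ?p)" using pr(2) by simp
  then have "c * c \<le> c * norm (?q - ?p)" using c by (intro mult_left_mono) simp_all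
  then show ?thesis using pq by (simp add: power2_eq_square)
qed

lemma area2_permute:
  fixes P :: "'a \<Rightarrow> real^2"
  assumes "{x, y, z} = {a, b, c}" "x \<noteq> y" "y \<noteq> z" "x \<noteq> z"
  shows "area2 (P x) (P y) (P z) = area2 (P a) (P b) (P c) \<or> area2 (P x) (P y) (P z) = - area2 (P a) (P b) (P c)"
proof -
  have "x \<in> {a, b, c}" "y \<in> {a, b, c}" "z \<in> {a, b, c}" using assms(1) by blast+
  then show ?thesis
    using assms(2-4) by (elim insertE emptyE; simp add: area2_def algebra_simps)
qed

lemma edge_norm1_le:
  assumes "norm u \<le> 1"
  shows "edge_norm1 u y \<le> 2 * norm y"
proof -
  have n: "norm (perp u) = norm u" by (simp add: norm_eq_sqrt_inner inner_vec_def sum_2 perp_def)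
  have "norm u * norm y \<le> 1 * norm y" using assms by (intro mult_right_mono) simp_all
  moreover have "\<bar>u \<bullet> y\<bar> \<le> norm u * norm y" "\<bar>perp u \<bullet> y\<bar> \<le> norm u * norm y"
    using Cauchy_Schwarz_ineq2[of u y] Cauchy_Schwarz_ineq2[of "perp u" y] n by simp_all
  ultimately show ?thesis by (simp add: edge_norm1_def)
qed

lemma edge_dist_le:
  assumes z: "z \<in> convex hull {column j0 Q, column j1 Q}"
  shows "edge_dist Q i0 j0 j1 \<le> 2 * norm (column i0 Q - z)"
proof -
  define u where "u = (column j1 Q - column j0 Q) /\<^sub>R norm (column j1 Q - column j0 Q)"
  have "norm u \<le> 1" by (cases "column j1 Q = column j0 Q") (simp_all add: u_def)
  have "edge_dist Q i0 j0 j1 = (INF x\<in>convex hull {column j0 Q, column j1 Q}. edge_norm1 u (column i0 Q - x))"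
    by (simp add: edge_dist_def u_def Let_def)
  also have "\<dots> \<le> edge_norm1 u (column i0 Q - z)"
    by (rule cINF_lower[OF _ z]) (auto intro!: bdd_belowI[of _ 0] simp: edge_norm1_def)
  also have "\<dots> \<le> 2 * norm (column i0 Q - z)" by (rule edge_norm1_le) fact
  finally show ?thesis .
qed

context oriented_complex
begin

text \<open>Two orderings of the same three vertices are compared through absolute values, so that
  parities of permutations need not be computed; both areas are positive where this is used.\<close>

lemma abs_signed_area_eq:
  assumes "\<sigma> \<in> faces 2 \<Delta>" "t \<in> ori \<sigma>" "s \<in> ori \<sigma>"
  shows "\<bar>signed_area Q t\<bar> = \<bar>signed_area Q s\<bar>"
proof -
  note t = ori_vertices[OF assms(1,2)] and s = ori_vertices[OF assms(1,3)]
  have "{t 0, t 1, t 2} = {s 0, s 1, s 2}" using t(1) s(1) by (rule trans[OF sym])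
  from area2_permute[OF this t(2,3,4), of "\<lambda>i. column i Q"] show ?thesis
    unfolding signed_area_eq by (elim disjE) simp_all
qed

lemma height_pos:
  assumes "Q \<in> M_plus \<Delta> ori" "\<sigma> \<in> faces 2 \<Delta>" "t \<in> ori \<sigma>"
  shows "signed_area Q t > 0" "column (t (l + 1)) Q \<noteq> column (t (l + 2)) Q" "height Q l t > 0"
proof -
  show A: "signed_area Q t > 0" using assms by (simp add: M_plus_def)
  show ne: "column (t (l + 1)) Q \<noteq> column (t (l + 2)) Q"
  proof
    assume eq: "column (t (l + 1)) Q = column (t (l + 2)) Q"
    have "l \<in> {0, 1, 2}" using UNIV_3_zero by blast
    then have "area2 (column (t 0) Q) (column (t 1) Q) (column (t 2) Q) = 0"
      using eq by (elim insertE emptyE; simp add: mod_3 area2_def)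
    then show False using A by (simp add: signed_area_eq)
  qed
  show "height Q l t > 0" using A ne by (simp add: height_def)
qed

text \<open>In the limit the bound on the heights keeps the triangles nondegenerate and the bound on
  the distances keeps boundary vertices off boundary edges; weak separation passes to the limit
  because it is a closed condition.\<close>

theorem limit_in_M_plus:
  assumes x: "\<And>n. x n \<in> M_plus \<Delta> ori" and lim: "x \<longlonglongrightarrow> Q" and c: "c > 0"
    and h: "\<And>n \<sigma>. \<sigma> \<in> faces 2 \<Delta> \<Longrightarrow> \<exists>t\<in>ori \<sigma>. \<forall>l. height (x n) l t \<ge> c"
    and D: "\<And>n i j k. {j, k} \<in> boundary_edges \<Delta> \<Longrightarrow> i \<in> boundary_vertices \<Delta> \<Longrightarrow> i \<notin> {j, k} \<Longrightarrow> edge_dist (x n) i j k \<ge> c"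
  shows "Q \<in> M_plus \<Delta> ori"
proof -
  have lim_col: "(\<lambda>n. column i (x n)) \<longlonglongrightarrow> column i Q" for i
    using bounded_linear.tendsto[OF bounded_linear_column lim] .
  have pos: "positively_oriented \<Delta> ori Q"
    unfolding positively_oriented_def
  proof (intro ballI)
    fix \<sigma> t assume \<sigma>: "\<sigma> \<in> faces 2 \<Delta>" and t: "t \<in> ori \<sigma>"
    have ge: "signed_area (x n) t \<ge> c\<^sup>2 / 2" for n
    proof -
      obtain s where s: "s \<in> ori \<sigma>" "\<forall>l. height (x n) l s \<ge> c" using h[OF \<sigma>, of n] by blast
      have "signed_area (x n) s \<ge> c\<^sup>2 / 2" by (rule signed_area_ge_if_heights_ge[OF _ c]) (use s(2) in blast)
      moreover have "signed_area (x n) t > 0" "signed_area (x n) s > 0"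
        using height_pos(1)[OF x \<sigma>] t s(1) by blast+
      ultimately show ?thesis using abs_signed_area_eq[OF \<sigma> t s(1), of "x n"] by linarith
    qed
    have "(\<lambda>n. signed_area (x n) t) \<longlonglongrightarrow> signed_area Q t"
      unfolding signed_area_eq area2_def by (intro tendsto_intros lim_col) simp
    then have "signed_area Q t \<ge> c\<^sup>2 / 2" using ge by (intro LIMSEQ_le_const) auto
    moreover have "c\<^sup>2 / 2 > 0" using c by simp
    ultimately show "signed_area Q t > 0" by linarith
  qed
  moreover have "separated Q \<sigma> \<tau>" if \<sigma>\<tau>: "\<sigma> \<in> faces 2 \<Delta>" "\<tau> \<in> faces 2 \<Delta>" for \<sigma> \<tau>
  proof (rule separated_if_weakly_separated[OF pos _ _ \<sigma>\<tau>])
    fix \<sigma> \<tau> assume \<sigma>\<tau>: "\<sigma> \<in> faces 2 \<Delta>" "\<tau> \<in> faces 2 \<Delta>" "\<sigma> \<noteq> \<tau>"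
    have "\<not> \<sigma> \<subseteq> \<tau>"
      using card_subset_eq[of \<tau> \<sigma>] faces_2[OF \<sigma>\<tau>(1)] faces_2[OF \<sigma>\<tau>(2)] \<sigma>\<tau>(3) by auto
    then obtain i where i: "i \<in> \<sigma>" "i \<notin> \<tau>" by blast
    have "\<tau> \<noteq> {}" using faces_2[OF \<sigma>\<tau>(2)] by auto
    have "x n \<in> {Q. weakly_separated Q \<sigma> \<tau>}" for n
    proof -
      have "separated (x n) \<sigma> \<tau>" using x[of n] \<sigma>\<tau>(1,2) unfolding M_plus_iff by blast
      then show ?thesis using separated_imp_weakly_separated[OF _ i \<open>\<tau> \<noteq> {}\<close>] by simp
    qed
    then have "Q \<in> {Q. weakly_separated Q \<sigma> \<tau>}"
      using closed_sequentially[OF closed_weakly_separated _ lim] by blast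
    then show "weakly_separated Q \<sigma> \<tau>" by simp
  next
    fix e i assume e: "e \<in> boundary_edges \<Delta>" and i: "i \<in> boundary_vertices \<Delta>" "i \<notin> e"
    obtain j k where jk: "e = {j, k}" using boundary_edge_card[OF e] unfolding card_2_iff by blast
    show "column i Q \<notin> cell Q e"
    proof
      assume "column i Q \<in> cell Q e"
      then obtain w where w: "w \<in> weights e" "column i Q = Q *v w" unfolding cell_eq_weights by blast
      have le: "c \<le> 2 * norm (column i (x n) - x n *v w)" for n
      proof -
        have "x n *v w \<in> cell (x n) e" unfolding cell_eq_weights using w(1) by (rule imageI)
        then have "x n *v w \<in> convex hull {column j (x n), column k (x n)}" unfolding jk by simp
        then have "edge_dist (x n) i j k \<le> 2 * norm (column i (x n) - x n *v w)" by (rule edge_dist_le)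
        moreover have "c \<le> edge_dist (x n) i j k" using D[of j k i n] e i unfolding jk by blast
        ultimately show ?thesis by linarith
      qed
      have "(\<lambda>n. 2 * norm (column i (x n) - x n *v w)) \<longlonglongrightarrow> 2 * norm (column i Q - Q *v w)"
        unfolding mult_columns by (intro tendsto_intros lim_col)
      then have "c \<le> 2 * norm (column i Q - Q *v w)" by (rule LIMSEQ_le_const) (simp add: le)
      then show False using w(2) c by simp
    qed
  qed
  ultimately show ?thesis unfolding M_plus_iff by blast
qed

end

section \<open>Stacking columns\<close>

definition unvec_mat :: "real^('n::finite \<times> 2) \<Rightarrow> real^'n^2" where
  "unvec_mat x = (\<chi> r i. x $ (i, r))"

lemma inv_vec_mat: "inv vec_mat = unvec_mat"
  by (rule inv_unique_comp) (auto simp: fun_eq_iff vec_eq_iff vec_mat_def unvec_mat_def)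

lemma vec_mat_unvec_mat: "vec_mat (unvec_mat x) = x" and unvec_mat_vec_mat: "unvec_mat (vec_mat Q) = Q"
  by (simp_all add: vec_eq_iff vec_mat_def unvec_mat_def)

lemma bounded_linear_unvec_mat: "bounded_linear unvec_mat"
  by (rule linear_conv_bounded_linear[THEN iffD1]) (auto intro!: linearI simp: unvec_mat_def vec_eq_iff)

lemma bounded_linear_vec_mat: "bounded_linear vec_mat"
  by (rule linear_conv_bounded_linear[THEN iffD1]) (auto intro!: linearI simp: vec_mat_def vec_eq_iff)

lemma vec_mat_image: "vec_mat ` S = unvec_mat -` S"
proof (rule set_eqI)
  fix x show "x \<in> vec_mat ` S \<longleftrightarrow> x \<in> unvec_mat -` S"
    using vec_mat_unvec_mat[of x] by (auto simp: unvec_mat_vec_mat intro: image_eqI[of x vec_mat "unvec_mat x"])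
qed

lemma open_vec_mat_image: "open S \<Longrightarrow> open (vec_mat ` S)"
  unfolding vec_mat_image
  by (rule open_vimage) (simp_all add: linear_continuous_on bounded_linear_unvec_mat)

lemma Ck_on_unvec_mat:
  assumes "open S" "Ck_on k f S"
  shows "Ck_on k (f \<circ> inv vec_mat) (vec_mat ` S)"
  unfolding inv_vec_mat o_def
  by (rule Ck_on_compose_linear[OF open_vec_mat_image[OF assms(1)] bounded_linear_unvec_mat _ assms(2)])
    (auto simp: vec_mat_image)

lemma proper_on_unvec_mat:
  assumes "proper_on S f"
  shows "proper_on (vec_mat ` S) (f \<circ> inv vec_mat)"
  unfolding proper_on_def
proof (intro allI impI)
  fix K :: "real set" assume "compact K"
  then have "compact {Q\<in>S. f Q \<in> K}" using assms by (simp add: proper_on_def)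
  then have "compact (vec_mat ` {Q\<in>S. f Q \<in> K})"
    by (intro compact_continuous_image linear_continuous_on bounded_linear_vec_mat)
  also have "vec_mat ` {Q\<in>S. f Q \<in> K} = {x \<in> vec_mat ` S. (f \<circ> inv vec_mat) x \<in> K}"
    unfolding vec_mat_image inv_vec_mat by auto
  finally show "compact {x \<in> vec_mat ` S. (f \<circ> inv vec_mat) x \<in> K}" .
qed

lemma f_metric_eq_graph_metric: "f_metric f = graph_metric (f \<circ> inv vec_mat)"
  by (rule ext) (simp add: f_metric_def graph_metric_def)

section \<open>Smoothness of the potential\<close>

lemma Ck_on_entry: "open S \<Longrightarrow> Ck_on k (\<lambda>Q :: real^'n^'m. Q $ r $ i) S"
  by (rule Ck_on_linear) (auto intro: bounded_linear_compose[OF bounded_linear_vec_nth bounded_linear_vec_nth])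

lemma Ck_on_signed_area:
  assumes S: "open (S :: (real^'n^2) set)"
  shows "Ck_on k (\<lambda>Q. signed_area Q t) S"
proof -
  have *: "Ck_on k (\<lambda>Q. column i Q $ r) S" for i r
    unfolding column_def vec_lambda_beta by (rule Ck_on_entry[OF S])
  have "Ck_on k (\<lambda>Q. 1/2 * area2 (column (t 0) Q) (column (t 1) Q) (column (t 2) Q)) S"
    unfolding area2_def by (intro Ck_on_cmult Ck_on_diff Ck_on_mult * S)
  then show ?thesis by (simp add: signed_area_eq)
qed

lemma Ck_on_edge_length:
  assumes S: "open (S :: (real^'n^2) set)" and ne: "\<And>Q. Q \<in> S \<Longrightarrow> column i Q \<noteq> column j Q"
  shows "Ck_on k (\<lambda>Q. norm (column i Q - column j Q)) S"
proof -
  have *: "Ck_on k (\<lambda>Q. column i Q $ r) S" for i r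
    unfolding column_def vec_lambda_beta by (rule Ck_on_entry[OF S])
  have eq: "(norm (column i Q - column j Q)) = sqrt (\<Sum>r\<in>UNIV. (column i Q $ r - column j Q $ r) * (column i Q $ r - column j Q $ r))"
    for Q :: "real^'n^2"
    by (simp add: norm_eq_sqrt_inner inner_vec_def)
  have "Ck_on k (\<lambda>Q. sqrt (\<Sum>r\<in>UNIV. (column i Q $ r - column j Q $ r) * (column i Q $ r - column j Q $ r))) S"
  proof (intro Ck_on_sqrt Ck_on_sum Ck_on_diff Ck_on_mult * S)
    fix Q assume "Q \<in> S"
    then have "norm (column i Q - column j Q) > 0" using ne by simp
    then show "0 < (\<Sum>r\<in>UNIV. (column i Q $ r - column j Q $ r) * (column i Q $ r - column j Q $ r))"
      unfolding eq by (simp only: real_sqrt_gt_0_iff)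
  qed
  then show ?thesis by (simp only: eq)
qed

lemma Ck_on_norm_square:
  assumes S: "open (S :: (real^'n^'m) set)"
  shows "Ck_on k (\<lambda>Q. (norm (Q - Q0))\<^sup>2) S"
proof -
  have "Ck_on k (\<lambda>Q. \<Sum>r\<in>UNIV. \<Sum>i\<in>UNIV. (Q $ r $ i - Q0 $ r $ i) * (Q $ r $ i - Q0 $ r $ i)) S"
    by (intro Ck_on_sum Ck_on_mult Ck_on_diff Ck_on_entry Ck_on_const S)
  then show ?thesis by (simp add: power2_norm_eq_inner inner_vec_def)
qed

text \<open>Without a quotient of lengths in the denominator, smoothness can be read off.\<close>

lemma inverse_height: "b / height Q l t = b * norm (column (t (l + 1)) Q - column (t (l + 2)) Q) / (2 * signed_area Q t)"
  by (simp add: height_def)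

section \<open>The potential is proper and its metric complete\<close>

theorem theorem4p13:
  fixes \<Delta> :: "'n::finite set set"
    and ori :: "'n set \<Rightarrow> (3 \<Rightarrow> 'n) set"
    and N\<^sub>T :: nat and T :: "nat \<Rightarrow> 3 \<Rightarrow> 'n"
    and Qref :: "real^'n^2"
    and \<beta>\<^sub>1 \<beta>\<^sub>2 \<beta>\<^sub>3 :: real
    and D\<mu> :: "'n \<Rightarrow> 'n set \<Rightarrow> real^'n^2 \<Rightarrow> real"
    and f :: "real^'n^2 \<Rightarrow> real"
  assumes "connectivity_complex \<Delta>" and "\<Union>\<Delta> = UNIV"
    and "consistently_oriented \<Delta> ori"
    and "numbering_2_faces \<Delta> ori N\<^sub>T T"
    and "Qref \<in> M_plus \<Delta> ori"
    and "\<beta>\<^sub>1 > 0" and "\<beta>\<^sub>2 > 0" and "\<beta>\<^sub>3 > 0"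
    and "\<And>i0 j0 j1. \<lbrakk>{j0, j1} \<in> boundary_edges \<Delta>; i0 \<in> boundary_vertices \<Delta>; i0 \<noteq> j0; i0 \<noteq> j1\<rbrakk> \<Longrightarrow>
           continuous_on (M_plus \<Delta> ori) (D\<mu> i0 {j0, j1}) \<and>
           (\<forall>Q\<in>M_plus \<Delta> ori. 0 < D\<mu> i0 {j0, j1} Q \<and> D\<mu> i0 {j0, j1} Q \<le> edge_dist Q i0 j0 j1)"
    and "\<And>Q. Q \<in> M_plus \<Delta> ori \<Longrightarrow>
           f Q = (\<Sum>k=1..N\<^sub>T. \<Sum>l\<in>UNIV. \<beta>\<^sub>1 / height Q l (T k))
               + (\<Sum>e\<in>boundary_edges \<Delta>. \<Sum>i0\<in>boundary_vertices \<Delta> - e. \<beta>\<^sub>2 / D\<mu> i0 e Q)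
               + \<beta>\<^sub>3 / 2 * (norm (Q - Qref))\<^sup>2"
  shows "proper_on (M_plus_comp \<Delta> ori Qref) f \<and>
         ((\<forall>e\<in>boundary_edges \<Delta>. \<forall>i0\<in>boundary_vertices \<Delta> - e.
             Ck_on 3 (D\<mu> i0 e) (M_plus_comp \<Delta> ori Qref)) \<longrightarrow>
          riemannian_metric_on (vec_mat ` M_plus_comp \<Delta> ori Qref) (f_metric f) \<and>
          geodesically_complete (vec_mat ` M_plus_comp \<Delta> ori Qref) (f_metric f))"
proof -
  interpret oriented_complex \<Delta> ori using assms(1-3) by unfold_locales
  let ?M = "M_plus \<Delta> ori" and ?C = "M_plus_comp \<Delta> ori Qref"
  let ?BE = "boundary_edges \<Delta>" and ?BV = "boundary_vertices \<Delta>"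
  have T: "range (T k) \<in> faces 2 \<Delta>" "T k \<in> ori (range (T k))" if "k \<in> {1..N\<^sub>T}" for k
    using assms(4) that bij_betwE unfolding numbering_2_faces_def by blast+
  have T_onto: "\<exists>k\<in>{1..N\<^sub>T}. range (T k) = \<sigma>" if "\<sigma> \<in> faces 2 \<Delta>" for \<sigma>
  proof -
    have "(\<lambda>k. range (T k)) ` {1..N\<^sub>T} = faces 2 \<Delta>"
      using assms(4) unfolding numbering_2_faces_def bij_betw_def by blast
    then have "\<sigma> \<in> (\<lambda>k. range (T k)) ` {1..N\<^sub>T}" using that by simp
    then show ?thesis by (elim imageE) (simp only: bexI)
  qed
  have D_cont: "continuous_on ?M (D\<mu> i e)" and D_pos: "\<And>Q. Q \<in> ?M \<Longrightarrow> 0 < D\<mu> i e Q"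
    if "e \<in> ?BE" "i \<in> ?BV - e" for i e
  proof -
    obtain j k where "e = {j, k}" using boundary_edge_card[OF \<open>e \<in> ?BE\<close>] unfolding card_2_iff by blast
    then show "continuous_on ?M (D\<mu> i e)" "\<And>Q. Q \<in> ?M \<Longrightarrow> 0 < D\<mu> i e Q"
      using assms(9)[of j k i] that by auto
  qed
  have C_M: "?C \<subseteq> ?M" unfolding M_plus_comp_def by (rule path_component_subset)
  have C_open: "open ?C" unfolding M_plus_comp_def by (rule open_path_component[OF M_plus_open])

  \<comment> \<open>for \<open>k = 0\<close> this is continuity, which properness needs on all of \<open>M_plus \<Delta> ori\<close>; for \<open>k = 3\<close> it is
    needed for the metric\<close>
  have f_Ck: "Ck_on k f S"
    if S: "open S" "S \<subseteq> ?M" and D: "\<And>e i. e \<in> ?BE \<Longrightarrow> i \<in> ?BV - e \<Longrightarrow> Ck_on k (D\<mu> i e) S" for k S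
  proof -
    have "Ck_on k (\<lambda>Q. \<beta>\<^sub>1 / height Q l (T k')) S" if "k' \<in> {1..N\<^sub>T}" for k' l
      unfolding inverse_height
    proof (intro Ck_on_divide Ck_on_cmult Ck_on_signed_area Ck_on_edge_length S(1))
      fix Q assume "Q \<in> S"
      then have "Q \<in> ?M" using S(2) by blast
      from height_pos[OF this T[OF that]]
      show "column (T k' (l + 1)) Q \<noteq> column (T k' (l + 2)) Q" "2 * signed_area Q (T k') \<noteq> 0" by simp_all
    qed
    moreover have "Ck_on k (\<lambda>Q. \<beta>\<^sub>2 / D\<mu> i e Q) S" if "e \<in> ?BE" "i \<in> ?BV - e" for e i
      by (rule Ck_on_divide[OF S(1) Ck_on_const[OF S(1)] D[OF that]]) (use D_pos[OF that] S(2) in force)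
    ultimately have "Ck_on k (\<lambda>Q. (\<Sum>k=1..N\<^sub>T. \<Sum>l\<in>UNIV. \<beta>\<^sub>1 / height Q l (T k))
               + (\<Sum>e\<in>?BE. \<Sum>i0\<in>?BV - e. \<beta>\<^sub>2 / D\<mu> i0 e Q)
               + \<beta>\<^sub>3 / 2 * (norm (Q - Qref))\<^sup>2) S"
      by (intro Ck_on_add Ck_on_sum Ck_on_cmult Ck_on_norm_square S(1))
    then show ?thesis
      by (rule Ck_on_cong_imp[OF S(1), rotated]) (use assms(10) S(2) in \<open>simp add: subset_iff\<close>)
  qed

  have proper: "proper_on ?C f"
    unfolding proper_on_def
  proof (intro allI impI)
    fix K :: "real set" assume K: "compact K"
    let ?S = "{Q\<in>?C. f Q \<in> K}"
    obtain B where B: "B > 0" "\<And>y. y \<in> K \<Longrightarrow> y \<le> B"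
    proof -
      obtain B0 where "\<And>y. y \<in> K \<Longrightarrow> \<bar>y\<bar> \<le> B0"
        using compact_imp_bounded[OF K] unfolding bounded_iff by auto
      then show thesis by (intro that[of "\<bar>B0\<bar> + 1"]) force+
    qed
    have bounds: "\<beta>\<^sub>1 / height Q l (T k) \<le> B"
        "e \<in> ?BE \<Longrightarrow> i \<in> ?BV - e \<Longrightarrow> \<beta>\<^sub>2 / D\<mu> i e Q \<le> B" "\<beta>\<^sub>3 / 2 * (norm (Q - Qref))\<^sup>2 \<le> B"
      if Q: "Q \<in> ?S" and k: "k \<in> {1..N\<^sub>T}" for Q k l e i
    proof -
      have QM: "Q \<in> ?M" using Q C_M by blast
      have h0: "0 \<le> \<beta>\<^sub>1 / height Q l (T k)" if "k \<in> {1..N\<^sub>T}" for k l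
        using height_pos(3)[OF QM T[OF that]] assms(6) by (simp add: less_imp_le)
      have d0: "0 \<le> \<beta>\<^sub>2 / D\<mu> i e Q" if "e \<in> ?BE" "i \<in> ?BV - e" for e i
        using D_pos[OF that QM] assms(7) by simp
      let ?H = "\<Sum>k=1..N\<^sub>T. \<Sum>l\<in>UNIV. \<beta>\<^sub>1 / height Q l (T k)"
      let ?G = "\<Sum>e\<in>?BE. \<Sum>i0\<in>?BV - e. \<beta>\<^sub>2 / D\<mu> i0 e Q"
      let ?N = "\<beta>\<^sub>3 / 2 * (norm (Q - Qref))\<^sup>2"
      have f: "?H + ?G + ?N \<le> B" using B(2)[of "f Q"] assms(10)[OF QM] Q by simp
      have nn: "?H \<ge> 0" "?G \<ge> 0" "?N \<ge> 0"
        using h0 d0 assms(8) by (auto intro!: sum_nonneg mult_nonneg_nonneg)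
      have "\<beta>\<^sub>1 / height Q l (T k) \<le> (\<Sum>l\<in>UNIV. \<beta>\<^sub>1 / height Q l (T k))"
        by (rule member_le_sum) (use h0[OF k] in auto)
      also have "\<dots> \<le> ?H"
        by (rule member_le_sum[where f = "\<lambda>k. \<Sum>l\<in>UNIV. \<beta>\<^sub>1 / height Q l (T k)"])
          (use k h0 in \<open>auto intro!: sum_nonneg\<close>)
      finally show "\<beta>\<^sub>1 / height Q l (T k) \<le> B" using f nn by linarith
      show "?N \<le> B" using f nn by linarith
      show "\<beta>\<^sub>2 / D\<mu> i e Q \<le> B" if ei: "e \<in> ?BE" "i \<in> ?BV - e"
      proof -
        have "\<beta>\<^sub>2 / D\<mu> i e Q \<le> (\<Sum>i0\<in>?BV - e. \<beta>\<^sub>2 / D\<mu> i0 e Q)"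
          by (rule member_le_sum[OF ei(2)]) (use d0[OF ei(1)] in auto)
        also have "\<dots> \<le> ?G"
          by (rule member_le_sum[where f = "\<lambda>e. \<Sum>i0\<in>?BV - e. \<beta>\<^sub>2 / D\<mu> i0 e Q", OF ei(1)])
            (use d0 in \<open>auto intro!: sum_nonneg\<close>)
        finally show ?thesis using f nn by linarith
      qed
    qed
    have N0: "1 \<in> {1..N\<^sub>T}"
    proof -
      obtain \<sigma> where "\<sigma> \<in> \<Delta>" using nonempty by blast
      then obtain \<tau> where "\<tau> \<in> faces 2 \<Delta>" by (rule face_in_2_face)
      then show ?thesis using T_onto by fastforce
    qed
    have "?S \<subseteq> cball Qref (sqrt (2 * B / \<beta>\<^sub>3))"
    proof
      fix Q assume "Q \<in> ?S"
      then have "(norm (Q - Qref))\<^sup>2 \<le> 2 * B / \<beta>\<^sub>3"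
        using bounds(3)[OF _ N0] assms(8) by (simp add: field_simps)
      then have "norm (Q - Qref) \<le> sqrt (2 * B / \<beta>\<^sub>3)" by (rule real_le_rsqrt)
      then show "Q \<in> cball Qref (sqrt (2 * B / \<beta>\<^sub>3))" by (simp add: dist_norm norm_minus_commute)
    qed
    then have "bounded ?S" using bounded_subset bounded_cball by blast
    moreover have "closed ?S"
      unfolding closed_sequential_limits
    proof (intro allI impI)
      fix x l assume "(\<forall>n. x n \<in> ?S) \<and> x \<longlonglongrightarrow> l"
      then have x: "\<And>n. x n \<in> ?S" and lim: "x \<longlonglongrightarrow> l" by auto
      have xM: "x n \<in> ?M" for n using x[of n] C_M by blast
      \<comment> \<open>a common lower bound for heights and distances, from \<open>\<beta>\<^sub>1 / height \<le> B\<close> and \<open>\<beta>\<^sub>2 / D\<mu> \<le> B\<close>\<close>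
      define c where "c = min (\<beta>\<^sub>1 / B) (\<beta>\<^sub>2 / B)"
      have c: "c > 0" using assms(6,7) B(1) by (simp add: c_def)
      have lM: "l \<in> ?M"
      proof (rule limit_in_M_plus[OF xM lim c])
        fix n \<sigma> assume \<sigma>: "\<sigma> \<in> faces 2 \<Delta>"
        then obtain k where k: "k \<in> {1..N\<^sub>T}" "range (T k) = \<sigma>" using T_onto by blast
        have "c \<le> height (x n) l (T k)" for l
        proof -
          have "height (x n) l (T k) > 0" using height_pos(3)[OF xM T[OF k(1)]] .
          moreover have "\<beta>\<^sub>1 / height (x n) l (T k) \<le> B" using bounds(1)[OF x k(1)] .
          ultimately have "\<beta>\<^sub>1 / B \<le> height (x n) l (T k)" using B(1) by (simp add: field_simps)
          then show ?thesis by (simp add: c_def)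
        qed
        then show "\<exists>t\<in>ori \<sigma>. \<forall>l. c \<le> height (x n) l t" using T(2)[OF k(1)] k(2) by blast
      next
        fix n i j k assume *: "{j, k} \<in> ?BE" "i \<in> ?BV" "i \<notin> {j, k}"
        have "D\<mu> i {j, k} (x n) > 0" using D_pos[of "{j, k}" i] * xM by blast
        moreover have "\<beta>\<^sub>2 / D\<mu> i {j, k} (x n) \<le> B" using bounds(2)[OF x N0, of "{j, k}" i n] * by blast
        ultimately have "\<beta>\<^sub>2 / B \<le> D\<mu> i {j, k} (x n)" using B(1) by (simp add: field_simps)
        also have "\<dots> \<le> edge_dist (x n) i j k" using assms(9)[of j k i] * xM by blast
        finally show "c \<le> edge_dist (x n) i j k" by (simp add: c_def)
      qed
      have "l \<in> ?C"
      proof (rule ccontr)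
        \<comment> \<open>path components of an open set are closed in it\<close>
        assume "l \<notin> ?C"
        have "open (?M - ?C)" unfolding M_plus_comp_def by (rule open_non_path_component[OF M_plus_open])
        then have "\<forall>\<^sub>F n in sequentially. x n \<in> ?M - ?C"
          using lim lM \<open>l \<notin> ?C\<close> topological_tendstoD by blast
        then obtain n where "x n \<in> ?M - ?C" unfolding eventually_sequentially by blast
        then show False using x[of n] by blast
      qed
      moreover have "f l \<in> K"
      proof -
        have "Ck_on 0 f ?M" by (rule f_Ck[OF M_plus_open]) (use D_cont in auto)
        then have "continuous_on ?M f" by simp
        then have "(\<lambda>n. f (x n)) \<longlonglongrightarrow> f l"
          by (rule continuous_on_tendsto_compose[OF _ lim lM]) (simp add: xM)
        then show ?thesis
          by (rule closed_sequentially[OF compact_imp_closed[OF K], rotated]) (use x in blast)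
      qed
      ultimately show "l \<in> ?S" by blast
    qed
    ultimately show "compact ?S" by (simp add: compact_eq_bounded_closed)
  qed
  moreover have "riemannian_metric_on (vec_mat ` ?C) (f_metric f) \<and> geodesically_complete (vec_mat ` ?C) (f_metric f)"
    if "\<forall>e\<in>?BE. \<forall>i0\<in>?BV - e. Ck_on 3 (D\<mu> i0 e) ?C"
  proof -
    have "Ck_on 3 f ?C" by (rule f_Ck[OF C_open C_M]) (use that in blast)
    then have "Ck_on 3 (f \<circ> inv vec_mat) (vec_mat ` ?C)" by (rule Ck_on_unvec_mat[OF C_open])
    from graph_metric_complete[OF open_vec_mat_image[OF C_open] this proper_on_unvec_mat[OF proper]]
    show ?thesis unfolding f_metric_eq_graph_metric by (rule conjI)
  qed
  ultimately show ?thesis by blast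
qed

end
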